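(* For all integers $n\geq 55$, \[f(n)<u_n<g(n),\] where $u_n$, $f(n)$, $g(n)$ are as defined in the context.
   Context: $\overline{p}(n)$ denotes the number of overpartitions of $n$ (partitions of $n$ in which the first occurrence of each distinct part may be overlined), and $u_n=\dfrac{\overline{p}(n-1)\overline{p}(n+1)}{\overline{p}(n)^2}$. Let $\mu(m)=\pi\sqrt{m}$. For an integer $n\geq 2$ put $x=\mu(n-1)$, $y=\mu(n)$, $z=\mu(n+1)$, and define \[f(n)=e^{x-2y+z}\,\frac{y^{14}(x^5-x^4-1)(z^5-z^4-1)}{x^7z^7(y^5-y^4+1)^2},\qquad g(n)=e^{x-2y+z}\,\frac{y^{14}(x^5-x^4+1)(z^5-z^4+1)}{x^7z^7(y^5-y^4-1)^2}.\] *)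

theory Defs
  imports "HOL-Analysis.Analysis" "HOL-Library.Multiset"
begin

definition partitions :: "nat \<Rightarrow> nat multiset set" where
  "partitions n = {M. (\<forall>k\<in>set_mset M. 0 < k) \<and> sum_mset M = n}"

text \<open>An overpartition of n: a partition of n together with the set of distinct
  parts whose first occurrence is overlined.\<close>
definition overpartitions :: "nat \<Rightarrow> (nat multiset \<times> nat set) set" where
  "overpartitions n = {(M, S). M \<in> partitions n \<and> S \<subseteq> set_mset M}"

definition overpartition_count :: "nat \<Rightarrow> nat" where
  "overpartition_count n = card (overpartitions n)"

definition u_seq :: "nat \<Rightarrow> real" where
  "u_seq n = real (overpartition_count (n - 1)) * real (overpartition_count (n + 1))
             / real (overpartition_count n) ^ 2"

definition mu :: "real \<Rightarrow> real" where
  "mu m = pi * sqrt m"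

definition f_lower :: "nat \<Rightarrow> real" where
  "f_lower n = (let x = mu (real n - 1); y = mu (real n); z = mu (real n + 1) in
     exp (x - 2*y + z) * (y^14 * (x^5 - x^4 - 1) * (z^5 - z^4 - 1))
       / (x^7 * z^7 * (y^5 - y^4 + 1)^2))"

definition g_upper :: "nat \<Rightarrow> real" where
  "g_upper n = (let x = mu (real n - 1); y = mu (real n); z = mu (real n + 1) in
     exp (x - 2*y + z) * (y^14 * (x^5 - x^4 + 1) * (z^5 - z^4 + 1))
       / (x^7 * z^7 * (y^5 - y^4 - 1)^2))"

end

(*
  Write P(q) for the generating function of the overpartition numbers, mu = pi * sqrt n, and
  phi(x) for 1 - 1/x.  The heart of the matter is
      |p(n) - e^mu / (8 n) * phi(mu)| <= e^(mu/2) / 6     for n >= 289,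
  which for n >= 300 is smaller than the allowed error e^mu / (8 n) * mu^(-5); inserting it for
  n - 1, n, n + 1 gives the claim for n >= 301, and 55 <= n <= 300 is checked by exact integer
  arithmetic.

  By Gauss, P(q) is the reciprocal of sum (-1)^k q^(k^2), so the theta transformation (proved on
  the real axis by Polya's limit of binomial sums and continued analytically) gives
      P(e^(-pi t)) = sqrt t * e^(pi/(4t)) / (2 W(e^(-2 pi/t)))  with W(x) = 1 + x + x^3 + x^6 + ...
  Then p(n) is the mean of P(e^(-pi t)) e^(n pi t) over a path from sigma - i to sigma + i, where
  sigma = 1/(4 sqrt n).  On the arc |t| = 2 sigma, |arg t| <= pi/3 the exponent pi/(4t) + n pi t is
  the real number mu cos(arg t) and the substitution v = sin(arg t / 2) turns the main term into a
  truncated Gaussian integral.  On Re t = sigma the transformation bounds the integrand up to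
  |Im t| = 6 sigma.  Further out, each factor of the product satisfies
      |(1+w)/(1-w)| <= (1+|w|)/(1-|w|) * exp(2 (Re w - |w|)),
  which yields |P(q)| <= P(|q|) exp(2 Re(q/(1-q)) - 2 |q|/(1-|q|)).
*)

theory Submission
  imports Defs "HOL-Complex_Analysis.Complex_Analysis" "HOL-Probability.Distributions" "HOL-Real_Asymp.Real_Asymp"
begin

section \<open>Generating function and Gauss' identity\<close>

text \<open>The size \<open>exp (mu / 2)\<close> of the error is decided where the two kinds of path
  meet: the arc and the line \<open>Re t = \<sigma>\<close> cross at \<open>arg t = pi / 3\<close>
  and \<open>- pi / 3\<close>, where \<open>mu * cos (arg t)\<close> has dropped to
  \<open>mu / 2\<close>. Further along the line \<open>Re (pi / (4 * t))\<close> only decreases. Far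
  out, however, \<open>exp (- 2 * pi / t)\<close> comes close to the unit circle and no lower bound
  for \<open>W\<close> is at hand, so from \<open>6 * \<sigma>\<close> on the product bound takes
  over. It has to win back an excess of \<open>3 / 4 * pi * s\<close> in the exponent, where
  \<open>s = sqrt n\<close>; it does so with a margin of about \<open>0.118 * s - 2\<close>, and
  this is why \<open>s >= 17\<close>, that is 289, is required. The threshold 300 comes from
  comparing \<open>exp (mu / 2)\<close> with a multiple of \<open>mu ^ 7\<close>. The remaining
  range is settled by evaluation through rewriting, which dictates its form: counts from the sparse
  recurrence with square gaps, and reals replaced by scaled integers with explicit rounding
  slack.\<close>

definition bounded_overpartitions :: "nat \<Rightarrow> nat \<Rightarrow> (nat multiset \<times> nat set) set" where
  "bounded_overpartitions m n = {(M, S) \<in> overpartitions n. \<forall>k\<in>#M. k \<le> m}"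

definition bounded_count :: "nat \<Rightarrow> nat \<Rightarrow> nat" where
  "bounded_count m n = card (bounded_overpartitions m n)"

lemma mem_bounded_overpartitions:
  "(M, S) \<in> bounded_overpartitions m n \<longleftrightarrow>
     (\<forall>k\<in>#M. 0 < k \<and> k \<le> m) \<and> sum_mset M = n \<and> S \<subseteq> set_mset M"
  by (auto simp: bounded_overpartitions_def overpartitions_def partitions_def)

lemma bounded_overpartitions_0:
  "bounded_overpartitions 0 n = (if n = 0 then {({#}, {})} else {})"
proof -
  have *: "(\<forall>k\<in>#M. 0 < k \<and> k \<le> 0) \<longleftrightarrow> M = {#}" for M :: "nat multiset"
    by (cases M) auto
  show ?thesis
    unfolding set_eq_iff by (auto simp only: split_paired_All mem_bounded_overpartitions * split: if_splits) auto
qed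

text \<open>If \<open>k\<close> occurs, one copy of it is removed. The overlining survives unless
  that copy was the last one and overlined; then only parts up to \<open>m\<close> remain and
  \<open>k\<close> must be put back into \<open>S\<close>. The three cases are the terms of
  \<open>(1 - X ^ k) * C k = (1 + X ^ k) * C m\<close>, read at coefficient
  \<open>n\<close>.\<close>

lemma bounded_overpartitions_Suc:
  fixes m n :: nat
  defines "k \<equiv> Suc m"
  shows "bounded_overpartitions k n = bounded_overpartitions m n \<union>
     (if k \<le> n then (\<lambda>(M, S). (add_mset k M, S)) ` bounded_overpartitions k (n - k) \<union>
        (\<lambda>(M, S). (add_mset k M, insert k S)) ` bounded_overpartitions m (n - k) else {})"
    (is "?L = ?A \<union> ?B")
proof (intro equalityI subsetI)
  fix p assume "p \<in> ?L"
  then obtain M S where p: "p = (M, S)" and MS: "(M, S) \<in> ?L" by (cases p) auto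
  show "p \<in> ?A \<union> ?B"
  proof (cases "k \<in># M")
    case False
    then have "(M, S) \<in> ?A"
      using MS unfolding mem_bounded_overpartitions k_def by (metis le_Suc_eq)
    then show ?thesis by (simp add: p)
  next
    case True
    then obtain N where N: "M = add_mset k N" by (metis insert_DiffM)
    have kn: "k \<le> n" and sN: "sum_mset N = n - k"
      using MS by (auto simp: mem_bounded_overpartitions N)
    show ?thesis
    proof (cases "k \<in> S \<and> k \<notin># N")
      case False
      then have "(N, S) \<in> bounded_overpartitions k (n - k)"
        using MS sN by (auto simp: mem_bounded_overpartitions N)
      then show ?thesis using kn by (force simp: p N)
    next
      case True
      then have "(N, S - {k}) \<in> bounded_overpartitions m (n - k)"
        using MS sN unfolding mem_bounded_overpartitions N k_def
        by (auto simp: le_Suc_eq)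
      then have "(add_mset k N, insert k (S - {k})) \<in> ?B"
        using kn by force
      then show ?thesis using True by (simp add: p N insert_absorb)
    qed
  qed
next
  fix p assume "p \<in> ?A \<union> ?B"
  then show "p \<in> ?L"
    by (cases p; cases "k \<le> n") (auto simp: mem_bounded_overpartitions k_def le_Suc_eq)
qed

lemma finite_bounded_overpartitions: "finite (bounded_overpartitions m n)"
proof (induction m arbitrary: n)
  case 0
  then show ?case by (simp add: bounded_overpartitions_0)
next
  case (Suc m)
  show ?case
  proof (induction n rule: less_induct)
    case (less n)
    show ?case
      using Suc less by (subst bounded_overpartitions_Suc) auto
  qed
qed

lemma bounded_count_0: "bounded_count 0 n = (if n = 0 then 1 else 0)"
  by (simp add: bounded_count_def bounded_overpartitions_0)

lemma bounded_count_Suc: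
  "bounded_count (Suc m) n = bounded_count m n +
     (if Suc m \<le> n then bounded_count (Suc m) (n - Suc m) + bounded_count m (n - Suc m) else 0)"
proof (cases "Suc m \<le> n")
  case False
  then show ?thesis by (simp add: bounded_count_def bounded_overpartitions_Suc[of m n])
next
  case True
  define k where "k = Suc m"
  define f1 where "f1 = (\<lambda>(M :: nat multiset, S :: nat set). (add_mset k M, S))"
  define f2 where "f2 = (\<lambda>(M :: nat multiset, S :: nat set). (add_mset k M, insert k S))"
  let ?A = "bounded_overpartitions m n"
  let ?B = "f1 ` bounded_overpartitions k (n - k)"
  let ?C = "f2 ` bounded_overpartitions m (n - k)"
  have eq: "bounded_overpartitions k n = ?A \<union> (?B \<union> ?C)"
    using True unfolding k_def f1_def f2_def by (subst bounded_overpartitions_Suc) simp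
  have nk: "k \<notin># M" if "(M, S) \<in> bounded_overpartitions m i" for M S i
    using that by (auto simp: mem_bounded_overpartitions k_def)
  have nk': "k \<notin> S" if "(M, S) \<in> bounded_overpartitions m i" for M S i
    using nk[OF that] that by (auto simp: mem_bounded_overpartitions)
  have d1: "?A \<inter> (?B \<union> ?C) = {}"
  proof -
    have "k \<in># fst p" if "p \<in> ?B \<union> ?C" for p
      using that by (auto simp: f1_def f2_def)
    moreover have "k \<notin># fst p" if "p \<in> ?A" for p
      using nk[of "fst p" "snd p"] that by simp
    ultimately show ?thesis by blast
  qed
  have d2: "?B \<inter> ?C = {}"
    using nk by (auto simp: f1_def f2_def mem_bounded_overpartitions)
  have i1: "inj_on f1 (bounded_overpartitions k (n - k))"
    by (auto simp: inj_on_def f1_def)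
  have i2: "inj_on f2 (bounded_overpartitions m (n - k))"
    using nk' by (auto simp: inj_on_def f2_def insert_ident)
  have "card (bounded_overpartitions k n) = card ?A + (card ?B + card ?C)"
    unfolding eq using d1 d2
    by (subst card_Un_disjoint; simp add: finite_bounded_overpartitions card_Un_disjoint)+
  then show ?thesis
    using True by (simp add: bounded_count_def card_image i1 i2 k_def[symmetric])
qed

lemma bounded_count_eq:
  assumes "n \<le> m"
  shows "bounded_count m n = overpartition_count n"
proof -
  have "k \<le> m" if "(M, S) \<in> overpartitions n" "k \<in># M" for M S k
  proof -
    have "k \<le> sum_mset M" using that(2) by (simp add: sum_mset.remove)
    then show ?thesis using that(1) assms by (auto simp: overpartitions_def partitions_def)
  qed
  then have "bounded_overpartitions m n = overpartitions n"
    by (auto simp: bounded_overpartitions_def)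
  then show ?thesis by (simp add: bounded_count_def overpartition_count_def)
qed

lemma bounded_count_le: "bounded_count m n \<le> overpartition_count n"
proof -
  have "bounded_overpartitions m n \<subseteq> bounded_overpartitions (max m n) n"
    by (auto simp: mem_bounded_overpartitions le_max_iff_disj)
  then have "bounded_count m n \<le> bounded_count (max m n) n"
    unfolding bounded_count_def by (intro card_mono finite_bounded_overpartitions)
  then show ?thesis using bounded_count_eq[of n "max m n"] by simp
qed

section \<open>Formal power series and Gauss' identity\<close>

definition bounded_fps :: "nat \<Rightarrow> 'a :: field fps" where
  "bounded_fps m = Abs_fps (\<lambda>n. of_nat (bounded_count m n))"

lemma bounded_fps_0: "bounded_fps 0 = 1"
  by (rule fps_ext) (simp add: bounded_fps_def bounded_count_0)

lemma bounded_fps_Suc: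
  "bounded_fps (Suc m) * (1 - fps_X ^ Suc m) = bounded_fps m * (1 + fps_X ^ Suc m)"
proof (rule fps_ext)
  fix n
  show "(bounded_fps (Suc m) * (1 - fps_X ^ Suc m)) $ n = (bounded_fps m * (1 + fps_X ^ Suc m)) $ n"
    using bounded_count_Suc[of m n]
    by (simp only: distrib_left right_diff_distrib mult_1_right fps_add_nth fps_sub_nth fps_X_power_mult_right_nth)
      (auto simp: bounded_fps_def)
qed

text \<open>A finite form of Gauss' identity in the style of Shanks. Let \<open>R n\<close> be the right-hand side and \<open>C\<close>
  the generating function for bounded parts. Then \<open>(1 - X\<^sup>n) R n - (1 + X\<^sup>n) R (n - 1)\<close>
  telescopes in \<open>s\<close>, which is what the induction needs because
  \<open>(1 - X\<^sup>n) C n = (1 + X\<^sup>n) C (n - 1)\<close>.\<close>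

lemma gauss_square_finite:
  fixes X :: "'a :: field_char_0 fps"
  defines "X \<equiv> fps_X"
  shows "(1 + 2 * (\<Sum>s=1..n. (-1) ^ s * X ^ (s ^ 2))) * bounded_fps n =
    bounded_fps 0 + (\<Sum>s=1..n. (-1) ^ s * bounded_fps s * X ^ (s * (n + 1)) * (2 * inverse (1 + X ^ s)))"
proof (induction n)
  case 0
  then show ?case by simp
next
  case (Suc m)
  define n where "n = Suc m"
  define C where "C = (bounded_fps :: nat \<Rightarrow> 'a fps)"
  \<comment> \<open>At \<open>s = 0\<close> the general expression
    \<open>C s * 2 / (1 + X ^ s)\<close> is 1 as well, so the summand \<open>bounded_fps 0\<close>
    of the statement becomes the term \<open>s = 0\<close> of \<open>R\<close>.\<close>
  define D where "D = (\<lambda>s. if s = 0 then 1 else C s * (2 * inverse (1 + X ^ s)))"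
  have C: "C (Suc s) * (1 - X ^ Suc s) = C s * (1 + X ^ Suc s)" for s
    unfolding C_def X_def by (rule bounded_fps_Suc)
  have inv: "inverse (1 + X ^ Suc s) * (1 + X ^ Suc s) = 1" for s
    by (rule inverse_mult_eq_1) (simp add: X_def)
  have D1: "D (Suc s) * (1 + X ^ Suc s) = 2 * C (Suc s)" for s
    using inv[of s] by (simp add: D_def mult_ac del: power_Suc)
  have D1': "D s * (1 + X ^ s) = 2 * C s" for s
    using D1 by (cases s) (simp_all add: D_def C_def bounded_fps_0 del: power_Suc)
  have D2: "D (Suc s) * (1 - X ^ Suc s) = 2 * C s" for s
  proof -
    have "D (Suc s) * (1 - X ^ Suc s) = 2 * inverse (1 + X ^ Suc s) * (C (Suc s) * (1 - X ^ Suc s))"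
      by (simp add: D_def mult_ac del: power_Suc)
    also have "\<dots> = 2 * C s * (inverse (1 + X ^ Suc s) * (1 + X ^ Suc s))"
      by (simp only: C mult_ac)
    finally show ?thesis by (simp only: inv mult_1_right)
  qed
  define R where "R = (\<lambda>n. \<Sum>s\<le>n. (-1) ^ s * D s * X ^ (s * (n + 1)))"
  have R: "bounded_fps 0 + (\<Sum>s=1..n. (-1) ^ s * bounded_fps s * X ^ (s * (n + 1)) * (2 * inverse (1 + X ^ s))) = R n" for n
  proof -
    have "R n = D 0 + (\<Sum>s=1..n. (-1) ^ s * D s * X ^ (s * (n + 1)))"
      by (simp add: R_def atMost_atLeast0 sum.atLeast_Suc_atMost)
    then show ?thesis
      by (simp add: D_def C_def bounded_fps_0 mult_ac cong: sum.cong_simp)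
  qed
  define S where "S = (\<lambda>n. 1 + 2 * (\<Sum>s=1..n. (-1) ^ s * X ^ (s ^ 2)))"
  have IH: "S m * C m = R m"
    using Suc unfolding R S_def C_def .
  \<comment> \<open>Since \<open>D s * (1 - X ^ s) = 2 * C (s - 1)\<close> and
    \<open>D s * (1 + X ^ s) = 2 * C s\<close>, the two halves of this term are one expression taken
    at \<open>s\<close> and at \<open>s + 1\<close>, with opposite signs. At \<open>s = 0\<close>
    the factor \<open>1 - X ^ 0\<close> vanishes, so nothing is left over at the lower end.\<close>
  have diff: "(1 - X ^ n) * ((-1) ^ s * D s * X ^ (s * (n + 1))) - (1 + X ^ n) * ((-1) ^ s * D s * X ^ (s * n))
      = (-1) ^ Suc s * X ^ (s * n) * (D s * (1 - X ^ s)) + 2 * ((-1) ^ Suc s * X ^ (Suc s * n) * C s)" for s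
  proof -
    have "2 * ((-1) ^ Suc s * X ^ (Suc s * n) * C s) = (-1) ^ Suc s * X ^ (Suc s * n) * (D s * (1 + X ^ s))"
      by (simp add: D1')
    then show ?thesis by (simp add: algebra_simps power_add)
  qed
  have tele: "(\<Sum>s<j. (-1) ^ Suc s * X ^ (s * n) * (D s * (1 - X ^ s)) + 2 * ((-1) ^ Suc s * X ^ (Suc s * n) * C s))
     = (if j = 0 then 0 else 2 * ((-1) ^ j * X ^ (j * n) * C (j - 1)))" for j
  proof (induction j)
    case 0
    then show ?case by simp
  next
    case (Suc j)
    show ?case
    proof (cases j)
      case 0
      then show ?thesis by (simp add: D_def)
    next
      case (Suc i)
      have "D j * (1 - X ^ j) = 2 * C i" using D2[of i] Suc by simp
      then show ?thesis using Suc.IH Suc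
        by (simp only: sum.lessThan_Suc) (simp add: algebra_simps)
    qed
  qed
  have "(1 - X ^ n) * R n - (1 + X ^ n) * R m =
     (\<Sum>s<n. (1 - X ^ n) * ((-1) ^ s * D s * X ^ (s * (n + 1))) - (1 + X ^ n) * ((-1) ^ s * D s * X ^ (s * n)))
     + (1 - X ^ n) * ((-1) ^ n * D n * X ^ (n * (n + 1)))"
    unfolding R_def n_def
    by (simp add: lessThan_Suc_atMost[symmetric] sum_subtractf sum_distrib_left distrib_left del: power_Suc mult_Suc_right)
  also have "\<dots> = 2 * ((-1) ^ n * X ^ (n * n) * C m) + (1 - X ^ n) * ((-1) ^ n * D n * X ^ (n * (n + 1)))"
    unfolding diff tele by (simp add: n_def)
  also have "(1 - X ^ n) * ((-1) ^ n * D n * X ^ (n * (n + 1))) = (-1) ^ n * X ^ (n * (n + 1)) * (2 * C m)"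
    using D2[of m] by (simp add: n_def mult_ac del: power_Suc mult_Suc_right)
  also have "2 * ((-1) ^ n * X ^ (n * n) * C m) + (-1) ^ n * X ^ (n * (n + 1)) * (2 * C m)
      = 2 * (-1) ^ n * X ^ (n * n) * (C m * (1 + X ^ n))"
    by (simp add: algebra_simps power_add)
  also have "\<dots> = 2 * (-1) ^ n * X ^ (n * n) * (C n * (1 - X ^ n))"
    using C[of m] by (simp add: n_def del: power_Suc mult_Suc_right)
  finally have 1: "(1 - X ^ n) * R n = (1 + X ^ n) * R m + 2 * (-1) ^ n * X ^ (n * n) * (C n * (1 - X ^ n))"
    by (simp add: algebra_simps)
  have "(1 - X ^ n) * (S n * C n) = S n * (C n * (1 - X ^ n))" by (simp add: mult_ac)
  also have "\<dots> = (S m + 2 * (-1) ^ n * X ^ (n * n)) * (C n * (1 - X ^ n))"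
    by (simp add: S_def n_def power2_eq_square algebra_simps del: power_Suc mult_Suc_right)
  also have "\<dots> = S m * C m * (1 + X ^ n) + 2 * (-1) ^ n * X ^ (n * n) * (C n * (1 - X ^ n))"
    using C[of m] unfolding n_def distrib_right by (simp only: mult_ac)
  also have "\<dots> = (1 - X ^ n) * R n" unfolding IH 1 by (simp add: mult_ac)
  finally have "(1 - X ^ n) * (S n * C n) = (1 - X ^ n) * R n" .
  moreover have "1 - X ^ n \<noteq> 0"
  proof
    assume "1 - X ^ n = 0"
    then have "(1 - X ^ n) $ 0 = 0" by simp
    then show False by (simp add: X_def n_def)
  qed
  ultimately have "S n * C n = R n" by simp
  then show ?case unfolding R S_def C_def n_def .
qed

text \<open>Polymorphic because the recurrence for exact values uses real coefficients and the
  analysis uses complex ones.\<close>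

definition overpartition_fps :: "'a :: field fps" where
  "overpartition_fps = Abs_fps (\<lambda>n. of_nat (overpartition_count n))"

text \<open>The sign at \<open>n = k ^ 2\<close> can be written \<open>(-1) ^ n\<close> because
  \<open>k\<close> and \<open>k ^ 2\<close> have the same parity.\<close>

definition theta_fps :: "'a :: field fps" where
  "theta_fps = Abs_fps (\<lambda>n. if n = 0 then 1 else if (\<exists>k. n = k ^ 2) then 2 * (-1) ^ n else 0)"

lemma theta_fps_partial:
  assumes "i \<le> n"
  shows "(1 + 2 * (\<Sum>s=1..n. (-1) ^ s * fps_X ^ (s ^ 2))) $ i = (theta_fps :: 'a :: field fps) $ i"
proof -
  have sgn: "((-1) ^ s * fps_X ^ (s ^ 2)) $ i = (if s ^ 2 = i then (-1) ^ i else 0 :: 'a)" for s :: nat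
    by (cases "even s") (auto simp: fps_X_power_nth)
  have "(\<Sum>s=1..n. if s ^ 2 = i then (-1) ^ i else 0 :: 'a) = (if i \<noteq> 0 \<and> (\<exists>k. i = k ^ 2) then (-1) ^ i else 0)"
  proof (cases "i \<noteq> 0 \<and> (\<exists>k. i = k ^ 2)")
    case True
    then obtain r where r: "i = r ^ 2" "r \<ge> 1" by (metis One_nat_def Suc_leI gr0I zero_power2)
    have "r \<le> r ^ 2" using r(2) by (simp add: power2_eq_square)
    then have rn: "r \<in> {1..n}" using r assms by auto
    have "(if s ^ 2 = i then (-1) ^ i else 0 :: 'a) = (if s = r then (-1) ^ i else 0)" for s
      using r by (simp add: power_eq_iff_eq_base)
    then show ?thesis using True rn by (simp add: sum.delta)
  next
    case False
    then have "s ^ 2 \<noteq> i" if "s \<in> {1..n}" for s using that by auto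
    then show ?thesis using False by (auto intro!: sum.neutral)
  qed
  then show ?thesis
    by (auto simp: theta_fps_def fps_sum_nth sgn numeral_fps_const)
qed

text \<open>The finite form is taken modulo \<open>X ^ (n + 1)\<close>: up to coefficient
  \<open>n\<close> both factors agree with their truncations, and every summand with
  \<open>s >= 1\<close> on the right of the finite identity is divisible by
  \<open>X ^ (n + 1)\<close>.\<close>

theorem theta_overpartition:
  "theta_fps * overpartition_fps = (1 :: 'a :: field_char_0 fps)"
proof (rule fps_ext)
  fix n :: nat
  define S where "S = (1 + 2 * (\<Sum>s=1..n. (-1) ^ s * fps_X ^ (s ^ 2)) :: 'a fps)"
  have "(theta_fps * overpartition_fps :: 'a fps) $ n = (S * bounded_fps n) $ n"
    unfolding fps_mult_nth
  proof (intro sum.cong refl arg_cong2[of _ _ _ _ "(*)"])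
    fix i assume "i \<in> {0..n}"
    then show "(theta_fps :: 'a fps) $ i = S $ i" unfolding S_def by (subst theta_fps_partial) auto
  qed (simp add: overpartition_fps_def bounded_fps_def bounded_count_eq)
  also have "S * bounded_fps n = 1 + fps_X ^ (n + 1) * (\<Sum>s=1..n. (-1) ^ s * bounded_fps s * fps_X ^ ((s - 1) * (n + 1)) * (2 * inverse (1 + fps_X ^ s)))"
    unfolding S_def gauss_square_finite bounded_fps_0 sum_distrib_left[of "fps_X ^ (n + 1)"]
  proof (intro arg_cong2[of _ _ _ _ "(+)"] refl sum.cong)
    fix s assume "s \<in> {1..n}"
    then have "s * (n + 1) = (n + 1) + (s - 1) * (n + 1)" by (cases s) auto
    then have "(fps_X ^ (s * (n + 1)) :: 'a fps) = fps_X ^ (n + 1) * fps_X ^ ((s - 1) * (n + 1))"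
      by (simp only: power_add)
    then show "(-1) ^ s * bounded_fps s * fps_X ^ (s * (n + 1)) * (2 * inverse (1 + fps_X ^ s)) =
      fps_X ^ (n + 1) * ((-1) ^ s * bounded_fps s * fps_X ^ ((s - 1) * (n + 1)) * (2 * inverse (1 + fps_X ^ s :: 'a fps)))"
      by (simp only: mult_ac)
  qed
  also have "\<dots> $ n = (1 :: 'a fps) $ n"
    by (simp only: fps_add_nth fps_X_power_mult_nth) simp
  finally show "(theta_fps * overpartition_fps :: 'a fps) $ n = 1 $ n" .
qed

section \<open>The theta transformation\<close>

lemma sin_ge_cubic:
  fixes x :: real
  assumes "0 \<le> x"
  shows "x - x ^ 3 / 6 \<le> sin x"
proof -
  have "\<bar>sin x - (\<Sum>m<3. sin_coeff m * x ^ m)\<bar> \<le> inverse (fact 3) * \<bar>x\<bar> ^ 3"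
    by (rule Maclaurin_sin_bound)
  moreover have "(\<Sum>m<3. sin_coeff m * x ^ m) = x"
    by (simp add: sin_coeff_def numeral_eq_Suc)
  ultimately have "\<bar>sin x - x\<bar> \<le> x ^ 3 / 6" using assms by (simp add: fact_numeral field_simps)
  then show ?thesis by linarith
qed

lemma sin_ge_half:
  fixes x :: real
  assumes "0 \<le> x" "x \<le> pi / 2"
  shows "x / 2 \<le> sin x"
proof -
  have "x \<le> 8 / 5" using assms(2) pi_less_4 pi_approx by simp
  then have "x * x \<le> 8 / 5 * (8 / 5)" using assms by (intro mult_mono) auto
  then have "x * (x * x) \<le> x * 3" using assms by (intro mult_left_mono) auto
  then show ?thesis using sin_ge_cubic[OF assms(1)] by (simp add: power3_eq_cube)
qed

text \<open>With \<open>b = pi * a / L\<close>, multiplication by \<open>2 * sin b\<close> makes the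
  sum telescope to \<open>sin (2 * L * b) = sin (2 * pi * a) = 0\<close>; and
  \<open>sin b = 0\<close> only when \<open>L\<close> divides \<open>a\<close>.\<close>

lemma sum_cos_odd_multiples:
  fixes L :: nat and a :: nat
  assumes "L > 0"
  shows "(\<Sum>l<L. cos (pi * (2 * real l + 1) * real a / real L)) =
    (if L dvd a then real L * (-1) ^ (a div L) else 0)"
proof (cases "L dvd a")
  case True
  then obtain j where j: "a = L * j" by auto
  have "cos (pi * (2 * real l + 1) * real a / real L) = (-1) ^ j" for l
  proof -
    have "pi * (2 * real l + 1) * real a / real L = real ((2 * l + 1) * j) * pi"
      using assms by (simp add: j field_simps)
    then show ?thesis by (simp only: cos_npi) (simp add: power_mult power_add)
  qed
  then show ?thesis using True assms by (simp add: j)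
next
  case False
  define b where "b = pi * real a / real L"
  have sb: "sin b \<noteq> 0"
  proof
    assume "sin b = 0"
    then obtain i :: int where i: "b = of_int i * pi" by (auto simp: sin_zero_iff_int2)
    then have "real a = of_int i * real L" using assms by (simp add: b_def field_simps)
    then have "real_of_int (int a) = real_of_int (i * int L)" by simp
    then have "int a = i * int L" by (simp only: of_int_eq_iff)
    then have "int L dvd int a" by simp
    then show False using False by simp
  qed
  have tele: "2 * sin b * (\<Sum>l<n. cos (pi * (2 * real l + 1) * real a / real L)) = sin (2 * real n * b)" for n
  proof (induction n)
    case (Suc n)
    have "pi * (2 * real n + 1) * real a / real L = 2 * real n * b + b"
      by (simp add: b_def add_divide_distrib[symmetric] algebra_simps)
    moreover have "2 * sin b * cos (2 * real n * b + b) = sin (2 * real (Suc n) * b) - sin (2 * real n * b)"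
    proof -
      have "sin (2 * real (Suc n) * b) = sin ((2 * real n * b + b) + b)" by (simp add: algebra_simps)
      moreover have "sin (2 * real n * b) = sin ((2 * real n * b + b) - b)" by simp
      ultimately show ?thesis unfolding sin_add sin_diff by (simp add: algebra_simps)
    qed
    ultimately show ?case using Suc by (simp add: distrib_left)
  qed simp
  have "sin (2 * real L * b) = sin (real (2 * a) * pi)" using assms by (simp add: b_def mult_ac)
  then have "sin (2 * real L * b) = 0" by (simp only: sin_npi)
  then show ?thesis using tele[of L] sb False by simp
qed

lemma cos_power_even_expand:
  "(2 * cos x) ^ (2 * m) = real (2 * m choose m) + 2 * (\<Sum>a=1..m. real (2 * m choose (m + a)) * cos (2 * real a * x))"
proof -
  have "complex_of_real ((2 * cos x) ^ (2 * m)) = (cis x + cis (- x)) ^ (2 * m)"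
    by (simp add: complex_eq_iff cis.ctr[symmetric] of_real_power[symmetric] del: of_real_power)
  also have "\<dots> = (\<Sum>k\<le>2 * m. of_nat (2 * m choose k) * cis x ^ k * cis (- x) ^ (2 * m - k))"
    by (rule binomial_ring)
  also have "\<dots> = (\<Sum>k\<le>2 * m. of_nat (2 * m choose k) * cis (2 * (real k - real m) * x))"
  proof (intro sum.cong refl)
    fix k assume "k \<in> {..2 * m}"
    then have "real k * x + real (2 * m - k) * - x = 2 * (real k - real m) * x"
      by (simp add: of_nat_diff algebra_simps)
    then have "cis x ^ k * cis (- x) ^ (2 * m - k) = cis (2 * (real k - real m) * x)"
      using Complex.DeMoivre[of x k] Complex.DeMoivre[of "- x" "2 * m - k"] cis_mult[of "real k * x" "real (2 * m - k) * - x"]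
      by metis
    then show "of_nat (2 * m choose k) * cis x ^ k * cis (- x) ^ (2 * m - k) = of_nat (2 * m choose k) * cis (2 * (real k - real m) * x)"
      by (simp only: mult.assoc)
  qed
  finally have "Re (complex_of_real ((2 * cos x) ^ (2 * m))) = Re \<dots>" by (rule arg_cong)
  then have "(2 * cos x) ^ (2 * m) = (\<Sum>k\<le>2 * m. real (2 * m choose k) * cos (2 * (real k - real m) * x))"
    by simp
  also have "{..2 * m} = {..<m} \<union> ({m} \<union> {m<..2 * m})" by auto
  also have "(\<Sum>k\<in>\<dots>. real (2 * m choose k) * cos (2 * (real k - real m) * x)) =
     (\<Sum>k<m. real (2 * m choose k) * cos (2 * (real k - real m) * x)) + (real (2 * m choose m) +
     (\<Sum>k\<in>{m<..2*m}. real (2 * m choose k) * cos (2 * (real k - real m) * x)))"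
    by (subst sum.union_disjoint; auto)+
  also have "(\<Sum>k\<in>{m<..2*m}. real (2 * m choose k) * cos (2 * (real k - real m) * x)) =
     (\<Sum>a=1..m. real (2 * m choose (m + a)) * cos (2 * real a * x))"
    by (rule sum.reindex_bij_witness[of _ "\<lambda>a. m + a" "\<lambda>k. k - m"]) (auto simp: of_nat_diff)
  also have "(\<Sum>k<m. real (2 * m choose k) * cos (2 * (real k - real m) * x)) =
     (\<Sum>a=1..m. real (2 * m choose (m + a)) * cos (2 * real a * x))"
  proof (rule sum.reindex_bij_witness[of _ "\<lambda>a. m - a" "\<lambda>k. m - k"])
    fix k assume k: "k \<in> {..<m}"
    have "m + (m - k) = 2 * m - k" using k by simp
    then have "(2 * m choose (m + (m - k))) = (2 * m choose k)"
      using k binomial_symmetric[of k "2 * m"] by simp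
    moreover have "cos (2 * real (m - k) * x) = cos (2 * (real k - real m) * x)"
      using k cos_minus[of "2 * (real k - real m) * x"] by (simp add: of_nat_diff algebra_simps)
    ultimately show "real (2 * m choose (m + (m - k))) * cos (2 * real (m - k) * x) =
      real (2 * m choose k) * cos (2 * (real k - real m) * x)" by simp
  qed auto
  finally show ?thesis by simp
qed

definition central_ratio :: "nat \<Rightarrow> nat \<Rightarrow> real" where
  "central_ratio m a = real (2 * m choose (m + a)) / real (2 * m choose m)"

text \<open>Both sides evaluate the sum of \<open>(2 cos x)\<^bsup>2m\<^esup>\<close> over the \<open>x\<close> with \<open>e\<^bsup>2ix\<^esup>\<close> a \<open>2K\<close>-th root of \<open>-1\<close>.\<close>

lemma sum_cos_powers:
  fixes m K :: nat
  assumes "K > 0"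
  shows "1 + 2 * (\<Sum>j. (-1) ^ Suc j * central_ratio m (Suc j * (2 * K))) =
    4 ^ m / (real K * real (2 * m choose m)) * (\<Sum>l<K. cos (pi * (2 * real l + 1) / (4 * real K)) ^ (2 * m))"
proof -
  define L where "L = 2 * K"
  have L: "L > 0" using assms by (simp add: L_def)
  define C where "C = real (2 * m choose m)"
  have C: "C > 0" by (simp add: C_def)
  define x where "x = (\<lambda>l. pi * (2 * real l + 1) / (2 * real L))"
  have "(\<Sum>l<L. (2 * cos (x l)) ^ (2 * m)) =
    (\<Sum>l<L. C + 2 * (\<Sum>a=1..m. real (2 * m choose (m + a)) * cos (2 * real a * x l)))"
    unfolding cos_power_even_expand C_def ..
  also have "\<dots> = real L * C + 2 * (\<Sum>a=1..m. real (2 * m choose (m + a)) * (\<Sum>l<L. cos (2 * real a * x l)))"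
  proof -
    have "(\<Sum>l<L. \<Sum>a=1..m. real (2 * m choose (m + a)) * cos (2 * real a * x l)) =
      (\<Sum>a=1..m. real (2 * m choose (m + a)) * (\<Sum>l<L. cos (2 * real a * x l)))"
      by (subst sum.swap) (simp add: sum_distrib_left)
    then show ?thesis by (simp add: sum.distrib sum_distrib_left[symmetric])
  qed
  also have "(\<lambda>a. \<Sum>l<L. cos (2 * real a * x l)) = (\<lambda>a. if L dvd a then real L * (-1) ^ (a div L) else 0)"
  proof -
    have "2 * real a * x l = pi * (2 * real l + 1) * real a / real L" for a l
      using L by (simp add: x_def)
    then show ?thesis by (simp only: sum_cos_odd_multiples[OF L])
  qed
  also have "(\<Sum>a=1..m. real (2 * m choose (m + a)) * (if L dvd a then real L * (-1) ^ (a div L) else 0)) =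
     (\<Sum>a\<in>{a\<in>{1..m}. L dvd a}. real (2 * m choose (m + a)) * (real L * (-1) ^ (a div L)))"
    by (subst sum.inter_filter) (auto intro!: sum.cong)
  also have "\<dots> = (\<Sum>j\<in>{j. Suc j * L \<le> m}. real (2 * m choose (m + Suc j * L)) * (real L * (-1) ^ Suc j))"
  proof (rule sum.reindex_bij_witness[of _ "\<lambda>j. Suc j * L" "\<lambda>a. a div L - 1"])
    fix a assume "a \<in> {a\<in>{1..m}. L dvd a}"
    then obtain i where i: "a = L * i" "1 \<le> a" "a \<le> m" by (auto elim: dvdE)
    then obtain i' where "i = Suc i'" by (cases i) auto
    then show "Suc (a div L - 1) * L = a" "a div L - 1 \<in> {j. Suc j * L \<le> m}"
      "real (2 * m choose (m + Suc (a div L - 1) * L)) * (real L * (-1) ^ Suc (a div L - 1)) =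
       real (2 * m choose (m + a)) * (real L * (-1) ^ (a div L))"
      using i L by (auto simp: mult.commute)
  qed (use L in auto)
  also have "\<dots> = (\<Sum>j\<in>{j. Suc j * L \<le> m}. real L * C * ((-1) ^ Suc j * central_ratio m (Suc j * L)))"
    using C by (intro sum.cong refl) (simp add: central_ratio_def C_def)
  \<comment> \<open>Binomial coefficients beyond the row are 0, so the sum may run over all
    \<open>j\<close>. This frees the index range from \<open>m\<close> and \<open>K\<close>, as
    dominated convergence for series requires.\<close>
  also have "\<dots> = (\<Sum>j. real L * C * ((-1) ^ Suc j * central_ratio m (Suc j * L)))"
  proof (rule suminf_finite[symmetric])
    have "{j. Suc j * L \<le> m} \<subseteq> {..m}"
    proof
      fix j assume "j \<in> {j. Suc j * L \<le> m}"
      then have "Suc j * L \<le> m" by simp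
      moreover have "Suc j * 1 \<le> Suc j * L" using L by (intro mult_left_mono) auto
      ultimately show "j \<in> {..m}" by simp
    qed
    then show "finite {j. Suc j * L \<le> m}" by (rule finite_subset) simp
  next
    fix j assume "j \<notin> {j. Suc j * L \<le> m}"
    then have "2 * m < m + Suc j * L" by simp
    then show "real L * C * ((-1) ^ Suc j * central_ratio m (Suc j * L)) = 0"
      by (simp add: central_ratio_def binomial_eq_0)
  qed
  also have "\<dots> = real L * C * (\<Sum>j. (-1) ^ Suc j * central_ratio m (Suc j * L))"
  proof (rule suminf_mult)
    show "summable (\<lambda>j. (-1) ^ Suc j * central_ratio m (Suc j * L))"
    proof (rule summable_finite[of "{..m}"])
      fix j assume "j \<notin> {..m}"
      moreover have "Suc j * 1 \<le> Suc j * L" using L by (intro mult_left_mono) auto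
      ultimately have "2 * m < m + Suc j * L" by simp
      then show "(-1) ^ Suc j * central_ratio m (Suc j * L) = 0"
        by (simp add: central_ratio_def binomial_eq_0)
    qed simp
  qed
  finally have 1: "(\<Sum>l<L. (2 * cos (x l)) ^ (2 * m)) =
     real L * C * (1 + 2 * (\<Sum>j. (-1) ^ Suc j * central_ratio m (Suc j * L)))"
    by (simp add: algebra_simps)
  \<comment> \<open>The reflection of \<open>l\<close> to \<open>L - 1 - l\<close> sends the angle
    \<open>x\<close> to \<open>pi - x\<close>, where the even power of cos agrees. Only angles below
    \<open>pi / 2\<close> remain, the range in which \<open>sin x >= x / 2\<close> is available for
    the majorant.\<close>
  have split: "{..<L} = {..<K} \<union> {K..<L}" "{..<K} \<inter> {K..<L} = {}" by (auto simp: L_def)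
  have "(\<Sum>l<L. (2 * cos (x l)) ^ (2 * m)) = (\<Sum>l<K. (2 * cos (x l)) ^ (2 * m)) + (\<Sum>l=K..<L. (2 * cos (x l)) ^ (2 * m))"
    unfolding split(1) by (rule sum.union_disjoint) (auto simp: L_def)
  also have "(\<Sum>l=K..<L. (2 * cos (x l)) ^ (2 * m)) = (\<Sum>l<K. (2 * cos (x l)) ^ (2 * m))"
  proof (rule sum.reindex_bij_witness[of _ "\<lambda>l. L - 1 - l" "\<lambda>l. L - 1 - l"])
    fix l assume l: "l \<in> {K..<L}"
    then have "x (L - 1 - l) = pi - x l"
      using L by (simp add: x_def of_nat_diff field_simps)
    then show "(2 * cos (x (L - 1 - l))) ^ (2 * m) = (2 * cos (x l)) ^ (2 * m)"
      by (simp add: power_mult power_mult_distrib)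
  qed (use L in \<open>auto simp: L_def\<close>)
  finally have 2: "(\<Sum>l<L. (2 * cos (x l)) ^ (2 * m)) = 2 * (\<Sum>l<K. (2 * cos (x l)) ^ (2 * m))" by simp
  have "(\<Sum>l<K. (2 * cos (x l)) ^ (2 * m)) = 4 ^ m * (\<Sum>l<K. cos (x l) ^ (2 * m))"
    by (simp add: power_mult_distrib sum_distrib_left power_mult)
  then have "real L * C * (1 + 2 * (\<Sum>j. (-1) ^ Suc j * central_ratio m (Suc j * L))) = 2 * (4 ^ m * (\<Sum>l<K. cos (x l) ^ (2 * m)))"
    using 1 2 by simp
  then have "1 + 2 * (\<Sum>j. (-1) ^ Suc j * central_ratio m (Suc j * L)) = 2 * (4 ^ m * (\<Sum>l<K. cos (x l) ^ (2 * m))) / (real L * C)"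
    using L C by (simp add: field_simps)
  then show ?thesis using C assms by (simp add: L_def C_def x_def)
qed

section \<open>Gaussian behaviour of binomial coefficients\<close>

lemma central_ratio_Suc:
  assumes "a \<le> m"
  shows "central_ratio m (Suc a) = central_ratio m a * ((real m - real a) / (real m + real a + 1))"
proof -
  have "Suc (m + a) * (2 * m choose Suc (m + a)) = (2 * m - (m + a)) * (2 * m choose (m + a))"
    by (simp only: binomial_absorption binomial_absorb_comp)
  then have "real (Suc (m + a) * (2 * m choose Suc (m + a))) = real ((m - a) * (2 * m choose (m + a)))"
    by simp
  then have "(real m + real a + 1) * real (2 * m choose Suc (m + a)) = (real m - real a) * real (2 * m choose (m + a))"
    using assms by (simp add: of_nat_diff algebra_simps)
  moreover have "real m + real a + 1 > 0" by simp
  ultimately have "real (2 * m choose Suc (m + a)) = real (2 * m choose (m + a)) * ((real m - real a) / (real m + real a + 1))"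
    by (simp only: times_divide_eq_right eq_divide_eq) (simp add: mult_ac)
  then show ?thesis by (simp add: central_ratio_def)
qed

lemma central_ratio_nonneg: "0 \<le> central_ratio m a"
  by (simp add: central_ratio_def)

text \<open>Successive quotients are \<open>1 - (2 * a + 1) / (m + a + 1)\<close>, and the first
  \<open>a\<close> odd numbers add up to \<open>a ^ 2\<close>. The cap \<open>N\<close> replaces the
  varying denominators by a fixed one, so that the product collapses into one Gaussian.\<close>

lemma central_ratio_upper:
  assumes "a \<le> N" "N \<le> m" "0 < m"
  shows "central_ratio m a \<le> exp (- (real a ^ 2 / (real m + real N)))"
  using assms(1)
proof (induction a)
  case (Suc a)
  have "(real m - real a) / (real m + real a + 1) = 1 - (2 * real a + 1) / (real m + real a + 1)"
    by (simp add: field_simps)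
  also have "\<dots> \<le> 1 - (2 * real a + 1) / (real m + real N)"
    using Suc assms by (intro diff_left_mono divide_left_mono mult_pos_pos) auto
  also have "\<dots> \<le> exp (- ((2 * real a + 1) / (real m + real N)))"
    by (rule exp_minus_ge)
  finally have "(real m - real a) / (real m + real a + 1) \<le> exp (- ((2 * real a + 1) / (real m + real N)))" .
  then have "central_ratio m (Suc a) \<le> exp (- (real a ^ 2 / (real m + real N))) * exp (- ((2 * real a + 1) / (real m + real N)))"
    unfolding central_ratio_Suc[OF order.trans[OF Suc_leD[OF Suc.prems] assms(2)]]
    using Suc assms by (intro mult_mono) simp_all
  also have "\<dots> = exp (- (real (Suc a) ^ 2 / (real m + real N)))"
  proof -
    have "real (Suc a) ^ 2 = real a ^ 2 + (2 * real a + 1)" by (simp add: power2_eq_square algebra_simps)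
    then show ?thesis unfolding exp_add[symmetric] by (simp only: add_divide_distrib minus_add_distrib)
  qed
  finally show ?case .
qed (simp add: central_ratio_def)

lemma exp_le_one_minus:
  fixes x :: real
  assumes "x < 1"
  shows "exp (- (x / (1 - x))) \<le> 1 - x"
proof -
  have "1 + x / (1 - x) \<le> exp (x / (1 - x))" by (rule exp_ge_add_one_self)
  moreover have "1 + x / (1 - x) = 1 / (1 - x)" using assms by (simp add: field_simps)
  ultimately show ?thesis using assms by (simp add: exp_minus field_simps)
qed

text \<open>Here \<open>1 - q >= exp (- (q / (1 - q)))\<close> is applied to the same quotients,
  which turns the denominators into \<open>m - a\<close>.\<close>

lemma central_ratio_lower:
  assumes "a \<le> N" "N < m"
  shows "exp (- (real a ^ 2 / (real m - real N))) \<le> central_ratio m a"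
  using assms(1)
proof (induction a)
  case (Suc a)
  define q where "q = (2 * real a + 1) / (real m + real a + 1)"
  have q1: "1 - q = (real m - real a) / (real m + real a + 1)"
    by (simp add: q_def field_simps)
  have q: "q < 1" using Suc assms by (simp add: q_def)
  have "q / (1 - q) = (2 * real a + 1) / (real m - real a)"
    using Suc assms unfolding q1 by (simp add: q_def)
  also have "\<dots> \<le> (2 * real a + 1) / (real m - real N)"
    using Suc assms by (intro divide_left_mono mult_pos_pos) auto
  finally have "exp (- ((2 * real a + 1) / (real m - real N))) \<le> exp (- (q / (1 - q)))" by simp
  also have "\<dots> \<le> 1 - q" by (rule exp_le_one_minus[OF q])
  finally have "exp (- ((2 * real a + 1) / (real m - real N))) \<le> (real m - real a) / (real m + real a + 1)"
    unfolding q1 .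
  then have "exp (- (real a ^ 2 / (real m - real N))) * exp (- ((2 * real a + 1) / (real m - real N))) \<le> central_ratio m (Suc a)"
    unfolding central_ratio_Suc[OF order.trans[OF Suc_leD[OF Suc.prems] less_imp_le[OF assms(2)]]]
    using Suc assms by (intro mult_mono central_ratio_nonneg) simp_all
  moreover have "exp (- (real a ^ 2 / (real m - real N))) * exp (- ((2 * real a + 1) / (real m - real N))) = exp (- (real (Suc a) ^ 2 / (real m - real N)))"
  proof -
    have "real (Suc a) ^ 2 = real a ^ 2 + (2 * real a + 1)" by (simp add: power2_eq_square algebra_simps)
    then show ?thesis unfolding exp_add[symmetric] by (simp only: add_divide_distrib minus_add_distrib)
  qed
  ultimately show ?case by simp
qed (simp add: central_ratio_def)

text \<open>Opens the central binomial coefficient to the Gamma asymptotics of generalised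
  binomials; \<open>Gamma (1 / 2) = sqrt pi\<close> then supplies the constant of the next
  limit.\<close>

lemma gbinomial_neg_half:
  "((-1/2 :: real) gchoose m) = (-1) ^ m * real (2 * m choose m) / 4 ^ m"
proof (induction m)
  case (Suc m)
  have "((-1/2 :: real) gchoose Suc m) * real (Suc m) = ((-1/2) gchoose m) * (-1/2 - real m)"
    using gbinomial_absorption'[of "Suc m" "-1/2 :: real"] gbinomial_mult_1[of "-1/2 :: real" m]
    by (simp add: algebra_simps)
  moreover have "real (2 * Suc m choose Suc m) * real (Suc m) = real (2 * m choose m) * (2 * (2 * real m + 1))"
  proof -
    have "Suc m * (2 * Suc m choose Suc m) = 2 * Suc m * (2 * m + 1 choose m)"
      using Suc_times_binomial[of m "2 * m + 1"] by simp
    then have 1: "(2 * Suc m choose Suc m) = 2 * (2 * m + 1 choose m)"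
    proof -
      assume "Suc m * (2 * Suc m choose Suc m) = 2 * Suc m * (2 * m + 1 choose m)"
      then have "Suc m * (2 * Suc m choose Suc m) = Suc m * (2 * (2 * m + 1 choose m))"
        by (simp only: mult_ac)
      then show ?thesis by (simp only: mult_cancel1) simp
    qed
    have 2: "(2 * m + 1 choose m) = (Suc (2 * m) choose Suc m)"
      using binomial_symmetric[of m "2 * m + 1"] by (simp del: binomial_Suc_Suc)
    have "Suc m * (2 * m + 1 choose m) = (2 * m + 1) * (2 * m choose m)"
      unfolding 2 Suc_times_binomial by simp
    then have "real (Suc m * (2 * m + 1 choose m)) = real ((2 * m + 1) * (2 * m choose m))" by simp
    then show ?thesis unfolding 1 by (simp add: algebra_simps)
  qed
  moreover have "G' * p = (- e * B' / (4 * F)) * p"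
    if "G' * p = (e * B / F) * (-1/2 - q)" "B' * p = B * (2 * (2 * q + 1))" "F > 0" for G' p e B' F B q :: real
  proof -
    have eq: "(- e * B' / (4 * F)) * p = - e * (B' * p) / (4 * F)" by simp
    show ?thesis unfolding eq unfolding that(1,2) using that(3) by (simp add: field_simps)
  qed
  ultimately have "((-1/2 :: real) gchoose Suc m) * real (Suc m) =
    (- ((-1) ^ m) * real (2 * Suc m choose Suc m) / (4 * 4 ^ m)) * real (Suc m)"
    unfolding Suc by simp
  then have "((-1/2 :: real) gchoose Suc m) * real (Suc m) =
    ((-1) ^ Suc m * real (2 * Suc m choose Suc m) / 4 ^ Suc m) * real (Suc m)"
    by (simp only: power_Suc mult_minus1)
  then show ?case by (simp only: mult_cancel_right of_nat_eq_0_iff nat.simps) simp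
qed simp

lemma central_binomial_limit:
  "(\<lambda>m. real (2 * m choose m) * sqrt (real m) / 4 ^ m) \<longlonglongrightarrow> 1 / sqrt pi"
proof -
  have "(\<lambda>n. ((-1/2 :: real) gchoose n) / ((-1) ^ n / exp ((-1/2 + 1) * of_real (ln (real n))))) \<longlonglongrightarrow> inverse (Gamma (- (-1/2)))"
    by (rule gbinomial_asymptotic)
  moreover have "inverse (Gamma (- (-1/2 :: real))) = 1 / sqrt pi"
    by (simp add: Gamma_one_half_real field_simps)
  moreover have "eventually (\<lambda>n. ((-1/2 :: real) gchoose n) / ((-1) ^ n / exp ((-1/2 + 1) * of_real (ln (real n)))) = real (2 * n choose n) * sqrt (real n) / 4 ^ n) sequentially"
    using eventually_gt_at_top[of 0]
  proof eventually_elim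
    case (elim n)
    have "exp ((-1/2 + 1) * ln (real n)) = real n powr (1/2)" using elim by (simp add: powr_def)
    also have "\<dots> = sqrt (real n)" by (rule powr_half_sqrt) simp
    finally show ?case unfolding gbinomial_neg_half by simp
  qed
  ultimately show ?thesis by (simp add: tendsto_cong)
qed


text \<open>Polya's proof: let \<open>K \<rightarrow> \<infinity>\<close> in the previous identity with \<open>m \<sim> 4 K\<^sup>2 / (\<pi> t)\<close>. Both sides converge
  by dominated convergence for series, and the central binomial coefficient supplies \<open>2 / sqrt t\<close>.\<close>

theorem theta_transformation_real:
  fixes t :: real
  assumes t: "t > 0"
  shows "(\<lambda>j. (-1) ^ Suc j * exp (- (pi * real (Suc j) ^ 2 * t))) sums
           ((2 / sqrt t * (\<Sum>l. exp (- (pi * (real l + 1 / 2) ^ 2 / t))) - 1) / 2)" (is "?a sums _")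
    and "summable (\<lambda>l. exp (- (pi * (real l + 1 / 2) ^ 2 / t)))" (is "summable ?b")
proof -
  \<comment> \<open>With \<open>m\<close> close to \<open>c * K ^ 2\<close>, the Gaussian exponent
    \<open>(2 * K * j) ^ 2 / m\<close> tends to \<open>4 * j ^ 2 / c\<close>, which has to be
    \<open>pi * j ^ 2 * t\<close>. The same \<open>c\<close> gives
    \<open>m * sin (x l K) ^ 2\<close> the limit \<open>pi * (l + 1 / 2) ^ 2 / t\<close> on the
    other side.\<close>
  define c where "c = 4 / (pi * t)"
  have c: "c > 0" using t by (simp add: c_def)
  define m where "m = (\<lambda>K. nat \<lfloor>c * real K ^ 2\<rfloor>)"
  have mK: "(\<lambda>K. real (m K) / real K ^ 2) \<longlonglongrightarrow> c"
    unfolding m_def using c by real_asymp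
  have m_top: "filterlim m at_top sequentially"
    unfolding m_def using c by real_asymp
  have m_le: "real (m K) \<le> c * real K ^ 2" for K
    unfolding m_def using c by simp
  have m_pos: "eventually (\<lambda>K. m K > 0) sequentially"
    using m_top[unfolded filterlim_at_top, rule_format, of 1] by eventually_elim simp
  have m_ge: "eventually (\<lambda>K. real (m K) \<ge> c / 2 * real K ^ 2) sequentially"
  proof -
    have "eventually (\<lambda>K. real (m K) / real K ^ 2 > c / 2) sequentially"
      using mK c by (intro order_tendstoD(1)) auto
    then show ?thesis using eventually_gt_at_top[of 0]
      by eventually_elim (simp add: field_simps)
  qed
  have K_lim: "(\<lambda>K. b / real K) \<longlonglongrightarrow> 0" for b by real_asymp

  have lim1: "(\<lambda>K. central_ratio (m K) (Suc j * (2 * K))) \<longlonglongrightarrow> exp (- (pi * real (Suc j) ^ 2 * t))" for j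
  proof (rule tendsto_sandwich)
    define p where "p = 2 * real (Suc j)"
    have p: "real (Suc j * (2 * K)) = p * real K" for K by (simp add: p_def algebra_simps)
    have val: "p ^ 2 / (c + 0) = pi * real (Suc j) ^ 2 * t" "p ^ 2 / (c - 0) = pi * real (Suc j) ^ 2 * t"
      using t by (simp_all add: p_def c_def power2_eq_square algebra_simps)
    have ev: "eventually (\<lambda>K. p / real K < c / 2 \<and> K > 0) sequentially"
      using order_tendstoD(2)[OF K_lim[of p], of "c / 2"] eventually_gt_at_top[of 0] c
      by (auto intro: eventually_conj)
    show "eventually (\<lambda>K. exp (- (p ^ 2 / (real (m K) / real K ^ 2 - p / real K))) \<le> central_ratio (m K) (Suc j * (2 * K))) sequentially"
      using ev m_ge m_pos
    proof eventually_elim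
      case (elim K)
      from elim(1) have K: "K > 0" and pK: "p / real K < c / 2" by auto
      then have "p < c / 2 * real K" by (simp add: pos_divide_less_eq)
      then have "p * real K < c / 2 * real K * real K" using K by (intro mult_strict_right_mono) auto
      then have "p * real K < c / 2 * real K ^ 2" by (simp add: power2_eq_square)
      then have lt: "real (Suc j * (2 * K)) < real (m K)" using elim(2) unfolding p by linarith
      have "exp (- (real (Suc j * (2 * K)) ^ 2 / (real (m K) - real (Suc j * (2 * K))))) \<le> central_ratio (m K) (Suc j * (2 * K))"
        using lt by (intro central_ratio_lower order.refl) (simp only: of_nat_less_iff)
      moreover have "(p * real K) ^ 2 / (real (m K) - p * real K) = p ^ 2 / (real (m K) / real K ^ 2 - p / real K)"
        using K by (simp add: diff_divide_distrib[symmetric] add_divide_distrib[symmetric] field_simps power2_eq_square)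
      ultimately show ?case unfolding p by simp
    qed
    show "eventually (\<lambda>K. central_ratio (m K) (Suc j * (2 * K)) \<le> exp (- (p ^ 2 / (real (m K) / real K ^ 2 + p / real K)))) sequentially"
      using ev m_ge m_pos
    proof eventually_elim
      case (elim K)
      from elim(1) have K: "K > 0" and pK: "p / real K < c / 2" by auto
      then have "p < c / 2 * real K" by (simp add: pos_divide_less_eq)
      then have "p * real K < c / 2 * real K * real K" using K by (intro mult_strict_right_mono) auto
      then have "p * real K < c / 2 * real K ^ 2" by (simp add: power2_eq_square)
      then have lt: "real (Suc j * (2 * K)) < real (m K)" using elim(2) unfolding p by linarith
      have "central_ratio (m K) (Suc j * (2 * K)) \<le> exp (- (real (Suc j * (2 * K)) ^ 2 / (real (m K) + real (Suc j * (2 * K)))))"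
        using lt elim(3) by (intro central_ratio_upper order.refl) (simp_all only: of_nat_less_iff less_imp_le)
      moreover have "(p * real K) ^ 2 / (real (m K) + p * real K) = p ^ 2 / (real (m K) / real K ^ 2 + p / real K)"
        using K by (simp add: diff_divide_distrib[symmetric] add_divide_distrib[symmetric] field_simps power2_eq_square)
      ultimately show ?case unfolding p by simp
    qed
    show "(\<lambda>K. exp (- (p ^ 2 / (real (m K) / real K ^ 2 - p / real K)))) \<longlonglongrightarrow> exp (- (pi * real (Suc j) ^ 2 * t))"
      unfolding val(2)[symmetric] using c by (intro tendsto_intros mK K_lim) simp
    show "(\<lambda>K. exp (- (p ^ 2 / (real (m K) / real K ^ 2 + p / real K)))) \<longlonglongrightarrow> exp (- (pi * real (Suc j) ^ 2 * t))"
      unfolding val(1)[symmetric] using c by (intro tendsto_intros mK K_lim) simp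
  qed
  \<comment> \<open>Majorant for the binomial side: with the cap \<open>N = m <= c * K ^ 2\<close>
    the exponent is at least \<open>2 * j ^ 2 / c >= 2 * j / c\<close> for
    \<open>j >= 1\<close>.\<close>
  define q where "q = exp (- (2 / c))"
  have q: "0 < q" "q < 1" using c by (simp_all add: q_def)
  have bound1: "norm ((-1) ^ Suc j * central_ratio (m K) (Suc j * (2 * K))) \<le> q ^ Suc j" if "m K > 0" for j K
  proof (cases "Suc j * (2 * K) \<le> m K")
    case True
    have K: "K > 0" using that by (cases K) (auto simp: m_def)
    have "central_ratio (m K) (Suc j * (2 * K)) \<le> exp (- (real (Suc j * (2 * K)) ^ 2 / (real (m K) + real (m K))))"
      using True that by (intro central_ratio_upper) auto
    also have "\<dots> \<le> exp (- (real (Suc j) * (2 / c)))"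
    proof -
      have "real (Suc j) * (2 / c) \<le> real (Suc j) ^ 2 * (2 / c)"
        using c by (intro mult_right_mono) (auto simp: power2_eq_square)
      also have "\<dots> = real (Suc j * (2 * K)) ^ 2 / (2 * (c * real K ^ 2))"
        unfolding of_nat_mult using K c by (simp add: power2_eq_square field_simps del: of_nat_Suc)
      also have "\<dots> \<le> real (Suc j * (2 * K)) ^ 2 / (2 * real (m K))"
        using m_le[of K] that c K by (intro divide_left_mono) auto
      finally show ?thesis by simp
    qed
    also have "\<dots> = q ^ Suc j" unfolding q_def exp_of_nat_mult[symmetric] by simp
    finally show ?thesis using central_ratio_nonneg by (simp add: abs_mult)
  next
    case False
    then have "2 * m K < m K + Suc j * (2 * K)" by simp
    then show ?thesis using q by (simp add: central_ratio_def binomial_eq_0)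
  qed
  have sumq: "summable (\<lambda>j. q ^ Suc j)" using q by (simp add: summable_mult)
  have T1: "summable (\<lambda>j. norm (?a j)) \<and>
      (\<lambda>K. \<Sum>j. (-1) ^ Suc j * central_ratio (m K) (Suc j * (2 * K))) \<longlonglongrightarrow> suminf ?a"
  proof -
    have "(\<forall>\<^sub>F K in sequentially. summable (\<lambda>j. norm ((-1) ^ Suc j * central_ratio (m K) (Suc j * (2 * K))))) \<and>
       summable (\<lambda>j. norm (?a j)) \<and>
      (\<lambda>K. \<Sum>j. (-1) ^ Suc j * central_ratio (m K) (Suc j * (2 * K))) \<longlonglongrightarrow> suminf ?a"
    proof (rule tannerys_theorem[where M = "\<lambda>j. q ^ Suc j"])
      show "(\<lambda>K. (-1) ^ Suc j * central_ratio (m K) (Suc j * (2 * K))) \<longlonglongrightarrow> ?a j" for j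
        by (intro tendsto_intros lim1)
      have "\<forall>\<^sub>F x in sequentially \<times>\<^sub>F sequentially. m (snd x) > 0"
        by (rule eventually_compose_filterlim[OF m_pos filterlim_snd])
      then show "\<forall>\<^sub>F (j, K) in sequentially \<times>\<^sub>F sequentially. norm ((-1) ^ Suc j * central_ratio (m K) (Suc j * (2 * K))) \<le> q ^ Suc j"
        by eventually_elim (use bound1 in auto)
    qed (use sumq in auto)
    then show ?thesis by blast
  qed

  define x where "x = (\<lambda>l K. pi * (2 * real l + 1) / (4 * real K))"
  define g where "g = (\<lambda>l K. if l < K then cos (x l K) ^ (2 * m K) else 0)"
  have lim2: "(\<lambda>K. g l K) \<longlonglongrightarrow> ?b l" for l
  proof -
    define b where "b = pi * (2 * real l + 1) / 4"
    have xb: "x l K = b / real K" for K by (simp add: x_def b_def)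
    have val: "c * b ^ 2 = pi * (real l + 1 / 2) ^ 2 / t"
      using t by (simp add: c_def b_def power2_eq_square field_simps)
    have s: "(\<lambda>K. real K * sin (x l K)) \<longlonglongrightarrow> b" unfolding xb by real_asymp
    have s0: "(\<lambda>K. sin (x l K)) \<longlonglongrightarrow> 0" unfolding xb by real_asymp
    have "(\<lambda>K. real (m K) / real K ^ 2 * (real K * sin (x l K)) ^ 2) \<longlonglongrightarrow> c * b ^ 2"
      by (intro tendsto_intros mK s)
    moreover have "eventually (\<lambda>K. real (m K) / real K ^ 2 * (real K * sin (x l K)) ^ 2 = real (m K) * sin (x l K) ^ 2) sequentially"
      using eventually_gt_at_top[of 0] by eventually_elim (simp add: power_mult_distrib)
    ultimately have ms: "(\<lambda>K. real (m K) * sin (x l K) ^ 2) \<longlonglongrightarrow> pi * (real l + 1 / 2) ^ 2 / t"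
      unfolding val[symmetric] by (rule Lim_transform_eventually)
    have ev: "eventually (\<lambda>K. sin (x l K) ^ 2 < 1 \<and> l < K) sequentially"
    proof -
      have "(\<lambda>K. sin (x l K) ^ 2) \<longlonglongrightarrow> 0 ^ 2" by (intro tendsto_intros s0)
      then have "eventually (\<lambda>K. sin (x l K) ^ 2 < 1) sequentially"
        by (rule order_tendstoD(2)) simp
      then show ?thesis using eventually_gt_at_top[of l] by (rule eventually_conj)
    qed
    show ?thesis
    proof (rule tendsto_sandwich)
      show "eventually (\<lambda>K. exp (- (real (m K) * sin (x l K) ^ 2 / (1 - sin (x l K) ^ 2))) \<le> g l K) sequentially"
        using ev
      proof eventually_elim
        case (elim K)
        have "exp (- (sin (x l K) ^ 2 / (1 - sin (x l K) ^ 2))) ^ m K \<le> (1 - sin (x l K) ^ 2) ^ m K"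
          using elim by (intro power_mono exp_le_one_minus) auto
        then show ?case using elim
          by (simp add: g_def power_mult cos_squared_eq exp_of_nat_mult[symmetric])
      qed
      show "eventually (\<lambda>K. g l K \<le> exp (- (real (m K) * sin (x l K) ^ 2))) sequentially"
        using ev
      proof eventually_elim
        case (elim K)
        have "(1 - sin (x l K) ^ 2) ^ m K \<le> exp (- (sin (x l K) ^ 2)) ^ m K"
          using elim by (intro power_mono exp_minus_ge) auto
        then show ?case using elim
          by (simp add: g_def power_mult cos_squared_eq exp_of_nat_mult[symmetric])
      qed
      show "(\<lambda>K. exp (- (real (m K) * sin (x l K) ^ 2))) \<longlonglongrightarrow> ?b l"
        by (intro tendsto_intros ms)
      have "(\<lambda>K. exp (- (real (m K) * sin (x l K) ^ 2 / (1 - sin (x l K) ^ 2)))) \<longlonglongrightarrow> exp (- (pi * (real l + 1 / 2) ^ 2 / t / (1 - 0 ^ 2)))"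
        by (intro tendsto_intros ms s0) simp
      then show "(\<lambda>K. exp (- (real (m K) * sin (x l K) ^ 2 / (1 - sin (x l K) ^ 2)))) \<longlonglongrightarrow> ?b l"
        by simp
    qed
  qed
  \<comment> \<open>Majorant for the cosine side: \<open>m >= c / 2 * K ^ 2\<close> and
    \<open>sin x >= x / 2 >= (2 * l + 1) / (4 * K)\<close> give the exponent
    \<open>c / 32 * (2 * l + 1) ^ 2 >= c / 8 * l\<close>.\<close>
  define q2 where "q2 = exp (- (c / 8))"
  have q2: "0 < q2" "q2 < 1" using c by (simp_all add: q2_def)
  have bound2: "norm (g l K) \<le> q2 ^ l" if mk: "real (m K) \<ge> c / 2 * real K ^ 2" for l K
  proof (cases "l < K")
    case False
    then show ?thesis using q2 by (simp add: g_def)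
  next
    case True
    have "pi * (2 * real l + 1) \<le> pi * (2 * real K)"
      using True by (intro mult_left_mono) auto
    then have x: "0 \<le> x l K" "x l K \<le> pi / 2"
      using True by (simp_all add: x_def field_simps)
    have "2 * (2 * real l + 1) \<le> pi * (2 * real l + 1)"
      using pi_ge_two by (intro mult_right_mono) auto
    then have "2 * (2 * real l + 1) / (4 * real K) \<le> x l K"
      unfolding x_def using True by (intro divide_right_mono) auto
    then have "(2 * real l + 1) / (4 * real K) \<le> x l K / 2" by simp
    also have "\<dots> \<le> sin (x l K)" by (rule sin_ge_half[OF x])
    finally have "((2 * real l + 1) / (4 * real K)) ^ 2 \<le> sin (x l K) ^ 2" by (intro power_mono) auto
    then have "c / 2 * real K ^ 2 * ((2 * real l + 1) / (4 * real K)) ^ 2 \<le> real (m K) * sin (x l K) ^ 2"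
      using mk c by (intro mult_mono) auto
    moreover have "c / 2 * real K ^ 2 * ((2 * real l + 1) / (4 * real K)) ^ 2 = c / 32 * (2 * real l + 1) ^ 2"
      using True by (simp add: power2_eq_square field_simps)
    moreover have "c / 32 * (2 * real l + 1) ^ 2 \<ge> c / 32 * (4 * real l)"
      using c by (intro mult_left_mono) (auto simp: power2_eq_square algebra_simps)
    moreover have "real l * (c / 8) = c / 32 * (4 * real l)" by simp
    ultimately have "real l * (c / 8) \<le> real (m K) * sin (x l K) ^ 2" by linarith
    then have "exp (- (real (m K) * sin (x l K) ^ 2)) \<le> q2 ^ l"
      unfolding q2_def exp_of_nat_mult[symmetric] by simp
    moreover have "(1 - sin (x l K) ^ 2) ^ m K \<le> exp (- (sin (x l K) ^ 2)) ^ m K"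
      by (intro power_mono exp_minus_ge) (simp add: abs_square_le_1)
    moreover have "(1 - sin (x l K) ^ 2) ^ m K \<ge> 0"
      by (intro zero_le_power) (simp add: abs_square_le_1)
    ultimately show ?thesis using True
      by (simp add: g_def power_mult cos_squared_eq exp_of_nat_mult[symmetric])
  qed
  have T2: "summable (\<lambda>l. norm (?b l)) \<and> (\<lambda>K. \<Sum>l. g l K) \<longlonglongrightarrow> suminf ?b"
  proof -
    have "(\<forall>\<^sub>F K in sequentially. summable (\<lambda>l. norm (g l K))) \<and>
       summable (\<lambda>l. norm (?b l)) \<and> (\<lambda>K. \<Sum>l. g l K) \<longlonglongrightarrow> suminf ?b"
    proof (rule tannerys_theorem[where M = "\<lambda>j. q2 ^ j"])
      have "\<forall>\<^sub>F x in sequentially \<times>\<^sub>F sequentially. real (m (snd x)) \<ge> c / 2 * real (snd x) ^ 2"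
        by (rule eventually_compose_filterlim[OF m_ge filterlim_snd])
      then show "\<forall>\<^sub>F (l, K) in sequentially \<times>\<^sub>F sequentially. norm (g l K) \<le> q2 ^ l"
        by eventually_elim (use bound2 in auto)
    qed (use lim2 q2 in auto)
    then show ?thesis by blast
  qed
  have "summable ?b" by (rule summable_norm_cancel[OF conjunct1[OF T2]])
  then show "summable ?b" .

  have fin: "(\<Sum>l. g l K) = (\<Sum>l<K. cos (pi * (2 * real l + 1) / (4 * real K)) ^ (2 * m K))" for K
    by (subst suminf_finite[of "{..<K}"]) (auto simp: g_def x_def)
  define D where "D = (\<lambda>K. real (2 * m K choose m K) * sqrt (real (m K)) / 4 ^ m K)"
  have D: "D \<longlonglongrightarrow> 1 / sqrt pi"
    unfolding D_def using filterlim_compose[OF central_binomial_limit m_top] by simp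
  have lim3: "(\<lambda>K. sqrt (real (m K) / real K ^ 2) / D K * (\<Sum>l. g l K)) \<longlonglongrightarrow> sqrt c / (1 / sqrt pi) * suminf ?b"
    by (rule tendsto_mult[OF tendsto_divide[OF tendsto_real_sqrt[OF mK] D] conjunct2[OF T2]]) simp
  have "(\<lambda>K. 1 + 2 * (\<Sum>j. (-1) ^ Suc j * central_ratio (m K) (Suc j * (2 * K)))) \<longlonglongrightarrow> 1 + 2 * suminf ?a"
    by (intro tendsto_intros conjunct2[OF T1])
  moreover have "eventually (\<lambda>K. 1 + 2 * (\<Sum>j. (-1) ^ Suc j * central_ratio (m K) (Suc j * (2 * K))) =
     sqrt (real (m K) / real K ^ 2) / D K * (\<Sum>l. g l K)) sequentially"
    using eventually_gt_at_top[of 0] m_pos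
  proof eventually_elim
    case (elim K)
    have "sqrt (real (m K) / real K ^ 2) / D K = 4 ^ m K / (real K * real (2 * m K choose m K))"
      using elim by (simp add: D_def real_sqrt_divide)
    then show ?case unfolding fin sum_cos_powers[OF elim(1)] by (simp only:)
  qed
  ultimately have "(\<lambda>K. sqrt (real (m K) / real K ^ 2) / D K * (\<Sum>l. g l K)) \<longlonglongrightarrow> 1 + 2 * suminf ?a"
    by (rule Lim_transform_eventually)
  from LIMSEQ_unique[OF this lim3] have "1 + 2 * suminf ?a = sqrt c / (1 / sqrt pi) * suminf ?b" .
  moreover have "sqrt c / (1 / sqrt pi) = 2 / sqrt t"
    using t by (simp add: c_def real_sqrt_divide real_sqrt_mult)
  ultimately have "suminf ?a = (2 / sqrt t * suminf ?b - 1) / 2" by simp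
  moreover have "?a sums suminf ?a"
    by (rule summable_sums[OF summable_norm_cancel[OF conjunct1[OF T1]]])
  ultimately show "?a sums ((2 / sqrt t * suminf ?b - 1) / 2)"
    by (simp only:)
qed

section \<open>Bounds on the generating function\<close>

lemma conv_radius_ge_1I:
  fixes f :: "nat \<Rightarrow> 'a :: {banach, real_normed_div_algebra}"
  assumes "\<And>n. norm (f n) \<le> C"
  shows "conv_radius f \<ge> 1"
proof (rule conv_radius_geI_ex')
  fix r :: real assume r: "0 < r" "ereal r < 1"
  show "summable (\<lambda>n. f n * of_real r ^ n)"
  proof (rule summable_comparison_test')
    show "summable (\<lambda>n. C * r ^ n)" using r by (intro summable_mult summable_geometric) auto
    show "norm (f n * of_real r ^ n) \<le> C * r ^ n" for n
      using r assms[of n] by (simp add: norm_mult norm_power mult_right_mono)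
  qed
qed

lemma one_minus_power_neq_0:
  fixes q :: complex
  assumes "norm q < 1" "k > 0"
  shows "1 - q ^ k \<noteq> 0"
proof
  assume "1 - q ^ k = 0"
  then have "norm q ^ k = 1" by (metis eq_iff_diff_eq_0 norm_one norm_power)
  moreover have "norm q ^ k < 1" using assms by (simp add: power_less_one_iff)
  ultimately show False by simp
qed

lemma bounded_fps_conv_radius: "fps_conv_radius (bounded_fps m :: complex fps) \<ge> 1"
proof (induction m)
  case 0
  then show ?case by (simp add: bounded_fps_0)
next
  case (Suc m)
  define k where "k = Suc m"
  have rX: "fps_conv_radius (fps_X ^ k :: complex fps) \<ge> 1" by simp
  have r1: "fps_conv_radius (1 - fps_X ^ k :: complex fps) \<ge> 1"
    by (intro fps_conv_radius_diff_ge) auto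
  have ev: "eval_fps (1 - fps_X ^ k) q = 1 - q ^ k" for q :: complex
    by (subst eval_fps_diff) (auto simp: eval_fps_X_power)
  have "min 1 (fps_conv_radius (1 - fps_X ^ k :: complex fps)) \<le> fps_conv_radius (inverse (1 - fps_X ^ k :: complex fps))"
    by (rule fps_conv_radius_inverse) (simp only: ev ball_simps, rule one_minus_power_neq_0, simp_all add: k_def)
  then have r2: "fps_conv_radius (inverse (1 - fps_X ^ k :: complex fps)) \<ge> 1"
    using r1 by (simp add: min_def split: if_splits)
  have inv: "(1 - fps_X ^ k) * inverse (1 - fps_X ^ k) = (1 :: complex fps)"
    by (rule inverse_mult_eq_1') (simp add: k_def)
  have "bounded_fps k = bounded_fps k * ((1 - fps_X ^ k) * inverse (1 - fps_X ^ k) :: complex fps)"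
    by (simp add: inv)
  also have "\<dots> = bounded_fps m * (1 + fps_X ^ k) * inverse (1 - fps_X ^ k)"
    unfolding mult.assoc[symmetric] k_def by (simp only: bounded_fps_Suc)
  finally have eq: "(bounded_fps k :: complex fps) = bounded_fps m * (1 + fps_X ^ k) * inverse (1 - fps_X ^ k)" .
  show ?case unfolding k_def[symmetric] eq
    by (intro fps_conv_radius_mult_ge fps_conv_radius_add_ge Suc r2) auto
qed

lemma eval_bounded_fps:
  fixes q :: complex
  assumes "norm q < 1"
  shows "eval_fps (bounded_fps m) q = (\<Prod>k=1..m. (1 + q ^ k) / (1 - q ^ k))"
proof (induction m)
  case 0
  then show ?case by (simp add: bounded_fps_0)
next
  case (Suc m)
  have r: "ereal (norm q) < fps_conv_radius (bounded_fps j :: complex fps)" for j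
    using assms bounded_fps_conv_radius[of j] by (metis ereal_less(3) less_le_trans)
  have r1: "1 \<le> fps_conv_radius (1 - fps_X ^ Suc m :: complex fps)" "1 \<le> fps_conv_radius (1 + fps_X ^ Suc m :: complex fps)"
    by (intro fps_conv_radius_diff_ge fps_conv_radius_add_ge; simp del: power_Suc)+
  have r1': "ereal (norm q) < fps_conv_radius (1 - fps_X ^ Suc m :: complex fps)" "ereal (norm q) < fps_conv_radius (1 + fps_X ^ Suc m :: complex fps)"
    using assms r1 by (auto intro: less_le_trans[of _ "1::ereal"] simp del: power_Suc)
  have "eval_fps (bounded_fps (Suc m) * (1 - fps_X ^ Suc m)) q = eval_fps (bounded_fps m * (1 + fps_X ^ Suc m)) q"
    by (simp only: bounded_fps_Suc)
  then have "eval_fps (bounded_fps (Suc m)) q * (1 - q ^ Suc m) = eval_fps (bounded_fps m) q * (1 + q ^ Suc m)"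
    by (simp add: eval_fps_mult r r1' eval_fps_diff eval_fps_add eval_fps_X_power del: power_Suc)
  moreover have "1 - q ^ Suc m \<noteq> 0" by (rule one_minus_power_neq_0[OF assms]) simp
  ultimately have "eval_fps (bounded_fps (Suc m)) q = eval_fps (bounded_fps m) q * ((1 + q ^ Suc m) / (1 - q ^ Suc m))"
    by (simp add: field_simps del: power_Suc)
  then show ?case using Suc by simp
qed

lemma bounded_count_sums:
  fixes q :: complex
  assumes "norm q < 1"
  shows "(\<lambda>n. of_nat (bounded_count m n) * q ^ n) sums (\<Prod>k=1..m. (1 + q ^ k) / (1 - q ^ k))"
proof -
  have "ereal (norm q) < fps_conv_radius (bounded_fps m :: complex fps)"
    using assms bounded_fps_conv_radius[of m] by (metis ereal_less(3) less_le_trans)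
  from sums_eval_fps[OF this] show ?thesis
    unfolding eval_bounded_fps[OF assms] by (simp add: bounded_fps_def)
qed

lemma bounded_count_sums_real:
  fixes x :: real
  assumes "0 \<le> x" "x < 1"
  shows "(\<lambda>n. real (bounded_count m n) * x ^ n) sums (\<Prod>k=1..m. (1 + x ^ k) / (1 - x ^ k))"
proof -
  have "(\<lambda>n. complex_of_real (real (bounded_count m n) * x ^ n)) sums complex_of_real (\<Prod>k=1..m. (1 + x ^ k) / (1 - x ^ k))"
    using bounded_count_sums[of "complex_of_real x" m] assms by simp
  then show ?thesis by (simp only: sums_of_real_iff)
qed

text \<open>The first \<open>N\<close> terms are also terms of the series for parts up to
  \<open>N\<close>, whose value is a finite product. Each factor is
  \<open>1 + 2 * y / (1 - y)\<close> with \<open>y = x ^ k <= x\<close>, so the products stay below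
  \<open>exp (2 / (1 - x) ^ 2)\<close> for every \<open>N\<close>.\<close>

lemma overpartition_count_summable:
  fixes x :: real
  assumes "0 \<le> x" "x < 1"
  shows "summable (\<lambda>n. real (overpartition_count n) * x ^ n)"
proof (rule summableI_nonneg_bounded)
  fix N
  have "(\<Sum>n<N. real (overpartition_count n) * x ^ n) = (\<Sum>n<N. real (bounded_count N n) * x ^ n)"
    by (intro sum.cong) (simp_all add: bounded_count_eq)
  also have "\<dots> \<le> (\<Sum>n. real (bounded_count N n) * x ^ n)"
    using assms by (intro sum_le_suminf sums_summable[OF bounded_count_sums_real]) auto
  also have "\<dots> = (\<Prod>k=1..N. (1 + x ^ k) / (1 - x ^ k))"
    using assms by (intro sums_unique[symmetric] bounded_count_sums_real)
  also have "\<dots> \<le> (\<Prod>k=1..N. exp (2 / (1 - x) * x ^ k))"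
  proof (rule prod_mono, intro conjI)
    fix k assume "k \<in> {1..N}"
    then have xk: "x ^ k \<le> x" "0 \<le> x ^ k" using assms power_decreasing[of 1 k x] by auto
    then show "0 \<le> (1 + x ^ k) / (1 - x ^ k)" using assms by simp
    have "(1 + x ^ k) / (1 - x ^ k) = 1 + 2 * x ^ k / (1 - x ^ k)"
      using xk assms by (simp add: field_simps)
    also have "\<dots> \<le> 1 + 2 * x ^ k / (1 - x)"
      using xk assms by (intro add_left_mono divide_left_mono mult_pos_pos) auto
    also have "\<dots> = 1 + 2 / (1 - x) * x ^ k" by simp
    also have "\<dots> \<le> exp (2 / (1 - x) * x ^ k)" by (rule exp_ge_add_one_self)
    finally show "(1 + x ^ k) / (1 - x ^ k) \<le> exp (2 / (1 - x) * x ^ k)" .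
  qed
  also have "\<dots> = exp (2 / (1 - x) * (\<Sum>k=1..N. x ^ k))"
    by (simp add: exp_sum sum_distrib_left)
  also have "\<dots> \<le> exp (2 / (1 - x) * (1 / (1 - x)))"
  proof -
    have "(\<Sum>k=1..N. x ^ k) \<le> (\<Sum>k. x ^ k)"
      using assms by (intro sum_le_suminf summable_geometric) auto
    also have "\<dots> = 1 / (1 - x)" using assms by (intro suminf_geometric) auto
    finally have "2 / (1 - x) * (\<Sum>k=1..N. x ^ k) \<le> 2 / (1 - x) * (1 / (1 - x))"
      using assms by (intro mult_left_mono) auto
    then show ?thesis by (simp only: exp_le_cancel_iff)
  qed
  finally show "(\<Sum>n<N. real (overpartition_count n) * x ^ n) \<le> exp (2 / (1 - x) * (1 / (1 - x)))" .
qed (use assms in auto)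

lemma overpartition_fps_conv_radius: "fps_conv_radius (overpartition_fps :: complex fps) \<ge> 1"
  unfolding fps_conv_radius_def
proof (rule conv_radius_geI_ex')
  fix r :: real assume r: "0 < r" "ereal r < 1"
  have "summable (\<lambda>n. complex_of_real (real (overpartition_count n) * r ^ n))"
    using r by (intro summable_of_real overpartition_count_summable) auto
  then show "summable (\<lambda>n. overpartition_fps $ n * complex_of_real r ^ n)"
    by (simp add: overpartition_fps_def)
qed

definition overpartition_gf :: "complex \<Rightarrow> complex" where
  "overpartition_gf = eval_fps overpartition_fps"

lemma overpartition_gf_sums:
  assumes "norm q < 1"
  shows "(\<lambda>n. of_nat (overpartition_count n) * q ^ n) sums overpartition_gf q"
proof -
  have "ereal (norm q) < fps_conv_radius (overpartition_fps :: complex fps)"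
    using assms overpartition_fps_conv_radius by (metis ereal_less(3) less_le_trans)
  from sums_eval_fps[OF this] show ?thesis by (simp add: overpartition_gf_def overpartition_fps_def)
qed

text \<open>Each coefficient is eventually constant in \<open>m\<close> and bounded by its final
  value, so the full series at \<open>norm q\<close> dominates.\<close>

lemma overpartition_gf_product:
  assumes q: "norm q < 1"
  shows "(\<lambda>m. \<Prod>k=1..m. (1 + q ^ k) / (1 - q ^ k)) \<longlonglongrightarrow> overpartition_gf q"
proof -
  have "(\<forall>\<^sub>F m in sequentially. summable (\<lambda>n. norm (of_nat (bounded_count m n) * q ^ n))) \<and>
    summable (\<lambda>n. norm (of_nat (overpartition_count n) * q ^ n)) \<and>
    (\<lambda>m. \<Sum>n. of_nat (bounded_count m n) * q ^ n) \<longlonglongrightarrow> (\<Sum>n. of_nat (overpartition_count n) * q ^ n)"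
  proof (rule tannerys_theorem[where M = "\<lambda>n. real (overpartition_count n) * norm q ^ n"])
    fix n
    have "\<forall>\<^sub>F m in sequentially. of_nat (bounded_count m n) * q ^ n = of_nat (overpartition_count n) * q ^ n"
      using eventually_ge_at_top[of n] by eventually_elim (simp add: bounded_count_eq)
    then show "(\<lambda>m. of_nat (bounded_count m n) * q ^ n) \<longlonglongrightarrow> of_nat (overpartition_count n) * q ^ n"
      by (rule tendsto_eventually)
  qed (use q in \<open>auto simp: norm_mult norm_power bounded_count_le intro!: overpartition_count_summable mult_right_mono always_eventually\<close>)
  then show ?thesis
    using sums_unique[OF bounded_count_sums[OF q]] sums_unique[OF overpartition_gf_sums[OF q]] by simp
qed

text \<open>The function \<open>Ln (1 + w) - Ln (1 - w) - 2 w\<close> has non-negative Taylor coefficients, so its real part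
  on a circle is largest at the positive real point.\<close>

lemma norm_one_plus_over_one_minus_le:
  assumes w: "norm (w :: complex) < 1"
  shows "norm ((1 + w) / (1 - w)) \<le> (1 + norm w) / (1 - norm w) * exp (2 * (Re w - norm w))"
proof -
  \<comment> \<open>The coefficients of \<open>2 * artanh\<close>, without the linear one. Keeping
    the linear term out of the comparison retains \<open>Re w - norm w\<close> exactly, and for
    \<open>w = q ^ k\<close> these add up to geometric series.\<close>
  define c where "c = (\<lambda>n. if odd n \<and> n \<noteq> 1 then 2 / real n else 0)"
  have ser: "(\<lambda>n. of_real (c n) * z ^ n) sums (Ln (1 + z) - Ln (1 - z) - 2 * z)" if z: "norm z < 1" for z :: complex
  proof -
    have "(\<lambda>n. (-1) ^ Suc n / of_nat n * z ^ n - (-1) ^ Suc n / of_nat n * (- z) ^ n - (if n = 1 then 2 * z else 0)) sums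
       (Ln (1 + z) - Ln (1 + - z) - 2 * z)"
      using z by (intro sums_diff Ln_series sums_single) auto
    moreover have "(-1) ^ Suc n / of_nat n * z ^ n - (-1) ^ Suc n / of_nat n * (- z) ^ n - (if n = 1 then 2 * z else 0) = of_real (c n) * z ^ n" for n
      by (cases "even n") (auto simp: c_def power_minus_odd)
    ultimately show ?thesis by simp
  qed
  have e: "exp (Ln (1 + z) - Ln (1 - z) - 2 * z) = (1 + z) / (1 - z) * exp (- (2 * z))" if z: "norm z < 1" for z :: complex
  proof -
    have "1 + z \<noteq> 0" "1 - z \<noteq> 0" using z by (auto simp: add_eq_0_iff)
    from exp_Ln[OF this(1)] exp_Ln[OF this(2)] show ?thesis by (simp only: exp_diff exp_minus divide_inverse)
  qed
  define r where "r = complex_of_real (norm w)"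
  have r: "norm r < 1" using w by (simp add: r_def)
  have "Re (Ln (1 + w) - Ln (1 - w) - 2 * w) \<le> Re (Ln (1 + r) - Ln (1 - r) - 2 * r)"
  proof (rule sums_le)
    show "(\<lambda>n. Re (of_real (c n) * w ^ n)) sums Re (Ln (1 + w) - Ln (1 - w) - 2 * w)"
      by (rule sums_Re[OF ser[OF w]])
    show "(\<lambda>n. Re (of_real (c n) * r ^ n)) sums Re (Ln (1 + r) - Ln (1 - r) - 2 * r)"
      by (rule sums_Re[OF ser[OF r]])
    fix n
    have "Re (of_real (c n) * w ^ n) = c n * Re (w ^ n)" by simp
    also have "\<dots> \<le> c n * norm (w ^ n)"
      by (intro mult_left_mono complex_Re_le_cmod) (simp add: c_def)
    also have "\<dots> = Re (of_real (c n) * r ^ n)"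
      by (simp add: r_def norm_power of_real_power[symmetric] del: of_real_power)
    finally show "Re (of_real (c n) * w ^ n) \<le> Re (of_real (c n) * r ^ n)" .
  qed
  then have "norm (exp (Ln (1 + w) - Ln (1 - w) - 2 * w)) \<le> norm (exp (Ln (1 + r) - Ln (1 - r) - 2 * r))"
    by simp
  then have "norm ((1 + w) / (1 - w)) * exp (- (2 * Re w)) \<le> norm ((1 + r) / (1 - r)) * exp (- (2 * norm w))"
    unfolding e[OF w] e[OF r] norm_mult by (simp add: r_def)
  moreover have "norm ((1 + r) / (1 - r)) = (1 + norm w) / (1 - norm w)"
  proof -
    have "(1 + r) / (1 - r) = complex_of_real ((1 + norm w) / (1 - norm w))" by (simp add: r_def)
    then show ?thesis using w by (simp only: norm_of_real) simp
  qed
  ultimately have "norm ((1 + w) / (1 - w)) * exp (- (2 * Re w)) * exp (2 * Re w) \<le> (1 + norm w) / (1 - norm w) * exp (- (2 * norm w)) * exp (2 * Re w)"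
    by (intro mult_right_mono) auto
  moreover have "exp (- (2 * Re w)) * exp (2 * Re w) = 1"
    and "exp (- (2 * norm w)) * exp (2 * Re w) = exp (2 * (Re w - norm w))"
    by (simp_all add: exp_add[symmetric])
  ultimately show ?thesis by (simp only: mult.assoc mult_1_right)
qed

lemma norm_overpartition_gf_le:
  assumes q: "norm q < 1"
  shows "norm (overpartition_gf q) \<le>
    Re (overpartition_gf (of_real (norm q))) * exp (2 * (Re (q / (1 - q)) - norm q / (1 - norm q)))"
proof (rule LIMSEQ_le)
  define r where "r = norm q"
  have r: "0 \<le> r" "r < 1" using q by (auto simp: r_def)
  have geo: "(\<lambda>m. \<Sum>k=1..m. z ^ k) \<longlonglongrightarrow> z / (1 - z)" if "norm z < 1" for z :: complex
  proof -
    have "(\<lambda>k. z ^ Suc k) sums (z * (1 / (1 - z)))"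
      unfolding power_Suc using that by (intro sums_mult geometric_sums)
    then have "(\<lambda>m. \<Sum>k<m. z ^ Suc k) \<longlonglongrightarrow> z / (1 - z)" by (simp add: sums_def)
    moreover have "(\<Sum>k<m. z ^ Suc k) = (\<Sum>k=1..m. z ^ k)" for m
      by (rule sum.reindex_bij_witness[of _ "\<lambda>k. k - 1" Suc]) auto
    ultimately show ?thesis by simp
  qed
  have geor: "(\<lambda>m. \<Sum>k=1..m. r ^ k) \<longlonglongrightarrow> r / (1 - r)"
  proof -
    have "(\<lambda>m. Re (\<Sum>k=1..m. of_real r ^ k)) \<longlonglongrightarrow> Re (of_real r / (1 - of_real r))"
      using r by (intro tendsto_Re geo) auto
    moreover have "(of_real r / (1 - of_real r) :: complex) = of_real (r / (1 - r))"
      and "(\<Sum>k=1..m. of_real r ^ k) = complex_of_real (\<Sum>k=1..m. r ^ k)" for m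
      by simp_all
    ultimately show ?thesis by (simp only: Re_complex_of_real)
  qed
  show "(\<lambda>m. norm (\<Prod>k=1..m. (1 + q ^ k) / (1 - q ^ k))) \<longlonglongrightarrow> norm (overpartition_gf q)"
    by (intro tendsto_norm overpartition_gf_product q)
  show "(\<lambda>m. Re (\<Prod>k=1..m. (1 + of_real (norm q) ^ k) / (1 - of_real (norm q) ^ k)) * exp (2 * (Re (\<Sum>k=1..m. q ^ k) - (\<Sum>k=1..m. norm q ^ k))))
     \<longlonglongrightarrow> Re (overpartition_gf (of_real (norm q))) * exp (2 * (Re (q / (1 - q)) - norm q / (1 - norm q)))"
    using q geor by (intro tendsto_intros overpartition_gf_product geo) (auto simp: r_def)
  show "\<exists>N. \<forall>m\<ge>N. norm (\<Prod>k=1..m. (1 + q ^ k) / (1 - q ^ k)) \<le>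
     Re (\<Prod>k=1..m. (1 + of_real (norm q) ^ k) / (1 - of_real (norm q) ^ k)) * exp (2 * (Re (\<Sum>k=1..m. q ^ k) - (\<Sum>k=1..m. norm q ^ k)))"
  proof (intro exI allI impI)
    fix m
    have "norm (\<Prod>k=1..m. (1 + q ^ k) / (1 - q ^ k)) = (\<Prod>k=1..m. norm ((1 + q ^ k) / (1 - q ^ k)))"
      by (rule prod_norm[symmetric])
    also have "\<dots> \<le> (\<Prod>k=1..m. (1 + r ^ k) / (1 - r ^ k) * exp (2 * (Re (q ^ k) - r ^ k)))"
    proof (intro prod_mono conjI)
      fix k assume "k \<in> {1..m}"
      then have "norm (q ^ k) < 1" using q by (simp add: norm_power power_less_one_iff)
      from norm_one_plus_over_one_minus_le[OF this]
      show "norm ((1 + q ^ k) / (1 - q ^ k)) \<le> (1 + r ^ k) / (1 - r ^ k) * exp (2 * (Re (q ^ k) - r ^ k))"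
        by (simp add: norm_power r_def)
    qed simp
    also have "\<dots> = (\<Prod>k=1..m. (1 + r ^ k) / (1 - r ^ k)) * exp (2 * (Re (\<Sum>k=1..m. q ^ k) - (\<Sum>k=1..m. r ^ k)))"
      by (simp only: prod.distrib) (simp add: exp_sum[symmetric] sum_distrib_left[symmetric] sum_subtractf)
    also have "(\<Prod>k=1..m. (1 + r ^ k) / (1 - r ^ k)) = Re (of_real (\<Prod>k=1..m. (1 + r ^ k) / (1 - r ^ k)))" by (rule Re_complex_of_real[symmetric])
    also have "complex_of_real (\<Prod>k=1..m. (1 + r ^ k) / (1 - r ^ k)) = (\<Prod>k=1..m. (1 + of_real r ^ k) / (1 - of_real r ^ k))"
      by simp
    finally show "norm (\<Prod>k=1..m. (1 + q ^ k) / (1 - q ^ k)) \<le>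
     Re (\<Prod>k=1..m. (1 + of_real (norm q) ^ k) / (1 - of_real (norm q) ^ k)) * exp (2 * (Re (\<Sum>k=1..m. q ^ k) - (\<Sum>k=1..m. norm q ^ k)))"
      unfolding r_def .
  qed
qed

section \<open>The transformation of the generating function\<close>

text \<open>Taking \<open>exp (- (pi / (4 * t)))\<close> out of the transformed theta series leaves
  \<open>exp (- (pi * l * (l + 1) / t))\<close>, a power of \<open>x = exp (- (2 * pi / t))\<close>
  with triangular exponent. As a power series in \<open>x\<close> it is holomorphic in the disc and
  close to 1 for small \<open>x\<close>.\<close>

definition triangular_fps :: "complex fps" where
  "triangular_fps = Abs_fps (\<lambda>n. if \<exists>l. n = l * (l + 1) div 2 then 1 else 0)"

definition triangular_gf :: "complex \<Rightarrow> complex" where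
  "triangular_gf = eval_fps triangular_fps"

lemma triangular_fps_conv_radius: "fps_conv_radius triangular_fps \<ge> 1"
  unfolding fps_conv_radius_def
  by (rule conv_radius_ge_1I[of _ 1]) (simp add: triangular_fps_def)

lemma theta_fps_conv_radius: "fps_conv_radius (theta_fps :: complex fps) \<ge> 1"
  unfolding fps_conv_radius_def
  by (rule conv_radius_ge_1I[of _ 2]) (simp add: theta_fps_def norm_mult norm_power)

lemma triangular_fps_nth_0: "triangular_fps $ 0 = 1"
  by (simp add: triangular_fps_def) (rule exI[of _ 0], simp)

lemma triangular_gf_sums:
  assumes "norm x < 1"
  shows "(\<lambda>n. triangular_fps $ n * x ^ n) sums triangular_gf x"
  unfolding triangular_gf_def
  using assms triangular_fps_conv_radius
  by (intro sums_eval_fps) (auto intro: less_le_trans[of _ "1 :: ereal"])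

lemma norm_triangular_gf_diff:
  assumes x: "norm x < 1"
  shows "norm (triangular_gf x - 1) \<le> norm x / (1 - norm x)"
proof -
  have "(\<lambda>n. triangular_fps $ Suc n * x ^ Suc n) sums (triangular_gf x - 1)"
    using triangular_gf_sums[OF x] by (subst sums_Suc_iff) (simp add: triangular_fps_nth_0)
  then have eq: "triangular_gf x - 1 = (\<Sum>n. triangular_fps $ Suc n * x ^ Suc n)"
    by (rule sums_unique)
  have geo: "(\<lambda>n. norm x * norm x ^ n) sums (norm x * (1 / (1 - norm x)))"
    using x by (intro sums_mult geometric_sums) auto
  have "norm (\<Sum>n. triangular_fps $ Suc n * x ^ Suc n) \<le> (\<Sum>n. norm x * norm x ^ n)"
    by (rule norm_suminf_le) (use geo in \<open>auto simp: triangular_fps_def norm_mult norm_power sums_iff mult_left_le_one_le\<close>)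
  also have "\<dots> = norm x / (1 - norm x)" using sums_unique[OF geo] by simp
  finally show ?thesis unfolding eq .
qed

lemma triangular_gf_exp_sums:
  fixes t :: real
  assumes "t > 0"
  shows "(\<lambda>l. complex_of_real (exp (- (pi * real l * (real l + 1) / t)))) sums
           triangular_gf (of_real (exp (- (2 * pi / t))))"
proof -
  define x where "x = exp (- (2 * pi / t))"
  have x: "norm (complex_of_real x) < 1" using assms by (simp add: x_def)
  define g where "g = (\<lambda>l :: nat. l * (l + 1) div 2)"
  have g2: "2 * g l = l * (l + 1)" for l by (simp add: g_def)
  have "strict_mono g"
  proof (rule strict_monoI_Suc)
    fix l show "g l < g (Suc l)" using g2[of l] g2[of "Suc l"] by simp
  qed
  then have "(\<lambda>l. triangular_fps $ g l * of_real x ^ g l) sums triangular_gf (of_real x)"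
    by (subst sums_mono_reindex[where f = "\<lambda>n. triangular_fps $ n * of_real x ^ n"])
      (use triangular_gf_sums[OF x] in \<open>auto simp: triangular_fps_def g_def\<close>)
  moreover have "triangular_fps $ g l * of_real x ^ g l = complex_of_real (exp (- (pi * real l * (real l + 1) / t)))" for l
  proof -
    have "real (2 * g l) = real (l * (l + 1))" by (simp only: g2)
    then have "real (g l) * 2 = real l * (real l + 1)" by (simp add: algebra_simps)
    moreover have "real (g l) * - (2 * pi / t) = - (pi * (real (g l) * 2) / t)" by simp
    ultimately have "real (g l) * - (2 * pi / t) = - (pi * real l * (real l + 1) / t)" by (simp only: mult.assoc)
    then have "x ^ g l = exp (- (pi * real l * (real l + 1) / t))"
      unfolding x_def exp_of_nat_mult[symmetric] by (rule arg_cong)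
    moreover have "triangular_fps $ g l = 1" by (auto simp: triangular_fps_def g_def)
    ultimately show ?thesis by (simp only: of_real_power[symmetric] mult_1_left)
  qed
  ultimately show ?thesis by (simp add: x_def)
qed

lemma overpartition_gf_transformation_real:
  fixes t :: real
  assumes t: "t > 0"
  shows "overpartition_gf (of_real (exp (- (pi * t)))) *
    (2 * of_real (exp (- (pi / (4 * t)))) * triangular_gf (of_real (exp (- (2 * pi / t))))) = of_real (sqrt t)"
proof -
  define q where "q = exp (- (pi * t))"
  define B where "B = (\<Sum>l. exp (- (pi * (real l + 1 / 2) ^ 2 / t)))"
  define Q where "Q = complex_of_real q"
  have q: "norm Q < 1" using t by (simp add: Q_def q_def)
  have r: "ereal (norm Q) < fps_conv_radius (theta_fps :: complex fps)" "ereal (norm Q) < fps_conv_radius (overpartition_fps :: complex fps)"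
    using q theta_fps_conv_radius overpartition_fps_conv_radius
    by (auto intro: less_le_trans[of _ "1 :: ereal"])
  have "eval_fps (theta_fps * overpartition_fps) Q = 1"
    by (simp add: theta_overpartition)
  then have 1: "eval_fps theta_fps Q * overpartition_gf Q = 1"
    using r by (simp add: eval_fps_mult overpartition_gf_def)
  have "strict_mono (\<lambda>j :: nat. j ^ 2)" by (rule strict_monoI) (simp add: power_strict_mono)
  then have "(\<lambda>j. theta_fps $ (j ^ 2) * Q ^ (j ^ 2)) sums eval_fps theta_fps Q"
    by (subst sums_mono_reindex[where f = "\<lambda>n. theta_fps $ n * Q ^ n"])
      (use sums_eval_fps[OF r(1)] in \<open>auto simp: theta_fps_def\<close>)
  then have "(\<lambda>j. theta_fps $ (Suc j ^ 2) * Q ^ (Suc j ^ 2)) sums (eval_fps theta_fps Q - 1)"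
    by (subst sums_Suc_iff) (simp add: theta_fps_def)
  moreover have "theta_fps $ (Suc j ^ 2) * Q ^ (Suc j ^ 2) = of_real (2 * ((-1) ^ Suc j * exp (- (pi * real (Suc j) ^ 2 * t))))" for j
  proof -
    have "(-1) ^ (Suc j ^ 2) = ((-1) ^ Suc j :: complex)" by (cases "even (Suc j)") auto
    then have "theta_fps $ (Suc j ^ 2) = (2 * (-1) ^ Suc j :: complex)"
      by (auto simp: theta_fps_def)
    moreover have "q ^ (Suc j ^ 2) = exp (- (pi * real (Suc j) ^ 2 * t))"
      unfolding q_def exp_of_nat_mult[symmetric] by (simp add: mult_ac)
    moreover have "Q ^ (Suc j ^ 2) = of_real (q ^ (Suc j ^ 2))" by (simp add: Q_def)
    ultimately show ?thesis by (simp only:) simp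
  qed
  ultimately have "(\<lambda>j. complex_of_real (2 * ((-1) ^ Suc j * exp (- (pi * real (Suc j) ^ 2 * t))))) sums (eval_fps theta_fps Q - 1)"
    by (simp only:)
  moreover have "(\<lambda>j. complex_of_real (2 * ((-1) ^ Suc j * exp (- (pi * real (Suc j) ^ 2 * t))))) sums of_real (2 * ((2 / sqrt t * B - 1) / 2))"
    unfolding B_def by (intro sums_of_real sums_mult theta_transformation_real t)
  ultimately have "eval_fps theta_fps Q - 1 = of_real (2 * ((2 / sqrt t * B - 1) / 2))"
    by (rule sums_unique2)
  also have "2 * ((2 / sqrt t * B - 1) / 2) = 2 / sqrt t * B - 1" by simp
  finally have 2: "eval_fps theta_fps Q = of_real (2 / sqrt t * B)"
    unfolding of_real_diff by simp
  have "(\<lambda>l. complex_of_real (exp (- (pi * (real l + 1 / 2) ^ 2 / t)))) sums of_real B"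
    unfolding B_def by (intro sums_of_real summable_sums theta_transformation_real t)
  moreover have "(\<lambda>l. of_real (exp (- (pi / (4 * t)))) * complex_of_real (exp (- (pi * real l * (real l + 1) / t)))) sums
     (of_real (exp (- (pi / (4 * t)))) * triangular_gf (of_real (exp (- (2 * pi / t)))))"
    by (intro sums_mult triangular_gf_exp_sums t)
  moreover have "of_real (exp (- (pi / (4 * t)))) * complex_of_real (exp (- (pi * real l * (real l + 1) / t))) = complex_of_real (exp (- (pi * (real l + 1 / 2) ^ 2 / t)))" for l
  proof -
    have "- (pi / (4 * t)) + - (pi * real l * (real l + 1) / t) = - (pi * (real l + 1 / 2) ^ 2 / t)"
      using t by (simp add: power2_eq_square field_simps)
    then show ?thesis by (simp only: of_real_mult[symmetric] exp_add[symmetric])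
  qed
  ultimately have "of_real B = of_real (exp (- (pi / (4 * t)))) * triangular_gf (of_real (exp (- (2 * pi / t))))"
    by (simp only:) (rule sums_unique2)
  then have "overpartition_gf Q * (2 * of_real (exp (- (pi / (4 * t)))) * triangular_gf (of_real (exp (- (2 * pi / t)))))
     = overpartition_gf Q * (2 * of_real B)" by (simp add: mult_ac)
  also have "\<dots> = overpartition_gf Q * (of_real (sqrt t) * eval_fps theta_fps Q)"
    unfolding 2 using t by simp
  also have "\<dots> = of_real (sqrt t) * (eval_fps theta_fps Q * overpartition_gf Q)" by (simp only: mult_ac)
  finally show ?thesis unfolding 1 mult_1_right unfolding Q_def q_def .
qed

lemma ball_subset_eball:
  assumes "1 \<le> r"
  shows "ball (0 :: complex) 1 \<subseteq> eball 0 r"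
proof
  fix x :: complex assume "x \<in> ball 0 1"
  then have "ereal (norm x) < 1" by simp
  also note assms
  finally show "x \<in> eball 0 r" by simp
qed

lemma Re_divide_of_real_left: "Re (of_real a / z) = a * Re z / (norm z) ^ 2"
  by (simp add: Re_divide cmod_power2)

text \<open>In product form both sides are holomorphic on the whole half-plane, whatever the zeros
  of \<open>triangular_gf\<close> may be, so the identity theorem applies directly from the positive
  axis. Division is postponed to the region where the factor is near 1.\<close>

theorem overpartition_gf_transformation:
  fixes t :: complex
  assumes t: "Re t > 0"
  shows "overpartition_gf (exp (- (pi * t))) * (2 * exp (- (pi / (4 * t))) * triangular_gf (exp (- (2 * pi / t)))) = csqrt t"
proof -
  define S where "S = {t. Re t > 0}"
  define f where "f = (\<lambda>t :: complex. overpartition_gf (exp (- (pi * t))) * (2 * exp (- (pi / (4 * t))) * triangular_gf (exp (- (2 * pi / t)))) - csqrt t)"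
  have nz: "t \<noteq> 0" if "t \<in> S" for t using that by (auto simp: S_def)
  have "f t = 0"
  proof (rule analytic_continuation[of f S "of_real ` {0<..}" 1])
    show "open S" unfolding S_def by (rule open_halfspace_Re_gt)
    show "connected S" unfolding S_def by (intro convex_connected convex_halfspace_Re_gt)
    have "(\<lambda>t :: complex. eval_fps overpartition_fps (exp (- (pi * t)))) holomorphic_on S"
    proof (rule holomorphic_on_compose_gen[of "\<lambda>t. exp (- (pi * t))" S _ "ball 0 1", unfolded o_def])
      show "eval_fps overpartition_fps holomorphic_on ball (0 :: complex) 1"
        by (rule holomorphic_on_eval_fps) (rule ball_subset_eball[OF overpartition_fps_conv_radius])
      show "(\<lambda>t. exp (- (pi * t))) ` S \<subseteq> ball (0 :: complex) 1" by (auto simp: S_def)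
    qed (intro holomorphic_intros)
    moreover have "(\<lambda>t :: complex. eval_fps triangular_fps (exp (- (2 * pi / t)))) holomorphic_on S"
    proof (rule holomorphic_on_compose_gen[of "\<lambda>t. exp (- (2 * pi / t))" S _ "ball 0 1", unfolded o_def])
      show "eval_fps triangular_fps holomorphic_on ball 0 1"
        by (rule holomorphic_on_eval_fps) (rule ball_subset_eball[OF triangular_fps_conv_radius])
      show "(\<lambda>t. exp (- (2 * pi / t))) ` S \<subseteq> ball (0 :: complex) 1"
      proof (rule image_subsetI)
        fix t assume "t \<in> S"
        then have "Re (of_real (2 * pi) / t) > 0" using nz[of t] unfolding Re_divide_of_real_left by (simp add: S_def)
        then show "exp (- (2 * pi / t)) \<in> ball 0 1" by simp
      qed
    qed (intro holomorphic_intros nz)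
    ultimately show "f holomorphic_on S"
      unfolding f_def overpartition_gf_def triangular_gf_def
      by (intro holomorphic_intros) (use nz in \<open>auto simp: S_def complex_nonpos_Reals_iff\<close>)
    show "of_real ` {0<..} \<subseteq> S" by (auto simp: S_def)
    show "1 \<in> S" "t \<in> S" using t by (auto simp: S_def)
    show "(1 :: complex) islimpt of_real ` {0<..}"
    proof (rule islimptI)
      fix T :: "complex set" assume "1 \<in> T" "open T"
      then obtain e where e: "e > 0" "ball 1 e \<subseteq> T" by (auto simp: open_contains_ball)
      have "complex_of_real (1 + e / 2) \<in> ball 1 e" using e by (simp add: dist_norm)
      then show "\<exists>y\<in>of_real ` {0<..}. y \<in> T \<and> y \<noteq> 1" using e
        by (intro bexI[of _ "complex_of_real (1 + e / 2)"]) (auto simp: complex_eq_iff)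
    qed
    fix z :: complex assume "z \<in> of_real ` {0<..}"
    then obtain u where u: "u > 0" "z = of_real u" by auto
    have "exp (- (pi * z)) = of_real (exp (- (pi * u)))" "exp (- (pi / (4 * z))) = of_real (exp (- (pi / (4 * u))))"
      "exp (- (2 * pi / z)) = of_real (exp (- (2 * pi / u)))" "csqrt z = of_real (sqrt u)"
      using u exp_of_real[of "- (pi * u)", where 'a = complex] exp_of_real[of "- (pi / (4 * u))", where 'a = complex]
        exp_of_real[of "- (2 * pi / u)", where 'a = complex]
      by simp_all
    then show "f z = 0"
      unfolding f_def using overpartition_gf_transformation_real[OF u(1)] by (simp only: diff_self)
  qed
  then show ?thesis by (simp add: f_def)
qed

text \<open>At a positive real argument \<open>triangular_gf\<close> is at least its constant term
  1, all its coefficients being non-negative.\<close>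

lemma overpartition_gf_real_le:
  fixes t :: real
  assumes t: "t > 0"
  shows "Re (overpartition_gf (of_real (exp (- (pi * t))))) \<le> sqrt t / 2 * exp (pi / (4 * t))"
proof -
  define q where "q = exp (- (pi * t))"
  define x where "x = exp (- (2 * pi / t))"
  have q: "0 < q" "q < 1" and x: "0 < x" "x < 1" using t by (auto simp: q_def x_def)
  define A where "A = (\<Sum>n. real (overpartition_count n) * q ^ n)"
  have "(\<lambda>n. complex_of_real (real (overpartition_count n) * q ^ n)) sums of_real A"
    unfolding A_def using q by (intro sums_of_real summable_sums overpartition_count_summable) auto
  then have "(\<lambda>n. of_nat (overpartition_count n) * complex_of_real q ^ n) sums of_real A" by simp
  then have A: "overpartition_gf (of_real q) = of_real A"
    using overpartition_gf_sums[of "of_real q"] q by (auto intro: sums_unique2)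
  have A0: "A \<ge> 0" unfolding A_def using q
    by (intro suminf_nonneg overpartition_count_summable) auto
  define c where "c = (\<lambda>n. Re (triangular_fps $ n))"
  have c: "triangular_fps $ n = of_real (c n)" "0 \<le> c n" for n by (auto simp: c_def triangular_fps_def)
  have s: "(\<lambda>n. complex_of_real (c n * x ^ n)) sums triangular_gf (of_real x)"
    using triangular_gf_sums[of "of_real x"] x by (simp add: c(1))
  define B where "B = Re (triangular_gf (of_real x))"
  have Bs: "(\<lambda>n. c n * x ^ n) sums B" using sums_Re[OF s] by (simp add: B_def)
  have B: "triangular_gf (of_real x) = of_real B"
    by (rule sums_unique2[OF s sums_of_real[OF Bs]])
  have "(\<Sum>n<1. c n * x ^ n) \<le> (\<Sum>n. c n * x ^ n)"
    using c x by (intro sum_le_suminf sums_summable[OF Bs]) auto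
  also have "\<dots> = B" by (rule sums_unique[OF Bs, symmetric])
  finally have "(\<Sum>n<1. c n * x ^ n) \<le> B" .
  then have B1: "B \<ge> 1" using triangular_fps_nth_0 by (simp add: c_def)
  have "complex_of_real (A * (2 * exp (- (pi / (4 * t))) * B)) = of_real (sqrt t)"
    using overpartition_gf_transformation_real[OF t] unfolding q_def[symmetric] x_def[symmetric] A B by simp
  then have eq: "A * (2 * exp (- (pi / (4 * t))) * B) = sqrt t" by (simp only: of_real_eq_iff)
  have "A * (2 * exp (- (pi / (4 * t))) * 1) \<le> A * (2 * exp (- (pi / (4 * t))) * B)"
    using A0 B1 by (intro mult_left_mono) auto
  then have "A * exp (- (pi / (4 * t))) * exp (pi / (4 * t)) \<le> sqrt t / 2 * exp (pi / (4 * t))"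
    unfolding eq by (intro mult_right_mono) auto
  then have "A \<le> sqrt t / 2 * exp (pi / (4 * t))"
    by (simp add: mult.assoc exp_add[symmetric])
  then show ?thesis unfolding q_def[symmetric] A by simp
qed

text \<open>A primitive replaces contour integration: the coefficient is read off from its increment over a period.\<close>

lemma overpartition_gf_primitive:
  obtains H :: "complex \<Rightarrow> complex" where
    "\<And>t :: complex. Re t > 0 \<Longrightarrow> (H has_field_derivative overpartition_gf (exp (- (pi * t))) * exp (of_nat n * pi * t)) (at t)"
    "\<And>t :: complex. H (t + 2 * \<i>) = H t + 2 * \<i> * of_nat (overpartition_count n)"
proof -
  define a where "a = complex_of_nat (overpartition_count n)"
  \<comment> \<open>Termwise integration: the term \<open>m\<close> of the integrand is a multiple
    of \<open>exp ((n - m) * pi * t)\<close> and has a primitive of period \<open>2 * \<i>\<close>,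
    except for \<open>m = n\<close>. That term is constant and contributes \<open>a * t\<close>, the
    only part of \<open>H\<close> that changes over a period.\<close>
  define R :: "complex fps" where
    "R = Abs_fps (\<lambda>m. if m = n then 0 else of_nat (overpartition_count m) / (of_nat m - of_nat n))"
  have norm_R: "norm (R $ m) \<le> real (overpartition_count m)" for m
  proof (cases "m = n")
    case False
    have "(of_nat m - of_nat n :: complex) = of_real (real m - real n)" by simp
    then have "norm (of_nat m - of_nat n :: complex) = \<bar>real m - real n\<bar>" by (simp only: norm_of_real)
    then have "norm (of_nat m - of_nat n :: complex) \<ge> 1" using False by linarith
    then have "real (overpartition_count m) / norm (of_nat m - of_nat n :: complex) \<le> real (overpartition_count m) / 1"
      by (intro divide_left_mono) auto
    then show ?thesis using False by (simp add: R_def norm_divide)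
  qed (simp add: R_def)
  have rR: "fps_conv_radius R \<ge> 1"
    unfolding fps_conv_radius_def
  proof (rule conv_radius_geI_ex')
    fix r :: real assume r: "0 < r" "ereal r < 1"
    show "summable (\<lambda>m. R $ m * of_real r ^ m)"
    proof (rule summable_comparison_test')
      show "summable (\<lambda>m. real (overpartition_count m) * r ^ m)"
        using r by (intro overpartition_count_summable) auto
      show "norm (R $ m * of_real r ^ m) \<le> real (overpartition_count m) * r ^ m" for m
        using r norm_R[of m] by (simp add: norm_mult norm_power mult_right_mono)
    qed
  qed
  have rR': "fps_conv_radius (fps_deriv R) \<ge> 1"
    by (rule order.trans[OF rR fps_conv_radius_deriv])
  have fps_eq: "fps_X * fps_deriv R - fps_const (of_nat n) * R = overpartition_fps - fps_const a * fps_X ^ n"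
  proof (rule fps_ext)
    fix m show "(fps_X * fps_deriv R - fps_const (of_nat n) * R) $ m = (overpartition_fps - fps_const a * fps_X ^ n) $ m"
    proof (cases "m = n")
      case True
      then show ?thesis by (cases m) (auto simp: R_def overpartition_fps_def a_def fps_X_power_nth)
    next
      case False
      then have "(of_nat m - of_nat n :: complex) \<noteq> 0" by simp
      then have "(of_nat m - of_nat n) * R $ m = of_nat (overpartition_count m)"
        using False by (simp add: R_def)
      moreover have "(fps_X * fps_deriv R) $ m = of_nat m * R $ m" by (cases m) auto
      ultimately show ?thesis using False by (simp add: overpartition_fps_def fps_X_power_nth algebra_simps)
    qed
  qed
  have ev: "q * eval_fps (fps_deriv R) q - of_nat n * eval_fps R q = overpartition_gf q - a * q ^ n"
    if q: "norm q < 1" for q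
  proof -
    have lt: "ereal (norm q) < fps_conv_radius f" if "fps_conv_radius f \<ge> 1" for f :: "complex fps"
      using q that by (auto intro: less_le_trans[of _ "1 :: ereal"])
    have r1: "fps_conv_radius (fps_X * fps_deriv R) \<ge> 1" "fps_conv_radius (fps_const (of_nat n) * R) \<ge> 1"
      "fps_conv_radius (fps_const a * fps_X ^ n) \<ge> 1"
      by (intro fps_conv_radius_mult_ge; simp add: rR rR')+
    have "eval_fps (fps_X * fps_deriv R - fps_const (of_nat n) * R) q = eval_fps (overpartition_fps - fps_const a * fps_X ^ n) q"
      by (simp only: fps_eq)
    then show ?thesis
      by (simp add: eval_fps_diff eval_fps_mult lt r1 rR rR' overpartition_fps_conv_radius eval_fps_X_power overpartition_gf_def)
  qed
  define H where "H = (\<lambda>t :: complex. a * t - 1 / pi * exp (of_nat n * pi * t) * eval_fps R (exp (- (pi * t))))"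
  have "(H has_field_derivative overpartition_gf (exp (- (pi * t))) * exp (of_nat n * pi * t)) (at t)" if t: "Re t > 0" for t :: complex
  proof -
    define q where "q = exp (- (pi * t))"
    have q: "norm q < 1" using t by (simp add: q_def)
    have d: "((\<lambda>t :: complex. eval_fps R (exp (- (pi * t)))) has_field_derivative eval_fps (fps_deriv R) q * (- pi * q)) (at t)"
      unfolding q_def
    proof (rule has_field_derivative_eval_fps')
      show "ereal (norm (exp (- (pi * t)))) < fps_conv_radius R"
        using q rR unfolding q_def by (auto intro: less_le_trans[of _ "1 :: ereal"])
      show "((\<lambda>t :: complex. exp (- (pi * t))) has_field_derivative - pi * exp (- (pi * t))) (at t)"
        by (auto intro!: derivative_eq_intros)
    qed
    define E where "E = exp (of_nat n * pi * t)"
    have Eq: "E * q ^ n = 1"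
      by (simp add: E_def q_def exp_of_nat_mult[symmetric] exp_add[symmetric] mult_ac)
    have dE: "((\<lambda>t :: complex. exp (of_nat n * pi * t)) has_field_derivative (of_nat n * pi * E)) (at t)"
      unfolding E_def by (auto intro!: derivative_eq_intros)
    have "(H has_field_derivative (a * 1 - (1 / pi * (of_nat n * pi * E) * eval_fps R q + 1 / pi * E * (eval_fps (fps_deriv R) q * (- pi * q))))) (at t)"
      unfolding H_def by (rule derivative_eq_intros d dE refl)+ (simp add: q_def E_def)
    also have "a * 1 - (1 / pi * (of_nat n * pi * E) * eval_fps R q + 1 / pi * E * (eval_fps (fps_deriv R) q * (- pi * q))) =
       a + E * (q * eval_fps (fps_deriv R) q - of_nat n * eval_fps R q)"
      by (simp add: algebra_simps)
    also have "\<dots> = a + E * overpartition_gf q - a * (E * q ^ n)"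
      unfolding ev[OF q] by (simp add: algebra_simps)
    finally show ?thesis unfolding Eq by (simp add: q_def E_def mult.commute)
  qed
  moreover have "H (t + 2 * \<i>) = H t + 2 * \<i> * a" for t :: complex
  proof -
    have "exp (- (pi * (t + 2 * \<i>))) = exp (- (pi * t))"
      using exp_plus_2pin[of "- (pi * t)" "-1"] by (simp add: algebra_simps)
    moreover have "exp (of_nat n * pi * (t + 2 * \<i>)) = exp (of_nat n * pi * t)"
      using exp_plus_2pin[of "of_nat n * pi * t" "int n"] by (simp add: algebra_simps)
    ultimately show ?thesis by (simp add: H_def algebra_simps)
  qed
  ultimately show ?thesis using that unfolding a_def by blast
qed

section \<open>The asymptotic estimate\<close>

text \<open>For \<open>x > c\<close> one has \<open>x ^ 2 >= c ^ 2 + (x - c) ^ 2\<close>, so the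
  tail beyond \<open>c\<close> is at most \<open>exp (- (a * c ^ 2))\<close> times the integral over
  the half-line.\<close>

lemma gaussian_truncated:
  fixes a c :: real
  assumes a: "a > 0" and c: "c \<ge> 0"
  shows "integral {-c..c} (\<lambda>v. exp (- (a * v ^ 2))) \<le> sqrt (pi / a)"
    and "sqrt (pi / a) * (1 - exp (- (a * c ^ 2))) \<le> integral {-c..c} (\<lambda>v. exp (- (a * v ^ 2)))"
proof -
  define f where "f = (\<lambda>v. exp (- (a * v ^ 2)))"
  define A where "A = sqrt pi / 2 / sqrt a"
  define g where "g = (\<lambda>v. indicator {0..} v *\<^sub>R f v)"
  define g1 where "g1 = (\<lambda>v. indicator {0..c} v *\<^sub>R f v)"
  have g: "has_bochner_integral lborel g A"
  proof -
    have "has_bochner_integral lborel (\<lambda>x. indicat_real {0..} (0 + sqrt a * x) *\<^sub>R exp (- (0 + sqrt a * x)\<^sup>2)) ((sqrt pi / 2) /\<^sub>R \<bar>sqrt a\<bar>)"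
      using gaussian_moment_0 a by (subst lborel_has_bochner_integral_real_affine_iff[symmetric]) auto
    moreover have "(\<lambda>x. indicat_real {0..} (0 + sqrt a * x) *\<^sub>R exp (- (0 + sqrt a * x)\<^sup>2)) = g"
      using a by (auto simp: g_def f_def fun_eq_iff indicator_def zero_le_mult_iff power_mult_distrib)
    moreover have "(sqrt pi / 2) /\<^sub>R \<bar>sqrt a\<bar> = A" using a by (simp add: A_def field_simps)
    ultimately show ?thesis by simp
  qed
  have gs: "has_bochner_integral lborel (\<lambda>x. g (- c + 1 * x)) A"
    using g by (subst (asm) lborel_has_bochner_integral_real_affine_iff[of 1 _ _ "- c"]) auto
  have cont: "continuous_on S f" for S unfolding f_def by (intro continuous_intros)
  have int1: "set_integrable lborel {0..c} f"
    unfolding set_integrable_def by (intro borel_integrable_compact cont) auto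
  then have ig1: "integrable lborel g1" unfolding set_integrable_def g1_def .
  have I: "integral\<^sup>L lborel g1 = integral {0..c} f"
    using set_borel_integral_eq_integral(2)[OF int1] unfolding set_lebesgue_integral_def g1_def .
  have ig: "integrable lborel g" "integral\<^sup>L lborel g = A" using g by (auto simp: has_bochner_integral_iff)
  have igs: "integrable lborel (\<lambda>x. g (- c + 1 * x))" "integral\<^sup>L lborel (\<lambda>x. g (- c + 1 * x)) = A"
    using gs by (auto simp: has_bochner_integral_iff)
  have "integral\<^sup>L lborel g1 \<le> integral\<^sup>L lborel g"
    by (rule integral_mono[OF ig1 ig(1)]) (auto simp: g1_def g_def f_def indicator_def)
  then have up: "integral {0..c} f \<le> A" using I ig by simp
  have "integral\<^sup>L lborel g \<le> integral\<^sup>L lborel (\<lambda>x. g1 x + f c * g (- c + 1 * x))"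
  proof (rule integral_mono[OF ig(1)])
    show "integrable lborel (\<lambda>x. g1 x + f c * g (- c + 1 * x))"
      by (intro Bochner_Integration.integrable_add ig1 integrable_mult_right igs)
    fix x :: real
    show "g x \<le> g1 x + f c * g (- c + 1 * x)"
    proof (cases "x > c")
      case True
      have "a * c ^ 2 + a * (- c + x) ^ 2 \<le> a * x ^ 2"
      proof -
        have "0 \<le> 2 * c * (x - c)" using True c by simp
        then have "c ^ 2 + (- c + x) ^ 2 \<le> x ^ 2" by (simp add: power2_eq_square algebra_simps)
        then have "a * (c ^ 2 + (- c + x) ^ 2) \<le> a * x ^ 2" using a by (intro mult_left_mono) auto
        then show ?thesis by (simp add: algebra_simps)
      qed
      then have "f x \<le> f c * f (- c + x)" unfolding f_def exp_add[symmetric] by simp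
      then show ?thesis using True c by (simp add: g_def g1_def indicator_def)
    next
      case False
      have "0 \<le> f c * g (- c + 1 * x)" by (simp add: g_def f_def indicator_def)
      then show ?thesis using False by (auto simp: g_def g1_def indicator_def)
    qed
  qed
  also have "\<dots> = integral {0..c} f + f c * A"
    using ig1 igs I by (subst Bochner_Integration.integral_add) auto
  finally have low: "A - f c * A \<le> integral {0..c} f" using ig by simp
  have int: "f integrable_on {u..v}" for u v by (intro integrable_continuous_interval cont)
  have "integral {-c..0} f = integral {-c..0} (\<lambda>x. f (- x))" by (simp add: f_def)
  also have "\<dots> = integral {-0..c} f" using Henstock_Kurzweil_Integration.integral_reflect_real[where a = 0 and b = c and f = f] by simp
  finally have "integral {-c..c} f = 2 * integral {0..c} f"
    using Henstock_Kurzweil_Integration.integral_combine[OF _ _ int, of "-c" 0 c] c by simp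
  moreover have A2: "sqrt (pi / a) = 2 * A" using a by (simp add: A_def real_sqrt_divide)
  ultimately show "integral {-c..c} (\<lambda>v. exp (- (a * v ^ 2))) \<le> sqrt (pi / a)"
    "sqrt (pi / a) * (1 - exp (- (a * c ^ 2))) \<le> integral {-c..c} (\<lambda>v. exp (- (a * v ^ 2)))"
    using up low unfolding A2 unfolding f_def by (simp_all add: algebra_simps)
qed

text \<open>The threshold 1/3 on \<open>norm x\<close> gives
  \<open>norm (w - 1) <= norm x / (1 - norm x) <= 1 / 2\<close>. Hence \<open>w\<close> is nonzero,
  \<open>norm (1 / w) <= 2\<close>, and dividing the product identity by it is legitimate.\<close>

lemma overpartition_gf_eq:
  fixes t :: complex
  assumes t: "Re t > 0" and small: "exp (- (2 * pi * Re t / norm t ^ 2)) \<le> 1 / 3"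
  defines "w \<equiv> triangular_gf (exp (- (2 * pi / t)))"
  shows "overpartition_gf (exp (- (pi * t))) = csqrt t * exp (pi / (4 * t)) / (2 * w)"
    and "norm (1 / w - 1) \<le> 3 * exp (- (2 * pi * Re t / norm t ^ 2))" "norm (1 / w) \<le> 2"
proof -
  define x where "x = exp (- (2 * pi / t))"
  have "Re (of_real (2 * pi) / t) = 2 * pi * Re t / norm t ^ 2" by (rule Re_divide_of_real_left)
  then have nx: "norm x = exp (- (2 * pi * Re t / norm t ^ 2))" by (simp add: x_def)
  then have x3: "norm x \<le> 1 / 3" using small by simp
  have "norm (w - 1) \<le> norm x / (1 - norm x)"
    unfolding w_def x_def[symmetric] by (rule norm_triangular_gf_diff) (use x3 in simp)
  also have "\<dots> \<le> norm x / (2 / 3)" using x3 by (intro divide_left_mono) auto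
  finally have w1: "norm (w - 1) \<le> 3 / 2 * norm x" by simp
  then have w2: "norm (w - 1) \<le> 1 / 2" using x3 by simp
  have w3: "norm w \<ge> 1 / 2" using norm_triangle_ineq4[of w "w - 1"] w2 by simp
  then have w0: "w \<noteq> 0" by auto
  have "exp (- (pi / (4 * t))) * exp (pi / (4 * t)) = 1" by (simp add: exp_add[symmetric])
  moreover have "overpartition_gf (exp (- (pi * t))) * (2 * exp (- (pi / (4 * t))) * w) = csqrt t"
    unfolding w_def by (rule overpartition_gf_transformation[OF t])
  moreover have "P * (2 * E * w) * F = P * (2 * w) * (E * F)" for P E F :: complex by simp
  ultimately have "csqrt t * exp (pi / (4 * t)) = overpartition_gf (exp (- (pi * t))) * (2 * w)"
    by (metis mult_1_right)
  then show "overpartition_gf (exp (- (pi * t))) = csqrt t * exp (pi / (4 * t)) / (2 * w)"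
    using w0 by simp
  have "norm (1 / w) = 1 / norm w" by (simp add: norm_divide)
  also have "\<dots> \<le> 1 / (1 / 2)" using w3 by (intro divide_left_mono) auto
  finally show w4: "norm (1 / w) \<le> 2" by simp
  have "1 / w - 1 = - ((w - 1) * (1 / w))" using w0 by (simp add: field_simps)
  then have "norm (1 / w - 1) = norm (w - 1) * norm (1 / w)" by (simp only: norm_minus_cancel norm_mult)
  also have "\<dots> \<le> 3 / 2 * norm x * 2" using w1 w4 by (intro mult_mono) auto
  finally show "norm (1 / w - 1) \<le> 3 * exp (- (2 * pi * Re t / norm t ^ 2))" by (simp add: nx)
qed

text \<open>With \<open>r = norm q\<close>, the numerator of the real part is
  \<open>r * cos \<theta> - r ^ 2 <= r - r ^ 2\<close>, while \<open>norm (1 - q) ^ 2 = (1 - r) ^ 2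
  + 4 * r * sin (\<theta> / 2) ^ 2\<close>, of which only the second summand is kept.\<close>

lemma Re_over_one_minus_le:
  fixes q :: complex
  assumes "norm q < 1" "q = of_real (norm q) * cis \<theta>" "sin (\<theta> / 2) \<noteq> 0" "norm q > 0"
  shows "Re (q / (1 - q)) \<le> (1 - norm q) / (4 * sin (\<theta> / 2) ^ 2)"
proof -
  define r where "r = norm q"
  have r: "0 < r" "r < 1" using assms by (auto simp: r_def)
  have q: "Re q = r * cos \<theta>" "Im q = r * sin \<theta>"
    using arg_cong[OF assms(2), of Re] arg_cong[OF assms(2), of Im] by (simp_all add: r_def)
  have c: "cos \<theta> = 1 - 2 * sin (\<theta> / 2) ^ 2" using cos_double_sin[of "\<theta> / 2"] by simp
  have n2: "norm (1 - q) ^ 2 = (1 - r) ^ 2 + 4 * r * sin (\<theta> / 2) ^ 2"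
  proof -
    have "norm (1 - q) ^ 2 = (1 - r * cos \<theta>) ^ 2 + (r * sin \<theta>) ^ 2"
      by (simp add: cmod_power2 q)
    also have "\<dots> = 1 - 2 * r * cos \<theta> + ((r * cos \<theta>) ^ 2 + (r * sin \<theta>) ^ 2)"
      by (simp add: power2_eq_square algebra_simps)
    also have "(r * cos \<theta>) ^ 2 + (r * sin \<theta>) ^ 2 = r ^ 2"
      unfolding power_mult_distrib distrib_left[symmetric] by simp
    finally show ?thesis unfolding c by (simp add: power2_eq_square algebra_simps)
  qed
  have "norm (1 - q) ^ 2 = (1 - Re q) ^ 2 + Im q ^ 2" by (simp add: cmod_power2)
  then have "Re (q / (1 - q)) = (Re q * (1 - Re q) - Im q ^ 2) / norm (1 - q) ^ 2"
    by (simp only:) (simp add: Re_divide power2_eq_square)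
  also have "Re q * (1 - Re q) - Im q ^ 2 = r * cos \<theta> - ((r * cos \<theta>) ^ 2 + (r * sin \<theta>) ^ 2)"
    by (simp add: q power2_eq_square algebra_simps)
  also have "\<dots> = r * cos \<theta> - r ^ 2"
    unfolding power_mult_distrib distrib_left[symmetric] by simp
  also have "(r * cos \<theta> - r ^ 2) / norm (1 - q) ^ 2 \<le> (r - r ^ 2) / norm (1 - q) ^ 2"
    using r by (intro divide_right_mono) auto
  also have "\<dots> \<le> (r - r ^ 2) / (4 * r * sin (\<theta> / 2) ^ 2)"
  proof (rule divide_left_mono)
    have pos: "0 < 4 * r * sin (\<theta> / 2) ^ 2" using r assms(3) by simp
    then show "0 < norm (1 - q) ^ 2 * (4 * r * sin (\<theta> / 2) ^ 2)"
      unfolding n2 by (simp only: mult_pos_pos add_nonneg_pos zero_le_power2)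
    show "4 * r * sin (\<theta> / 2) ^ 2 \<le> norm (1 - q) ^ 2" unfolding n2 by simp
    have "r * r \<le> r * 1" using r by (intro mult_left_mono) auto
    then show "0 \<le> r - r ^ 2" by (simp add: power2_eq_square)
  qed
  also have "\<dots> = (1 - r) / (4 * sin (\<theta> / 2) ^ 2)"
    using r assms(3) by (simp add: power2_eq_square field_simps)
  finally show ?thesis unfolding r_def .
qed


text \<open>In the following \<open>s\<close> is \<open>sqrt n\<close>, so that \<open>mu n = pi * s\<close>.\<close>

definition integrand :: "nat \<Rightarrow> complex \<Rightarrow> complex" where
  "integrand n = (\<lambda>t :: complex. overpartition_gf (exp (- (pi * t))) * exp (of_nat n * pi * t))"

context
  fixes n :: nat and s :: real
  assumes s: "s \<ge> 17" and n: "real n = s ^ 2"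
begin

lemma norm_integrand:
  fixes t :: complex
  shows "norm (integrand n t) = norm (overpartition_gf (exp (- (pi * t)))) * exp (pi * s ^ 2 * Re t)"
  using n by (simp add: integrand_def norm_mult mult_ac)

section \<open>Bounds on the pieces of the path\<close>

text \<open>On this line the trivial bound is of order \<open>exp (5 / 4 * pi * s)\<close>, so a
  factor \<open>exp (- (3 / 4 * pi * s))\<close> has to be gained. The exponential correction
  supplies about \<open>exp (2 - 2 * (1 - 1 / 36) / p)\<close> with
  \<open>1 / p = 4 * s / pi\<close>, which barely suffices; hence the careful constants.\<close>

lemma integrand_minor_bound:
  fixes t :: complex
  assumes t: "Re t = 1 / (4 * s)" and \<theta>: "6 / (4 * s) \<le> \<bar>Im t\<bar>" "\<bar>Im t\<bar> \<le> 1"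
  shows "norm (integrand n t) \<le> exp (pi * s / 2) / 16"
proof -
  define p where "p = pi / (4 * s)"
  have p: "0 < p" "p \<le> 1 / 21"
    using s pi_less_4 pi_approx by (auto simp: p_def field_simps)
  define q where "q = exp (- (pi * t))"
  have nq_eq: "norm q = exp (- (pi * Re t))" by (simp add: q_def)
  then have nq: "norm q = exp (- p)" by (simp add: t p_def)
  have nq1: "norm q < 1" using p by (simp add: nq)
  have nq0: "norm q > 0" by (simp add: nq)
  define \<theta> where "\<theta> = - (pi * Im t)"
  have qc: "q = of_real (norm q) * cis \<theta>"
    unfolding nq_eq by (simp add: q_def \<theta>_def exp_eq_polar)
  \<comment> \<open>Close to the ideal value \<open>9 * p ^ 2\<close>. At
    \<open>|Im t| = 6 * \<sigma>\<close> the half angle is \<open>3 * p\<close>, and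
    \<open>p <= 1 / 21\<close> makes the cubic term nearly negligible.\<close>
  have sin3: "sin (3 * p) ^ 2 \<ge> 8928 / 1000 * p ^ 2"
  proof -
    have "3 * p - (3 * p) ^ 3 / 6 \<le> sin (3 * p)" using p by (intro sin_ge_cubic) auto
    moreover have "3 * p - (3 * p) ^ 3 / 6 = 3 * p * (1 - 3 / 2 * p ^ 2)"
      by (simp add: power2_eq_square power3_eq_cube algebra_simps)
    moreover have "p ^ 2 \<le> (1 / 21) ^ 2" using p by (intro power_mono) auto
    then have "1 - 3 / 2 * p ^ 2 \<ge> 9965 / 10000" by (simp add: power2_eq_square)
    then have "3 * p * (1 - 3 / 2 * p ^ 2) \<ge> 3 * p * (9965 / 10000)" using p by (intro mult_left_mono) auto
    ultimately have "3 * p * (9965 / 10000) \<le> sin (3 * p)" by linarith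
    then have "(3 * p * (9965 / 10000)) ^ 2 \<le> sin (3 * p) ^ 2" using p by (intro power_mono) auto
    moreover have "(3 * p * (9965 / 10000)) ^ 2 \<ge> 8928 / 1000 * p ^ 2" by (simp add: power2_eq_square)
    ultimately show ?thesis by linarith
  qed
  have sin\<theta>: "sin (\<theta> / 2) ^ 2 \<ge> sin (3 * p) ^ 2"
  proof -
    define u where "u = pi * \<bar>Im t\<bar> / 2"
    have "3 * p = pi * (6 / (4 * s)) / 2" by (simp add: p_def)
    also have "\<dots> \<le> u" unfolding u_def using \<theta> by (intro divide_right_mono mult_left_mono) auto
    finally have "3 * p \<le> u" .
    moreover have "u \<le> pi / 2" unfolding u_def using \<theta> by (simp add: field_simps)
    ultimately have "sin (3 * p) \<le> sin u" using p by (intro sin_monotone_2pi_le) auto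
    moreover have "sin (3 * p) \<ge> 0" using p pi_gt3 by (intro sin_ge_zero) auto
    ultimately have "sin (3 * p) ^ 2 \<le> sin u ^ 2" by (intro power_mono) auto
    moreover have "sin u ^ 2 = sin (\<theta> / 2) ^ 2"
      by (cases "Im t \<ge> 0") (simp_all add: u_def \<theta>_def)
    ultimately show ?thesis by simp
  qed
  have pos: "8928 / 1000 * p ^ 2 > 0" using p by simp
  have "Re (q / (1 - q)) \<le> (1 - norm q) / (4 * sin (\<theta> / 2) ^ 2)"
    using sin3 sin\<theta> pos by (intro Re_over_one_minus_le nq1 nq0 qc) auto
  also have "\<dots> \<le> p / (4 * sin (\<theta> / 2) ^ 2)"
    using exp_minus_ge[of p] by (intro divide_right_mono) (auto simp: nq)
  also have "\<dots> \<le> p / (4 * (8928 / 1000 * p ^ 2))"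
    using sin3 sin\<theta> pos p by (intro divide_left_mono mult_pos_pos mult_left_mono) auto
  also have "\<dots> = 1000 / 35712 * (1 / p)" using p by (simp add: power2_eq_square)
  finally have b1: "Re (q / (1 - q)) \<le> 1000 / 35712 * (1 / p)" .
  have b2: "norm q / (1 - norm q) \<ge> 1 / p - 1"
  proof -
    have "1 - p \<le> exp (- p)" by (rule exp_minus_ge)
    have e1: "exp (- p) < 1" using p by simp
    have "1 / p \<le> 1 / (1 - exp (- p))" using \<open>1 - p \<le> exp (- p)\<close> e1 p by (intro divide_left_mono mult_pos_pos) auto
    also have "\<dots> = exp (- p) / (1 - exp (- p)) + 1" using e1 by (simp add: field_simps)
    finally show ?thesis by (simp add: nq)
  qed
  have "norm (overpartition_gf q) \<le> Re (overpartition_gf (of_real (norm q))) * exp (2 * (Re (q / (1 - q)) - norm q / (1 - norm q)))"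
    by (rule norm_overpartition_gf_le[OF nq1])
  also have "\<dots> \<le> (sqrt (1 / (4 * s)) / 2 * exp (pi * s)) * exp (2 * (1000 / 35712 * (1 / p) - (1 / p - 1)))"
  proof (rule mult_mono)
    have "Re (overpartition_gf (of_real (exp (- (pi * (1 / (4 * s))))))) \<le> sqrt (1 / (4 * s)) / 2 * exp (pi / (4 * (1 / (4 * s))))"
      using s by (intro overpartition_gf_real_le) auto
    then show "Re (overpartition_gf (of_real (norm q))) \<le> sqrt (1 / (4 * s)) / 2 * exp (pi * s)"
      by (simp add: nq p_def)
  qed (use b1 b2 s in auto)
  finally have "norm (integrand n t) \<le> (sqrt (1 / (4 * s)) / 2 * exp (pi * s)) * exp (2 * (1000 / 35712 * (1 / p) - (1 / p - 1))) * exp (pi * s ^ 2 * Re t)"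
    unfolding norm_integrand q_def[symmetric] by (intro mult_right_mono) auto
  also have "\<dots> = sqrt (1 / (4 * s)) / 2 * exp (pi * s + 2 * (1000 / 35712 * (1 / p) - (1 / p - 1)) + pi * s ^ 2 * Re t)"
    by (simp add: exp_add)
  also have "\<dots> \<le> (1 / 8) / 2 * exp (pi * s / 2)"
  proof (intro mult_mono divide_right_mono)
    have "sqrt (1 / (4 * s)) \<le> sqrt ((1 / 8) ^ 2)" using s by (intro real_sqrt_le_mono) (simp add: field_simps)
    then show "sqrt (1 / (4 * s)) \<le> 1 / 8" by simp
    have "pi * s ^ 2 * Re t = pi / 4 * s" using s by (simp add: t power2_eq_square)
    moreover have "1 / p = 4 * s / pi" using s by (simp add: p_def)
    ultimately have eq: "pi * s + 2 * (1000 / 35712 * (1 / p) - (1 / p - 1)) + pi * s ^ 2 * Re t =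
      pi * s / 2 + (s * (3 / 4 * pi - 69424 / 35712 * 4 / pi) + 2)" by (simp add: algebra_simps)
    \<comment> \<open>The coefficient of \<open>s\<close> is
      \<open>3 / 4 * pi - 8 / pi * (1 - 1000 / 35712)\<close>, slightly below -0.1177. Since
      \<open>17 * 0.1177\<close> just exceeds the leftover 2, \<open>s >= 17\<close> is what closes
      the estimate.\<close>
    have "pi * pi \<le> 31416 / 10000 * (31416 / 10000)" using pi_approx by (intro mult_mono) auto
    then have "(3 / 4 * pi + 1177 / 10000) * pi \<le> 69424 / 35712 * 4"
      using pi_approx by (simp add: algebra_simps)
    then have "3 / 4 * pi - 69424 / 35712 * 4 / pi \<le> - (1177 / 10000)" using pi_gt_zero by (simp add: field_simps)
    then have "s * (3 / 4 * pi - 69424 / 35712 * 4 / pi) \<le> s * (- (1177 / 10000))" using s by (intro mult_left_mono) auto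
    also have "\<dots> \<le> 17 * (- (1177 / 10000))" using s by (intro mult_right_mono_neg) auto
    finally have "s * (3 / 4 * pi - 69424 / 35712 * 4 / pi) + 2 \<le> 0" by simp
    then show "exp (pi * s + 2 * (1000 / 35712 * (1 / p) - (1 / p - 1)) + pi * s ^ 2 * Re t) \<le> exp (pi * s / 2)"
      unfolding eq by simp
  qed auto
  finally show ?thesis by simp
qed


lemma integrand_transformed:
  fixes t :: complex
  assumes t: "Re t > 0" and small: "exp (- (2 * pi * Re t / norm t ^ 2)) \<le> 1 / 3"
  defines "w \<equiv> triangular_gf (exp (- (2 * pi / t)))"
  shows "integrand n t = csqrt t * exp (pi / (4 * t) + pi * s ^ 2 * t) / 2 * (1 / w)"
proof -
  have "(of_nat n :: complex) = of_real (s ^ 2)" using n by (metis of_real_of_nat_eq)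
  then show ?thesis unfolding integrand_def overpartition_gf_eq(1)[OF t small] w_def
    by (simp add: exp_add mult_ac)
qed

text \<open>The lower bound on \<open>Im t\<close> says \<open>norm t >= 2 * Re t\<close>, so
  \<open>Re (pi / (4 * t))\<close> is at most \<open>pi * s / 4\<close>, the same amount that
  \<open>pi * s ^ 2 * t\<close> contributes. The upper bound keeps
  \<open>exp (- (2 * pi / t))\<close> small enough for the transformed expression.\<close>

lemma integrand_middle_bound:
  fixes t :: complex
  assumes t: "Re t = 1 / (4 * s)" and Im: "3 * (Re t) ^ 2 \<le> Im t ^ 2" "\<bar>Im t\<bar> \<le> 6 * Re t"
  shows "norm (integrand n t) \<le> exp (pi * s / 2)"
proof -
  define \<sigma> where "\<sigma> = 1 / (4 * s)"
  have \<sigma>: "0 < \<sigma>" "\<sigma> \<le> 1 / 68" using s by (auto simp: \<sigma>_def field_simps)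
  have re: "Re t = \<sigma>" by (simp add: t \<sigma>_def)
  have nt: "norm t ^ 2 = \<sigma> ^ 2 + Im t ^ 2" by (simp add: cmod_power2 re)
  have "\<bar>Im t\<bar> ^ 2 \<le> (6 * \<sigma>) ^ 2" using Im re by (intro power_mono) auto
  then have n1: "norm t ^ 2 \<le> 37 * \<sigma> ^ 2" unfolding nt by (simp add: power_mult_distrib)
  have n2: "4 * \<sigma> ^ 2 \<le> norm t ^ 2" using Im unfolding nt re by simp
  have npos: "0 < norm t ^ 2" using n2 \<sigma> by (smt (verit) zero_less_power)
  have ratio: "4 * s / 37 \<le> Re t / norm t ^ 2" "Re t / norm t ^ 2 \<le> s"
  proof -
    have "4 * s / 37 = \<sigma> / (37 * \<sigma> ^ 2)" using s by (simp add: \<sigma>_def power2_eq_square field_simps)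
    also have "\<dots> \<le> Re t / norm t ^ 2" unfolding re using n1 npos \<sigma> by (intro divide_left_mono mult_pos_pos) auto
    finally show "4 * s / 37 \<le> Re t / norm t ^ 2" .
    have "Re t / norm t ^ 2 \<le> \<sigma> / (4 * \<sigma> ^ 2)" unfolding re using n2 npos \<sigma> by (intro divide_left_mono mult_pos_pos) auto
    also have "\<dots> = s" using s by (simp add: \<sigma>_def power2_eq_square field_simps)
    finally show "Re t / norm t ^ 2 \<le> s" .
  qed
  have small: "exp (- (2 * pi * Re t / norm t ^ 2)) \<le> 1 / 3"
  proof -
    have "2 \<le> 2 * 3 * (4 * s / 37)" using s by simp
    also have "\<dots> \<le> 2 * pi * (Re t / norm t ^ 2)" using pi_gt3 ratio s by (intro mult_mono) auto
    finally have "exp (- (2 * pi * Re t / norm t ^ 2)) \<le> exp (- 2)" by simp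
    also have "\<dots> \<le> 1 / 3" using exp_ge_add_one_self[of 2] by (simp add: exp_minus field_simps)
    finally show ?thesis .
  qed
  have Re0: "Re t > 0" using re \<sigma> by simp
  define w where "w = triangular_gf (exp (- (2 * pi / t)))"
  have w: "norm (1 / w) \<le> 2" unfolding w_def by (rule overpartition_gf_eq(3)[OF Re0 small])
  have e: "Re (pi / (4 * t) + pi * s ^ 2 * t) \<le> pi * s / 2"
  proof -
    have "Re (of_real (pi / 4) / t) = pi / 4 * (Re t / norm t ^ 2)"
      unfolding Re_divide_of_real_left by simp
    also have "\<dots> \<le> pi / 4 * s" using ratio by (intro mult_left_mono) auto
    also have "of_real (pi / 4) / t = pi / (4 * t)" by simp
    finally have "Re (pi / (4 * t)) \<le> pi / 4 * s" .
    moreover have "Re (of_real (pi * s ^ 2) * t) = pi / 4 * s"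
      using s by (simp add: t power2_eq_square)
    moreover have "Re (pi / (4 * t) + pi * s ^ 2 * t) = Re (pi / (4 * t)) + Re (of_real (pi * s ^ 2) * t)"
      by simp
    moreover have "pi / 4 * s + pi / 4 * s = pi * s / 2" by simp
    ultimately show ?thesis by linarith
  qed
  have "norm (csqrt t) \<le> 1"
  proof -
    have "\<sigma> ^ 2 \<le> (1 / 68) ^ 2" using \<sigma> by (intro power_mono) auto
    then have "norm t ^ 2 \<le> 37 * (1 / 68) ^ 2" using n1 by linarith
    also have "\<dots> \<le> 1 ^ 2" by (simp add: power2_eq_square)
    finally have "norm t \<le> 1" by (rule power2_le_imp_le) simp
    then show ?thesis by (simp add: norm_csqrt)
  qed
  moreover define X where "X = exp (pi / (4 * t) + pi * s ^ 2 * t)"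
  moreover have "norm X \<le> exp (pi * s / 2)" unfolding X_def norm_exp_eq_Re using e by (simp only: exp_le_cancel_iff)
  ultimately have "norm (csqrt t) * norm X * norm (1 / w) \<le> 1 * exp (pi * s / 2) * 2"
    using w by (intro mult_mono) auto
  moreover have "norm (csqrt t * X / 2 * (1 / w)) = norm (csqrt t) * norm X * norm (1 / w) / 2"
    by (simp add: norm_mult norm_divide)
  ultimately show ?thesis unfolding integrand_transformed[OF Re0 small] w_def[symmetric] X_def[symmetric] by simp
qed

text \<open>The radius \<open>1 / (2 * s)\<close> makes \<open>pi / (4 * t)\<close> and
  \<open>pi * s ^ 2 * t\<close> complex conjugates. \<open>csqrt t * t\<close> contributes the angle
  \<open>3 * \<phi> / 2\<close>, and the factor \<open>\<i>\<close> comes from differentiating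
  \<open>t\<close> in \<open>\<phi>\<close>. The deviation of \<open>1 / w\<close> from 1 is at most
  \<open>3 * exp (- 4 * pi * s * cos \<phi>)\<close>, which outweighs the growing main
  exponential.\<close>

lemma integrand_arc:
  fixes \<phi> :: real
  assumes \<phi>: "\<bar>\<phi>\<bar> \<le> pi / 3"
  defines "t \<equiv> of_real (1 / (2 * s)) * cis \<phi>"
  shows "\<bar>Im (integrand n t * (\<i> * t)) - (1 / (2 * s)) powr (3 / 2) / 2 * (exp (pi * s * cos \<phi>) * cos (3 * \<phi> / 2))\<bar> \<le> 1 / 10"
proof -
  define r where "r = 1 / (2 * s)"
  have r: "0 < r" "r \<le> 1 / 34" using s by (auto simp: r_def field_simps)
  have t: "t = of_real r * cis \<phi>" by (simp add: t_def r_def)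
  have cos: "1 / 2 \<le> cos \<phi>"
  proof -
    have "cos (pi / 3) \<le> cos \<bar>\<phi>\<bar>" using \<phi> by (intro cos_monotone_0_pi_le) auto
    then show ?thesis by (simp add: cos_60)
  qed
  have re: "Re t = r * cos \<phi>" and nt: "norm t = r" using r by (simp_all add: t norm_mult)
  have Re0: "Re t > 0" unfolding re using r cos by simp
  have ratio: "2 * pi * Re t / norm t ^ 2 = 4 * (pi * s * cos \<phi>)"
    unfolding re nt using s by (simp add: r_def power2_eq_square field_simps)
  have big: "pi * s * cos \<phi> \<ge> 3 * 17 * (1 / 2)" using pi_gt3 s cos by (intro mult_mono) auto
  have small: "exp (- (2 * pi * Re t / norm t ^ 2)) \<le> 1 / 3"
  proof -
    have "exp (- (4 * (pi * s * cos \<phi>))) \<le> exp (- 2)" using big by simp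
    also have "\<dots> \<le> 1 / 3" using exp_ge_add_one_self[of 2] by (simp add: exp_minus field_simps)
    finally show ?thesis unfolding ratio .
  qed
  define w where "w = triangular_gf (exp (- (2 * pi / t)))"
  have w: "norm (1 / w - 1) \<le> 3 * exp (- (4 * (pi * s * cos \<phi>)))"
    using overpartition_gf_eq(2)[OF Re0 small] unfolding w_def ratio .
  have sq: "csqrt t = of_real (sqrt r) * cis (\<phi> / 2)"
  proof (rule csqrt_unique)
    show "(of_real (sqrt r) * cis (\<phi> / 2)) ^ 2 = t"
      using r by (simp add: power_mult_distrib Complex.DeMoivre t of_real_power[symmetric] del: of_real_power)
    have "cos (\<phi> / 2) > 0" using \<phi> pi_gt_zero by (intro cos_gt_zero_pi) linarith+
    then show "0 < Re (of_real (sqrt r) * cis (\<phi> / 2)) \<or> Re (of_real (sqrt r) * cis (\<phi> / 2)) = 0 \<and> 0 \<le> Im (of_real (sqrt r) * cis (\<phi> / 2))"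
      using r by simp
  qed
  have ex: "pi / (4 * t) + pi * s ^ 2 * t = of_real (pi * s * cos \<phi>)"
  proof -
    have "1 / cis \<phi> = cis (- \<phi>)" by (simp add: cis_divide[of 0 \<phi>, simplified])
    then have "pi / (4 * t) = of_real (pi * s / 2) * cis (- \<phi>)"
      using s by (simp add: t r_def field_simps)
    moreover have "pi * s ^ 2 * t = of_real (pi * s / 2) * cis \<phi>"
      using s by (simp add: t r_def power2_eq_square)
    ultimately have "pi / (4 * t) + pi * s ^ 2 * t = of_real (pi * s / 2) * cis (- \<phi>) + of_real (pi * s / 2) * cis \<phi>"
      by (simp only:)
    also have "\<dots> = of_real (pi * s * cos \<phi>)" by (simp add: complex_eq_iff)
    finally show ?thesis .
  qed
  define D where "D = of_real (r powr (3 / 2) / 2 * exp (pi * s * cos \<phi>)) * (\<i> * cis (3 * \<phi> / 2))"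
  have rp: "sqrt r * r = r powr (3 / 2)"
  proof -
    have "sqrt r * r = r powr (1 / 2) * r powr 1" using r by (simp add: powr_half_sqrt)
    also have "\<dots> = r powr (3 / 2)" by (simp only: powr_add[symmetric]) simp
    finally show ?thesis .
  qed
  have "integrand n t * (\<i> * t) = of_real (sqrt r) * cis (\<phi> / 2) * exp (of_real (pi * s * cos \<phi>)) / 2 * (1 / w) * (\<i> * (of_real r * cis \<phi>))"
    unfolding integrand_transformed[OF Re0 small] w_def sq ex by (simp only: t)
  also have "\<dots> = of_real (sqrt r * r / 2 * exp (pi * s * cos \<phi>)) * (\<i> * (cis (\<phi> / 2) * cis \<phi>)) * (1 / w)"
    by (simp add: exp_of_real[symmetric] mult_ac)
  also have "\<dots> = D * (1 / w)"
    unfolding D_def rp cis_mult by (simp add: mult_ac)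
  finally have "integrand n t * (\<i> * t) - D = D * (1 / w - 1)" by (simp add: algebra_simps)
  then have "norm (integrand n t * (\<i> * t) - D) = norm D * norm (1 / w - 1)" by (simp add: norm_mult)
  also have "\<dots> \<le> (1 / 2 * exp (pi * s * cos \<phi>)) * (3 * exp (- (4 * (pi * s * cos \<phi>))))"
  proof (intro mult_mono w)
    have "r powr (3 / 2) \<le> 1" using r by (intro powr_le1) auto
    then show "norm D \<le> 1 / 2 * exp (pi * s * cos \<phi>)" by (simp add: D_def norm_mult)
  qed auto
  also have "\<dots> = 3 / 2 * exp (- (3 * (pi * s * cos \<phi>)))" by (simp add: exp_add[symmetric])
  also have "\<dots> \<le> 3 / 2 * (1 / 15)"
  proof -
    have "exp (- (3 * (pi * s * cos \<phi>))) \<le> exp (- 15)" using big by simp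
    also have "\<dots> \<le> 1 / 15" using exp_ge_add_one_self[of 15] by (simp add: exp_minus field_simps)
    finally show ?thesis by simp
  qed
  finally have "norm (integrand n t * (\<i> * t) - D) \<le> 1 / 10" by simp
  then have "\<bar>Im (integrand n t * (\<i> * t) - D)\<bar> \<le> 1 / 10" using abs_Im_le_cmod order.trans by blast
  moreover have "Im D = r powr (3 / 2) / 2 * (exp (pi * s * cos \<phi>) * cos (3 * \<phi> / 2))"
    by (simp add: D_def)
  ultimately show ?thesis by (simp add: r_def)
qed

section \<open>Assembly of the asymptotic estimate\<close>

theorem overpartition_count_estimate:
  "\<bar>real (overpartition_count n) - exp (pi * s) / (8 * s ^ 2) * (1 - 1 / (pi * s))\<bar> \<le> exp (pi * s / 2) / 6"
proof -
  obtain H :: "complex \<Rightarrow> complex" where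
    dH': "\<And>t :: complex. Re t > 0 \<Longrightarrow> (H has_field_derivative overpartition_gf (exp (- (pi * t))) * exp (of_nat n * pi * t)) (at t)"
    and perH: "\<And>t. H (t + 2 * \<i>) = H t + 2 * \<i> * of_nat (overpartition_count n)"
    by (rule overpartition_gf_primitive[of n]) blast
  have dH: "(H has_field_derivative integrand n t) (at t)" if "Re t > 0" for t
    using dH'[OF that] by (simp only: integrand_def)
  define m where "m = pi * s"
  define \<sigma> where "\<sigma> = 1 / (4 * s)"
  define r where "r = 1 / (2 * s)"
  have \<sigma>: "0 < \<sigma>" "\<sigma> \<le> 1 / 68" using s by (auto simp: \<sigma>_def field_simps)
  have r: "0 < r" "r \<le> 1 / 34" using s by (auto simp: r_def field_simps)
  have "3 * 17 \<le> pi * s" using pi_gt3 s by (intro mult_mono) auto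
  then have m: "m \<ge> 51" by (simp add: m_def)
  define P where "P = (\<lambda>y. Complex \<sigma> y)"
  have seg: "norm (H (P v) - H (P u)) \<le> B * \<bar>v - u\<bar>"
    if B: "\<And>y. y \<in> closed_segment u v \<Longrightarrow> norm (integrand n (P y)) \<le> B" for u v B
  proof -
    have "norm (H (P v) - H (P u)) \<le> B * norm (P v - P u)"
    proof (rule field_differentiable_bound[where S = "closed_segment (P u) (P v)" and f' = "integrand n"])
      fix z assume "z \<in> closed_segment (P u) (P v)"
      then obtain x where x: "0 \<le> x" "x \<le> 1" "z = (1 - x) *\<^sub>R P u + x *\<^sub>R P v"
        unfolding in_segment by blast
      have z: "z = P ((1 - x) *\<^sub>R u + x *\<^sub>R v)"
        unfolding x(3) by (simp add: P_def complex_eq_iff algebra_simps)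
      have "(1 - x) *\<^sub>R u + x *\<^sub>R v \<in> closed_segment u v" unfolding in_segment using x(1,2) by blast
      then show "norm (integrand n z) \<le> B" unfolding z by (rule B)
      have "Re z > 0" using \<sigma> by (simp add: z P_def)
      then show "(H has_field_derivative integrand n z) (at z within closed_segment (P u) (P v))"
        by (rule has_field_derivative_at_within[OF dH])
    qed simp_all
    moreover have "P v - P u = of_real (v - u) * \<i>" by (simp add: P_def complex_eq_iff)
    ultimately show ?thesis by (simp add: norm_mult del: of_real_diff)
  qed
  define E where "E = exp (m / 2)"
  have E1: "E \<ge> 1 + m / 2" unfolding E_def by (rule exp_ge_add_one_self)
  have minor: "norm (integrand n (P y)) \<le> E / 16" if "6 * \<sigma> \<le> \<bar>y\<bar>" "\<bar>y\<bar> \<le> 1" for y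
    unfolding E_def m_def by (rule integrand_minor_bound) (use that in \<open>auto simp: P_def \<sigma>_def\<close>)
  have middle: "norm (integrand n (P y)) \<le> E" if "sqrt 3 * \<sigma> \<le> \<bar>y\<bar>" "\<bar>y\<bar> \<le> 6 * \<sigma>" for y
    unfolding E_def m_def
  proof (rule integrand_middle_bound)
    have "(sqrt 3 * \<sigma>) ^ 2 \<le> \<bar>y\<bar> ^ 2" using that \<sigma> by (intro power_mono) auto
    then show "3 * (Re (P y)) ^ 2 \<le> Im (P y) ^ 2" by (simp add: P_def power_mult_distrib)
  qed (use that in \<open>auto simp: P_def \<sigma>_def\<close>)
  have q3: "1 \<le> sqrt 3" "sqrt 3 \<le> 2" by (auto intro: real_le_rsqrt real_le_lsqrt)
  have s31: "\<sigma> \<le> sqrt 3 * \<sigma>" using \<sigma> q3 by simp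
  have s32: "sqrt 3 * \<sigma> \<le> 2 * \<sigma>" using \<sigma> q3 by (intro mult_right_mono) auto
  have E0: "E > 0" by (simp add: E_def)
  have b1: "norm (H (P 1) - H (P (6 * \<sigma>))) \<le> E / 16"
    "norm (H (P (- (6 * \<sigma>))) - H (P (-1))) \<le> E / 16"
  proof -
    have "norm (H (P 1) - H (P (6 * \<sigma>))) \<le> E / 16 * \<bar>1 - 6 * \<sigma>\<bar>"
      using \<sigma> by (intro seg minor) (auto simp: closed_segment_eq_real_ivl)
    also have "\<dots> \<le> E / 16 * 1" using \<sigma> E0 by (intro mult_left_mono) auto
    finally show "norm (H (P 1) - H (P (6 * \<sigma>))) \<le> E / 16" by simp
    have "norm (H (P (- (6 * \<sigma>))) - H (P (-1))) \<le> E / 16 * \<bar>- (6 * \<sigma>) - (-1)\<bar>"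
      using \<sigma> by (intro seg minor) (auto simp: closed_segment_eq_real_ivl)
    also have "\<dots> \<le> E / 16 * 1" using \<sigma> E0 by (intro mult_left_mono) auto
    finally show "norm (H (P (- (6 * \<sigma>))) - H (P (-1))) \<le> E / 16" by simp
  qed
  define c3 where "c3 = sqrt 3 * \<sigma>"
  note middle = middle[folded c3_def] and s31 = s31[folded c3_def] and s32 = s32[folded c3_def]
  have b2: "norm (H (P (6 * \<sigma>)) - H (P (c3))) \<le> E * (5 / 68)"
    "norm (H (P (- (c3))) - H (P (- (6 * \<sigma>)))) \<le> E * (5 / 68)"
  proof -
    have "norm (H (P (6 * \<sigma>)) - H (P (c3))) \<le> E * \<bar>6 * \<sigma> - c3\<bar>"
      using \<sigma> s31 s32 by (intro seg middle) (auto simp: closed_segment_eq_real_ivl)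
    also have "\<dots> \<le> E * (5 / 68)" using \<sigma> s31 s32 E0 by (intro mult_left_mono) auto
    finally show "norm (H (P (6 * \<sigma>)) - H (P (c3))) \<le> E * (5 / 68)" .
    have "norm (H (P (- (c3))) - H (P (- (6 * \<sigma>)))) \<le> E * \<bar>- (c3) - - (6 * \<sigma>)\<bar>"
      using \<sigma> s31 s32 by (intro seg middle) (auto simp: closed_segment_eq_real_ivl)
    also have "\<dots> \<le> E * (5 / 68)" using \<sigma> s31 s32 E0 by (intro mult_left_mono) auto
    finally show "norm (H (P (- (c3))) - H (P (- (6 * \<sigma>)))) \<le> E * (5 / 68)" .
  qed
  note b2 = b2[unfolded c3_def]

  define g where "g = (\<lambda>v. exp (- (2 * m * v ^ 2)))"
  define \<Psi> where "\<Psi> = (\<lambda>v. integral {-1/2..v} g)"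
  have d\<Psi>: "(\<Psi> has_real_derivative g v) (at v within {-1/2..1/2})" if "v \<in> {-1/2..1/2}" for v
    unfolding \<Psi>_def by (rule integral_has_real_derivative) (use that in \<open>auto simp: g_def intro!: continuous_intros\<close>)
  \<comment> \<open>Integration by parts against the Gaussian turns \<open>4 * v ^ 2 * g v\<close>
    into \<open>g v / m\<close> plus a boundary term; this is where the factor
    \<open>1 - 1 / m\<close> of the main term originates.\<close>
  define \<Phi> where "\<Phi> = (\<lambda>v. v * g v / m + (1 - 1 / m) * \<Psi> v)"
  have d\<Phi>: "(\<Phi> has_real_derivative (1 - 4 * v ^ 2) * g v) (at v within {-1/2..1/2})" if "v \<in> {-1/2..1/2}" for v
  proof -
    have dg: "(g has_real_derivative (- 4 * m * v) * g v) (at v within {-1/2..1/2})"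
      unfolding g_def by (auto intro!: derivative_eq_intros)
    have "(\<Phi> has_real_derivative (1 * g v + (- 4 * m * v) * g v * v) / m + (1 - 1 / m) * g v) (at v within {-1/2..1/2})"
      unfolding \<Phi>_def by (rule DERIV_add[OF DERIV_cdivide[OF DERIV_mult[OF DERIV_ident dg]] DERIV_cmult[OF d\<Psi>[OF that]]])
    moreover have "(1 * g v + (- 4 * m * v) * g v * v) / m + (1 - 1 / m) * g v = (1 - 4 * v ^ 2) * g v"
      using m by (simp add: field_simps power2_eq_square)
    ultimately show ?thesis by simp
  qed
  \<comment> \<open>Substitution \<open>v = sin (\<phi> / 2)\<close>:
    \<open>cos \<phi> = 1 - 2 * v ^ 2\<close> yields the Gaussian, and
    \<open>cos (3 * \<phi> / 2) = (1 - 4 * v ^ 2) * cos (\<phi> / 2)\<close> contains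
    \<open>dv\<close>. The limits \<open>pi / 3\<close> and \<open>- pi / 3\<close> become
    \<open>1 / 2\<close> and \<open>- 1 / 2\<close>.\<close>
  define M where "M = (\<lambda>\<phi>. 2 * exp m * \<Phi> (sin (\<phi> / 2)))"
  have dM: "(M has_real_derivative exp (m * cos \<phi>) * cos (3 * \<phi> / 2)) (at \<phi> within {-(pi/3)..pi/3})"
    if \<phi>: "\<phi> \<in> {-(pi/3)..pi/3}" for \<phi>
  proof -
    have sin_in: "sin (x / 2) \<in> {-1/2..1/2}" if "x \<in> {-(pi/3)..pi/3}" for x
    proof -
      have "sin (x / 2) \<le> sin (pi / 6)" using that by (intro sin_monotone_2pi_le) auto
      moreover have "sin (- (pi / 6)) \<le> sin (x / 2)" using that by (intro sin_monotone_2pi_le) auto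
      ultimately show ?thesis by (simp add: sin_30)
    qed
    define v where "v = sin (\<phi> / 2)"
    have "((\<lambda>\<phi>. sin (\<phi> / 2)) has_real_derivative cos (\<phi> / 2) / 2) (at \<phi> within {-(pi/3)..pi/3})"
      by (auto intro!: derivative_eq_intros)
    moreover have "(\<Phi> has_real_derivative (1 - 4 * v ^ 2) * g v) (at (sin (\<phi> / 2)) within (\<lambda>\<phi>. sin (\<phi> / 2)) ` {-(pi/3)..pi/3})"
      unfolding v_def by (rule has_field_derivative_subset[OF d\<Phi>]) (use sin_in \<phi> in auto)
    ultimately have "((\<lambda>\<phi>. \<Phi> (sin (\<phi> / 2))) has_real_derivative (1 - 4 * v ^ 2) * g v * (cos (\<phi> / 2) / 2)) (at \<phi> within {-(pi/3)..pi/3})"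
      by (rule DERIV_image_chain[unfolded o_def, rotated])
    then have "(M has_real_derivative 2 * exp m * ((1 - 4 * v ^ 2) * g v * (cos (\<phi> / 2) / 2))) (at \<phi> within {-(pi/3)..pi/3})"
      unfolding M_def by (rule DERIV_cmult)
    moreover have "exp m * g v = exp (m * cos \<phi>)"
    proof -
      have "cos \<phi> = 1 - 2 * v ^ 2" unfolding v_def using cos_double_sin[of "\<phi> / 2"] by simp
      then have "m * cos \<phi> = m + - (2 * m * v ^ 2)" by (simp add: right_diff_distrib)
      then show ?thesis by (simp only: g_def exp_add[symmetric])
    qed
    moreover have "(1 - 4 * v ^ 2) * cos (\<phi> / 2) = cos (3 * \<phi> / 2)"
    proof -
      have "3 * \<phi> / 2 = \<phi> / 2 + 2 * (\<phi> / 2)" by simp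
      then have "cos (3 * \<phi> / 2) = cos (\<phi> / 2) * cos (2 * (\<phi> / 2)) - v * sin (2 * (\<phi> / 2))"
        by (simp only: cos_add v_def)
      also have "\<dots> = (1 - 4 * v ^ 2) * cos (\<phi> / 2)"
        unfolding cos_double_sin sin_double v_def by (simp add: power2_eq_square algebra_simps)
      finally show ?thesis by simp
    qed
    moreover have "2 * exp m * ((1 - 4 * v ^ 2) * g v * (cos (\<phi> / 2) / 2)) = (exp m * g v) * ((1 - 4 * v ^ 2) * cos (\<phi> / 2))"
      by simp
    ultimately show ?thesis by (simp only:)
  qed
  define R where "R = r powr (3 / 2)"
  have R1: "0 < R" "R \<le> r" and Rr: "R * sqrt r = r ^ 2"
  proof -
    show "0 < R" using r by (simp add: R_def)
    have "r powr (3 / 2) \<le> r powr 1" using r by (intro powr_mono') auto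
    then show "R \<le> r" using r by (simp add: R_def)
    have "R * sqrt r = r powr (3 / 2) * r powr (1 / 2)" using r by (simp add: R_def powr_half_sqrt)
    also have "\<dots> = r powr 2" by (simp only: powr_add[symmetric]) simp
    finally show "R * sqrt r = r ^ 2" using r by simp
  qed
  \<comment> \<open>Comparing primitives instead of integrals: the derivative of \<open>h\<close> is
    the error of \<open>integrand_arc\<close>, at most 1/10 on an interval of length
    \<open>2 * pi / 3\<close>.\<close>
  define h where "h = (\<lambda>\<phi>. Im (H (of_real r * cis \<phi>)) - R / 2 * M \<phi>)"
  have arc: "\<bar>h (pi / 3) - h (- (pi / 3))\<bar> \<le> 1 / 4"
  proof -
    have dh: "(h has_real_derivative (Im (integrand n (of_real r * cis \<phi>) * (\<i> * (of_real r * cis \<phi>))) - R / 2 * (exp (m * cos \<phi>) * cos (3 * \<phi> / 2))))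
       (at \<phi> within {-(pi/3)..pi/3})" if \<phi>: "\<phi> \<in> {-(pi/3)..pi/3}" for \<phi>
    proof -
      have "cos \<phi> > 0" using \<phi> pi_gt_zero unfolding atLeastAtMost_iff by (intro cos_gt_zero_pi) linarith+
      then have "(H has_field_derivative integrand n (of_real r * cis \<phi>)) (at (of_real r * cis \<phi>))"
        using r by (intro dH) simp
      moreover have "((\<lambda>\<phi>. of_real r * cis \<phi>) has_vector_derivative \<i> * (of_real r * cis \<phi>)) (at \<phi> within {-(pi/3)..pi/3})"
      proof -
        have "((\<lambda>z. of_real r * exp (\<i> * z)) has_field_derivative \<i> * (of_real r * exp (\<i> * of_real \<phi>))) (at (of_real \<phi>))"
          by (auto intro!: derivative_eq_intros)
        from has_vector_derivative_real_field[OF this] show ?thesis by (simp only: cis_conv_exp)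
      qed
      ultimately have "((\<lambda>\<phi>. H (of_real r * cis \<phi>)) has_vector_derivative (\<i> * (of_real r * cis \<phi>)) * integrand n (of_real r * cis \<phi>)) (at \<phi> within {-(pi/3)..pi/3})"
        by (rule field_vector_diff_chain_within[unfolded o_def, rotated, OF has_field_derivative_at_within])
      then have "((\<lambda>\<phi>. Im (H (of_real r * cis \<phi>))) has_real_derivative Im ((\<i> * (of_real r * cis \<phi>)) * integrand n (of_real r * cis \<phi>))) (at \<phi> within {-(pi/3)..pi/3})"
        unfolding has_real_derivative_iff_has_vector_derivative
        by (rule bounded_linear.has_vector_derivative[OF bounded_linear_Im])
      then show ?thesis unfolding h_def mult.commute[of "integrand n _"]
        by (intro DERIV_diff DERIV_cmult dM \<phi>)
    qed
    have "norm (h (pi / 3) - h (- (pi / 3))) \<le> 1 / 10 * norm (pi / 3 - - (pi / 3))"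
    proof (rule field_differentiable_bound[OF _ dh])
      fix \<phi> assume "\<phi> \<in> {-(pi/3)..pi/3}"
      then have "\<bar>\<phi>\<bar> \<le> pi / 3" by auto
      from integrand_arc[OF this]
      show "norm (Im (integrand n (of_real r * cis \<phi>) * (\<i> * (of_real r * cis \<phi>))) - R / 2 * (exp (m * cos \<phi>) * cos (3 * \<phi> / 2))) \<le> 1 / 10"
        by (simp add: r_def R_def m_def)
    qed auto
    also have "\<dots> \<le> 1 / 4" using pi_approx by simp
    finally show ?thesis by simp
  qed
  define J where "J = integral {-(1/2)..1/2} g"
  have J: "sqrt r * (1 - exp (- (m / 2))) \<le> J" "J \<le> sqrt r"
  proof -
    \<comment> \<open>The full Gaussian integral is exactly \<open>sqrt r\<close>, so together with
      \<open>R = r powr (3 / 2)\<close> the main term carries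
      \<open>r ^ 2 = 1 / (4 * s ^ 2)\<close>.\<close>
    have "sqrt (pi / (2 * m)) = sqrt r" using s by (simp add: m_def r_def)
    then show "sqrt r * (1 - exp (- (m / 2))) \<le> J" "J \<le> sqrt r"
      using gaussian_truncated[of "2 * m" "1/2"] m unfolding J_def g_def by (simp_all add: power2_eq_square)
  qed
  have M: "M (pi / 3) - M (- (pi / 3)) = 2 * (exp m * (exp (- (m / 2)) / m + (1 - 1 / m) * J))"
  proof -
    have "\<Psi> (1/2) = J" "\<Psi> (-(1/2)) = 0" by (simp_all add: \<Psi>_def J_def)
    then show ?thesis
      by (simp add: M_def \<Phi>_def sin_30 g_def power2_eq_square algebra_simps)
  qed
  define main where "main = r ^ 2 / 2 * exp m * (1 - 1 / m)"
  have expE: "exp m * exp (- (m / 2)) = E" by (simp add: E_def exp_add[symmetric])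
  \<comment> \<open>Two errors remain, the boundary term of the integration by parts and the
    truncation of the Gaussian. They enter with opposite signs and are each at most
    \<open>E / 500\<close>, so this also bounds their sum.\<close>
  have Mmain: "\<bar>R / 2 * (M (pi / 3) - M (- (pi / 3))) - 2 * main\<bar> \<le> E / 500"
  proof -
    define d where "d = (1 - 1 / m) * (R * exp m * (sqrt r - J))"
    have "R / 2 * (M (pi / 3) - M (- (pi / 3))) = R * (E / m) + (1 - 1 / m) * (R * exp m * J)"
      unfolding M expE[symmetric] by (simp add: algebra_simps)
    moreover have "2 * main = (1 - 1 / m) * (R * exp m * sqrt r)"
      unfolding main_def Rr[symmetric] by simp
    ultimately have eq: "R / 2 * (M (pi / 3) - M (- (pi / 3))) - 2 * main = R * (E / m) - d"
      by (simp add: d_def algebra_simps)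
    have m1: "0 \<le> 1 - 1 / m" "1 - 1 / m \<le> 1" using m by auto
    have d0: "0 \<le> d" unfolding d_def using m1 R1 J by (intro mult_nonneg_nonneg) auto
    have "d \<le> 1 * (R * exp m * (sqrt r * exp (- (m / 2))))"
      unfolding d_def using m1 R1 J by (intro mult_mono) (auto simp: algebra_simps)
    also have "\<dots> = r ^ 2 * E" unfolding Rr[symmetric] expE[symmetric] by simp
    also have "\<dots> \<le> (1 / 34) ^ 2 * E" using r E0 by (intro mult_right_mono power_mono) auto
    also have "\<dots> \<le> E / 500" using E0 by (simp add: power2_eq_square)
    finally have d1: "d \<le> E / 500" .
    have "R * (E / m) \<le> 1 / 34 * (E / 51)"
      using R1 r m E0 by (intro mult_mono divide_left_mono) auto
    then have "R * (E / m) \<le> E / 500" using E0 by simp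
    moreover have "0 \<le> R * (E / m)" using R1 E0 m by simp
    ultimately show ?thesis unfolding eq using d0 d1 by linarith
  qed
  \<comment> \<open>The arc of radius \<open>2 * \<sigma>\<close> ends on the line itself, since
    \<open>cos (pi / 3) = 1 / 2\<close>; no connecting piece is needed.\<close>
  have ends: "of_real r * cis (pi / 3) = P (sqrt 3 * \<sigma>)" "of_real r * cis (- (pi / 3)) = P (- (sqrt 3 * \<sigma>))"
    by (auto simp: complex_eq_iff P_def r_def \<sigma>_def cos_60 sin_60)
  have per: "H (P 1) = H (P (-1)) + 2 * \<i> * of_nat (overpartition_count n)"
  proof -
    have "P 1 = P (-1) + 2 * \<i>" by (simp add: P_def complex_eq_iff)
    then show ?thesis using perH[of "P (-1)"] by simp
  qed
  have "2 * real (overpartition_count n) = Im (H (P 1) - H (P (-1)))" unfolding per by simp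
  also have "H (P 1) - H (P (-1)) = (H (P 1) - H (P (6 * \<sigma>))) + (H (P (6 * \<sigma>)) - H (P (sqrt 3 * \<sigma>))) +
     (H (P (sqrt 3 * \<sigma>)) - H (P (- (sqrt 3 * \<sigma>)))) + (H (P (- (sqrt 3 * \<sigma>))) - H (P (- (6 * \<sigma>)))) + (H (P (- (6 * \<sigma>))) - H (P (-1)))"
    by simp
  finally have "2 * real (overpartition_count n) = Im (H (P 1) - H (P (6 * \<sigma>))) + Im (H (P (6 * \<sigma>)) - H (P (sqrt 3 * \<sigma>))) +
     (Im (H (P (sqrt 3 * \<sigma>))) - Im (H (P (- (sqrt 3 * \<sigma>))))) + Im (H (P (- (sqrt 3 * \<sigma>))) - H (P (- (6 * \<sigma>)))) + Im (H (P (- (6 * \<sigma>))) - H (P (-1)))"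
    by (simp only: plus_complex.sel minus_complex.sel)
  moreover have "Im (H (P (sqrt 3 * \<sigma>))) - Im (H (P (- (sqrt 3 * \<sigma>)))) = (h (pi / 3) - h (- (pi / 3))) + R / 2 * (M (pi / 3) - M (- (pi / 3)))"
    unfolding h_def ends by (simp add: algebra_simps)
  moreover note abs_Im_le_cmod[of "H (P 1) - H (P (6 * \<sigma>))"] abs_Im_le_cmod[of "H (P (6 * \<sigma>)) - H (P (sqrt 3 * \<sigma>))"]
    abs_Im_le_cmod[of "H (P (- (sqrt 3 * \<sigma>))) - H (P (- (6 * \<sigma>)))"] abs_Im_le_cmod[of "H (P (- (6 * \<sigma>))) - H (P (-1))"]
  \<comment> \<open>The outer pieces have length at most 1 and integrand at most
    \<open>E / 16\<close>; the middle ones have length at most \<open>5 * \<sigma> <= 5 / 68\<close>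
    and integrand at most \<open>E\<close>. After halving, this is about
    \<open>0.137 * E + 0.125\<close>, below \<open>E / 6\<close> because
    \<open>E >= 1 + 51 / 2\<close>.\<close>
  ultimately have "\<bar>2 * real (overpartition_count n) - 2 * main\<bar> \<le> 2 * (E / 16) + 2 * (E * (5 / 68)) + E / 500 + 1 / 4"
    using b1 b2 arc Mmain by linarith
  then have "\<bar>real (overpartition_count n) - main\<bar> \<le> E / 6" using E1 m by linarith
  moreover have "main = exp (pi * s) / (8 * s ^ 2) * (1 - 1 / (pi * s))"
    by (simp add: main_def m_def r_def power2_eq_square)
  ultimately show ?thesis by (simp add: E_def m_def)
qed

end

section \<open>The finite range\<close>

text \<open>Applied to the list of counts in descending order of the argument, with \<open>g = 2\<close>, this is the alternating
  sum of the entries at the positions \<open>k\<^sup>2 - 1\<close> for \<open>k \<ge> 1\<close>, since consecutive positions have \<open>2 k\<close> entries between them.\<close>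

fun square_gaps :: "nat \<Rightarrow> int list \<Rightarrow> int" where
  "square_gaps g [] = 0"
| "square_gaps g (a # l) = a - square_gaps (Suc (Suc g)) (drop g l)"

definition extend_counts :: "int list \<Rightarrow> int list" where
  "extend_counts l = 2 * square_gaps (Suc (Suc 0)) l # l"

primrec counts :: "nat \<Rightarrow> int list" where
  "counts 0 = [1]"
| "counts (Suc n) = extend_counts (counts n)"

section \<open>Exact values from the theta recurrence\<close>

lemma overpartition_count_0: "overpartition_count 0 = 1"
  using bounded_count_eq[of 0 0] by (simp add: bounded_count_0)

lemma overpartition_count_pos: "overpartition_count n > 0"
proof (cases "n = 0")
  case False
  then have "({#n#}, {}) \<in> bounded_overpartitions n n" by (simp add: mem_bounded_overpartitions)
  then have "bounded_count n n > 0"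
    unfolding bounded_count_def using finite_bounded_overpartitions by (auto simp: card_gt_0_iff)
  then show ?thesis by (simp add: bounded_count_eq)
qed (simp add: overpartition_count_0)

lemma overpartition_count_recurrence:
  assumes "N > 0"
  shows "int (overpartition_count N) = - 2 * (\<Sum>j | 1 \<le> j \<and> j ^ 2 \<le> N. (-1) ^ j * int (overpartition_count (N - j ^ 2)))"
proof -
  define A where "A = {j. 1 \<le> j \<and> j ^ 2 \<le> N}"
  define p where "p = (\<lambda>n. real (overpartition_count n))"
  have j_le: "j \<le> j ^ 2" for j :: nat by (cases j) (auto simp: power2_eq_square)
  have "A \<subseteq> {..N}" unfolding A_def using j_le order.trans by blast
  then have finA: "finite A" by (rule finite_subset) simp
  have "0 = (theta_fps * overpartition_fps :: real fps) $ N"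
    using assms by (simp add: theta_overpartition)
  also have "\<dots> = (\<Sum>i\<le>N. theta_fps $ i * p (N - i))"
    by (simp add: fps_mult_nth overpartition_fps_def p_def atLeast0AtMost)
  also have "\<dots> = p N + (\<Sum>i\<in>{1..N}. theta_fps $ i * p (N - i))"
    by (simp add: atMost_atLeast0 sum.atLeast_Suc_atMost theta_fps_def)
  also have "(\<Sum>i\<in>{1..N}. theta_fps $ i * p (N - i)) = (\<Sum>i\<in>(\<lambda>j. j ^ 2) ` A. theta_fps $ i * p (N - i))"
  proof (rule sum.mono_neutral_right)
    show "(\<lambda>j. j ^ 2) ` A \<subseteq> {1..N}" by (auto simp: A_def Suc_le_eq)
    show "\<forall>i\<in>{1..N} - (\<lambda>j. j ^ 2) ` A. theta_fps $ i * p (N - i) = 0"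
    proof
      fix i assume i: "i \<in> {1..N} - (\<lambda>j. j ^ 2) ` A"
      have "\<nexists>k. i = k ^ 2"
      proof
        assume "\<exists>k. i = k ^ 2"
        then obtain k where k: "i = k ^ 2" by blast
        then have "k \<in> A" using i by (cases k) (auto simp: A_def)
        then show False using i k by auto
      qed
      then show "theta_fps $ i * p (N - i) = 0" by (auto simp: theta_fps_def)
    qed
  qed simp
  also have "\<dots> = (\<Sum>j\<in>A. theta_fps $ (j ^ 2) * p (N - j ^ 2))"
    by (subst sum.reindex) (auto simp: inj_on_def A_def)
  also have "\<dots> = (\<Sum>j\<in>A. 2 * ((-1) ^ j * p (N - j ^ 2)))"
  proof (rule sum.cong)
    fix j assume "j \<in> A"
    moreover have "(-1) ^ (j ^ 2) = ((-1) ^ j :: real)" by (cases "even j") auto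
    ultimately show "theta_fps $ (j ^ 2) * p (N - j ^ 2) = 2 * ((-1) ^ j * p (N - j ^ 2))"
      by (auto simp: theta_fps_def A_def)
  qed simp
  finally have "p N = - 2 * (\<Sum>j\<in>A. (-1) ^ j * p (N - j ^ 2))" by (simp add: sum_distrib_left sum_negf)
  also have "\<dots> = real_of_int (- 2 * (\<Sum>j\<in>A. (-1) ^ j * int (overpartition_count (N - j ^ 2))))"
    by (simp add: p_def)
  finally have "real_of_int (int (overpartition_count N)) = real_of_int (- 2 * (\<Sum>j\<in>A. (-1) ^ j * int (overpartition_count (N - j ^ 2))))"
    by (simp only: p_def of_int_of_nat_eq)
  then show ?thesis unfolding A_def of_int_eq_iff .
qed

text \<open>Position \<open>k ^ 2 - 1\<close> of \<open>l\<close> holds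
  \<open>p (N - k ^ 2)\<close>. Skipping \<open>2 * k\<close> entries after it leads to position
  \<open>(k + 1) ^ 2 - 1\<close>, hence the gap growing by two. The factor \<open>(-1) ^ k\<close>
  makes the leading sign positive, as in the alternating recursion.\<close>

lemma square_gaps_drop:
  fixes p :: "nat \<Rightarrow> int"
  assumes "length l = N" "\<And>i. i < N \<Longrightarrow> l ! i = p (N - 1 - i)" "1 \<le> k"
  shows "square_gaps (2 * k) (drop (k ^ 2 - 1) l) = (-1) ^ k * (\<Sum>j | k \<le> j \<and> j ^ 2 \<le> N. (-1) ^ j * p (N - j ^ 2))"
  using assms(3)
proof (induction "Suc N - k ^ 2" arbitrary: k rule: less_induct)
  case less
  have kk: "1 \<le> k ^ 2" using less.prems by simp
  show ?case
  proof (cases "k ^ 2 \<le> N")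
    case False
    then have "\<not> j ^ 2 \<le> N" if "k \<le> j" for j
      using power_mono[OF that, of 2] by linarith
    then have "{j. k \<le> j \<and> j ^ 2 \<le> N} = {}" by auto
    moreover have "drop (k ^ 2 - 1) l = []" using False kk assms(1) by simp
    ultimately show ?thesis by (simp only: sum.empty square_gaps.simps mult_zero_right)
  next
    case True
    have S: "(Suc k) ^ 2 = k ^ 2 + 2 * k + 1" by (simp add: power2_eq_square)
    have "drop (k ^ 2 - 1) l = p (N - k ^ 2) # drop (k ^ 2) l"
    proof -
      have "k ^ 2 - 1 < length l" using True kk assms(1) by simp
      then have "drop (k ^ 2 - 1) l = l ! (k ^ 2 - 1) # drop (Suc (k ^ 2 - 1)) l"
        by (rule Cons_nth_drop_Suc[symmetric])
      moreover have "l ! (k ^ 2 - 1) = p (N - k ^ 2)" using True kk assms(2)[of "k ^ 2 - 1"] by simp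
      moreover have "Suc (k ^ 2 - 1) = k ^ 2" using kk by simp
      ultimately show ?thesis by (simp only:)
    qed
    moreover have "drop (2 * k) (drop (k ^ 2) l) = drop ((Suc k) ^ 2 - 1) l" by (simp add: S add.commute)
    moreover have "square_gaps (2 * Suc k) (drop ((Suc k) ^ 2 - 1) l) =
        (-1) ^ Suc k * (\<Sum>j | Suc k \<le> j \<and> j ^ 2 \<le> N. (-1) ^ j * p (N - j ^ 2))"
      using True by (intro less.hyps) (auto simp: S)
    ultimately have 1: "square_gaps (2 * k) (drop (k ^ 2 - 1) l) =
        p (N - k ^ 2) + (-1) ^ k * (\<Sum>j | Suc k \<le> j \<and> j ^ 2 \<le> N. (-1) ^ j * p (N - j ^ 2))"
      by simp
    have j_le: "j \<le> j ^ 2" for j :: nat by (cases j) (auto simp: power2_eq_square)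
    have "{j. Suc k \<le> j \<and> j ^ 2 \<le> N} \<subseteq> {..N}" using j_le order.trans by blast
    then have "finite {j. Suc k \<le> j \<and> j ^ 2 \<le> N}" by (rule finite_subset) simp
    moreover have "{j. k \<le> j \<and> j ^ 2 \<le> N} = insert k {j. Suc k \<le> j \<and> j ^ 2 \<le> N}"
      using True by (auto simp: Suc_le_eq le_less)
    ultimately have "(\<Sum>j | k \<le> j \<and> j ^ 2 \<le> N. (-1) ^ j * p (N - j ^ 2)) =
        (-1) ^ k * p (N - k ^ 2) + (\<Sum>j | Suc k \<le> j \<and> j ^ 2 \<le> N. (-1) ^ j * p (N - j ^ 2))"
      by simp
    then show ?thesis unfolding 1 by (simp add: distrib_left mult.assoc[symmetric] power_add[symmetric])
  qed
qed

lemma extend_counts_correct: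
  assumes "length l = N" "N > 0" "\<And>i. i < N \<Longrightarrow> l ! i = int (overpartition_count (N - 1 - i))"
  shows "length (extend_counts l) = Suc N" "i < Suc N \<Longrightarrow> extend_counts l ! i = int (overpartition_count (N - i))"
proof -
  have "2 * square_gaps 2 l = int (overpartition_count N)"
    using square_gaps_drop[where k = 1 and p = "\<lambda>n. int (overpartition_count n)", OF assms(1,3)]
      overpartition_count_recurrence[OF assms(2)] by simp
  then have e: "extend_counts l = int (overpartition_count N) # l"
    by (simp add: extend_counts_def numeral_2_eq_2)
  show "length (extend_counts l) = Suc N" by (simp add: e assms(1))
  show "extend_counts l ! i = int (overpartition_count (N - i))" if "i < Suc N"
    using that assms by (cases i) (auto simp: e)
qed

lemma counts_correct:
  "length (counts n) = Suc n \<and> (\<forall>i<Suc n. counts n ! i = int (overpartition_count (n - i)))"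
proof (induction n)
  case 0
  then show ?case by (simp add: overpartition_count_0)
next
  case (Suc n)
  then show ?case using extend_counts_correct[of "counts n" "Suc n"] by auto
qed

section \<open>The inequalities in scaled integers\<close>

text \<open>A Newton step for the square root of \<open>N\<close>. It only proposes values: each
  result is tested by \<open>scaled_mu_bounds\<close> when its turn comes. Two steps from the linear
  extrapolation \<open>2 * w - z\<close> provide the next candidate.\<close>

definition newton :: "int \<Rightarrow> int \<Rightarrow> int" where
  "newton N g = (g + N div g) div 2"

definition newton2 :: "int \<Rightarrow> int \<Rightarrow> int" where
  "newton2 N g = newton N (newton N g)"

text \<open>All quantities are scaled by \<open>K = 2 ^ 32\<close>, and \<open>v\<close> approximates \<open>K * mu m\<close> up to 2. The two large numerals
  enclose \<open>(K * pi)\<^sup>2\<close>, and \<open>85899345920 = 20 * K\<close>.\<close>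

definition scaled_mu_bounds :: "int \<Rightarrow> int \<Rightarrow> bool" where
  "scaled_mu_bounds m v \<longleftrightarrow> 85899345920 \<le> v \<and> v \<le> 18446744073709551616 \<and>
     (v - 2) * (v - 2) \<le> m * 182062066495444990528 \<and> m * 182062066495665208720 \<le> (v + 2) * (v + 2)"

text \<open>The dividend is \<open>K\<^sup>2\<close>.\<close>

definition scaled_inverse :: "int \<Rightarrow> int" where
  "scaled_inverse v = 18446744073709551616 div v"

text \<open>For an argument \<open>b / 2 ^ 13\<close>; the divisor is \<open>K ^ 4 / 2 ^ 65\<close>.\<close>

definition scaled_pow5 :: "int \<Rightarrow> int" where
  "scaled_pow5 b = b * b * b * b * b div 9223372036854775808"

text \<open>For \<open>b\<close> near \<open>K / x\<close> and \<open>c\<close> near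
  \<open>K / x ^ 5\<close> these are approximations to \<open>K * phi_plus x\<close> and
  \<open>K * phi_minus x\<close>.\<close>

definition factor_pair :: "int \<Rightarrow> int \<Rightarrow> int \<times> int" where
  "factor_pair b c = (4294967296 - b + c, 4294967296 - b - c)"

definition factors_of_inverse :: "int \<Rightarrow> int \<times> int" where
  "factors_of_inverse b = factor_pair b (scaled_pow5 (b div 8192))"

definition factors_of :: "int \<Rightarrow> int \<times> int" where
  "factors_of v = factors_of_inverse (scaled_inverse v)"

text \<open>\<open>K * (1 + u + u ^ 2 / 2)\<close> with \<open>u = d / K\<close>, an upper bound of
  \<open>K * exp u\<close> for \<open>u <= 0\<close>. The additional 1 in the constant makes up for
  rounding the quotient down.\<close>

definition exp_upper :: "int \<Rightarrow> int" where
  "exp_upper d = 4294967297 + d + d * d div 8589934592"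

text \<open>One Taylor term more, which gives a lower bound for \<open>u <= 0\<close>; rounding down
  already goes the right way. The divisors are \<open>2 * K\<close> and
  \<open>6 * K ^ 2\<close>.\<close>

definition exp_lower :: "int \<Rightarrow> int" where
  "exp_lower d = 4294967296 + d + d * d div 8589934592 + d * d * d div 110680464442257309696"

text \<open>Both inequalities with denominators cleared; \<open>u\<close> and \<open>v\<close> stand
  for \<open>(n ^ 2 - 1) * p (n - 1) * p (n + 1)\<close> and \<open>n ^ 2 * p n ^ 2\<close>. Errors
  of 2 in \<open>x\<close>, \<open>y\<close>, \<open>z\<close> add up to
  \<open>2 + 2 * 2 + 2 = 8\<close> in the second difference \<open>d\<close>, and each factor is off
  by at most 2 in the direction used.\<close>

definition ratio_test :: "int \<Rightarrow> int \<Rightarrow> int \<Rightarrow> int \<times> int \<Rightarrow> int \<times> int \<Rightarrow> int \<times> int \<Rightarrow> bool" where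
  "ratio_test d u v X Y Z \<longleftrightarrow> d + 8 \<le> 0 \<and>
     exp_upper (d + 8) * ((snd X + 2) * (snd Z + 2)) * v < 4294967296 * ((fst Y - 2) * (fst Y - 2)) * u \<and>
     4294967296 * ((snd Y + 2) * (snd Y + 2)) * u < exp_lower (d - 8) * ((fst X - 2) * (fst Z - 2)) * v"

text \<open>The next approximation \<open>w\<close> is an argument rather than bound by \<open>let\<close>: evaluation by rewriting shares no
  subterms, so every repeatedly used value has to be normalised as an argument first.\<close>

primrec ratio_tests :: "nat \<Rightarrow> int \<Rightarrow> int \<Rightarrow> int \<Rightarrow> int \<Rightarrow> int \<Rightarrow> int \<times> int \<Rightarrow> int \<times> int \<Rightarrow> int \<times> int \<Rightarrow> int list \<Rightarrow> bool" where
  "ratio_tests 0 n x y z w X Y Z l \<longleftrightarrow> True"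
| "ratio_tests (Suc k) n x y z w X Y Z l \<longleftrightarrow> scaled_mu_bounds (n + 1) z \<and>
     ratio_test (x - 2 * y + z) ((n * n - 1) * ((l ! 2) * (l ! 0))) ((n * n) * ((l ! 1) * (l ! 1))) X Y Z \<and>
     ratio_tests k (n + 1) y z w (newton2 ((n + 3) * 182062066495665208720) (2 * w - z)) Y Z (factors_of w) (extend_counts l)"

section \<open>Soundness of the integer test\<close>

definition phi_plus :: "real \<Rightarrow> real" where
  "phi_plus x = 1 - 1 / x + (1 / x) ^ 5"

definition phi_minus :: "real \<Rightarrow> real" where
  "phi_minus x = 1 - 1 / x - (1 / x) ^ 5"

text \<open>Common normal form for both ranges. Extracting fifth powers leaves
  \<open>y ^ 4 / (x ^ 2 * z ^ 2)\<close>, where \<open>pi\<close> cancels and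
  \<open>n ^ 2 / (n ^ 2 - 1)\<close> remains; what is left is the exponential and values of
  \<open>phi_plus\<close> and \<open>phi_minus\<close>.\<close>

lemma f_lower_eq:
  assumes "n \<ge> 2"
  defines "x \<equiv> mu (real n - 1)" and "y \<equiv> mu (real n)" and "z \<equiv> mu (real n + 1)"
  shows "f_lower n = exp (x - 2 * y + z) * (real n ^ 2 / (real n ^ 2 - 1)) * (phi_minus x * phi_minus z / phi_plus y ^ 2)"
    and "g_upper n = exp (x - 2 * y + z) * (real n ^ 2 / (real n ^ 2 - 1)) * (phi_plus x * phi_plus z / phi_minus y ^ 2)"
proof -
  have pos: "x > 0" "y > 0" "z > 0" using assms(1) by (auto simp: x_def y_def z_def mu_def)
  have sq: "x ^ 2 = pi ^ 2 * (real n - 1)" "y ^ 2 = pi ^ 2 * real n" "z ^ 2 = pi ^ 2 * (real n + 1)"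
    using assms(1) by (auto simp: x_def y_def z_def mu_def power_mult_distrib)
  have "real n ^ 2 / (real n ^ 2 - 1) = (real n * real n) / ((real n - 1) * (real n + 1))"
    by (simp add: power2_eq_square algebra_simps)
  also have "\<dots> = (y ^ 2 * y ^ 2) / (x ^ 2 * z ^ 2)"
    unfolding sq by simp
  finally have r: "real n ^ 2 / (real n ^ 2 - 1) = y ^ 4 / (x ^ 2 * z ^ 2)" by (simp flip: power_add)
  have m: "x ^ 5 - x ^ 4 - 1 = x ^ 5 * phi_minus x" "x ^ 5 - x ^ 4 + 1 = x ^ 5 * phi_plus x" if "x > 0" for x
  proof -
    have "x ^ 5 * (1 / x) = x ^ 4" "x ^ 5 * (1 / x) ^ 5 = 1"
      using that by (simp_all add: eval_nat_numeral)
    then show "x ^ 5 - x ^ 4 - 1 = x ^ 5 * phi_minus x" "x ^ 5 - x ^ 4 + 1 = x ^ 5 * phi_plus x"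
      unfolding phi_minus_def phi_plus_def right_diff_distrib distrib_left by simp_all
  qed
  have a: "y ^ 14 * (x ^ 5 * a) * (z ^ 5 * c) / (x ^ 7 * z ^ 7 * (y ^ 5 * b) ^ 2) = y ^ 4 / (x ^ 2 * z ^ 2) * (a * c / b ^ 2)" for a b c
  proof -
    have "y ^ 14 = y ^ 4 * y ^ 10" "x ^ 7 = x ^ 2 * x ^ 5" "z ^ 7 = z ^ 2 * z ^ 5" "(y ^ 5 * b) ^ 2 = y ^ 10 * b ^ 2"
      by (simp_all add: power_mult_distrib flip: power_add power_mult)
    moreover have "(A * W) * (S * a) * (T * c) / ((U * S) * (V * T) * (W * b2)) = A / (U * V) * (a * c / b2)"
      if "W \<noteq> 0" "S \<noteq> 0" "T \<noteq> 0" for A W S T U V b2 :: real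
      using that by simp
    moreover have "y ^ 10 \<noteq> 0" "x ^ 5 \<noteq> 0" "z ^ 5 \<noteq> 0" using pos by simp_all
    ultimately show ?thesis by (simp only:)
  qed
  have "f_lower n = exp (x - 2 * y + z) * (y ^ 14 * (x ^ 5 * phi_minus x) * (z ^ 5 * phi_minus z) / (x ^ 7 * z ^ 7 * (y ^ 5 * phi_plus y) ^ 2))"
    unfolding f_lower_def Let_def x_def[symmetric] y_def[symmetric] z_def[symmetric] m(1)[OF pos(1)] m(1)[OF pos(3)] m(2)[OF pos(2)]
    by (simp only: times_divide_eq_right)
  then show "f_lower n = exp (x - 2 * y + z) * (real n ^ 2 / (real n ^ 2 - 1)) * (phi_minus x * phi_minus z / phi_plus y ^ 2)"
    unfolding a r by (simp only: mult.assoc)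
  have "g_upper n = exp (x - 2 * y + z) * (y ^ 14 * (x ^ 5 * phi_plus x) * (z ^ 5 * phi_plus z) / (x ^ 7 * z ^ 7 * (y ^ 5 * phi_minus y) ^ 2))"
    unfolding g_upper_def Let_def x_def[symmetric] y_def[symmetric] z_def[symmetric] m(2)[OF pos(1)] m(2)[OF pos(3)] m(1)[OF pos(2)]
    by (simp only: times_divide_eq_right)
  then show "g_upper n = exp (x - 2 * y + z) * (real n ^ 2 / (real n ^ 2 - 1)) * (phi_plus x * phi_plus z / phi_minus y ^ 2)"
    unfolding a r by (simp only: mult.assoc)
qed

text \<open>Lets an error in \<open>1 / x\<close> be carried through
  \<open>1 / x - 1 / x ^ 5\<close>, where the two terms pull in opposite directions. Each of the
  five monomials in \<open>(u ^ 5 - x ^ 5) / (u - x)\<close> is at most 1/16.\<close>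

lemma minus_pow5_mono:
  fixes x u :: real
  assumes "0 \<le> x" "x \<le> u" "u \<le> 1 / 2"
  shows "x - x ^ 5 \<le> u - u ^ 5"
proof -
  have le: "x ^ i * u ^ (4 - i) \<le> 1 / 16" if "i \<le> 4" for i
  proof -
    have "x ^ i * u ^ (4 - i) \<le> (1 / 2) ^ i * (1 / 2) ^ (4 - i)"
      using assms by (intro mult_mono power_mono) auto
    also have "\<dots> = (1 / 2) ^ 4" using that by (simp flip: power_add)
    finally show ?thesis by (simp add: power_one_over)
  qed
  have "u ^ 5 - x ^ 5 = (u - x) * (u ^ 4 + x * u ^ 3 + x ^ 2 * u ^ 2 + x ^ 3 * u + x ^ 4)"
    by (simp add: eval_nat_numeral algebra_simps)
  also have "\<dots> \<le> (u - x) * 1"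
    using assms le[of 0] le[of 1] le[of 2] le[of 3] le[of 4] by (intro mult_left_mono) auto
  finally show ?thesis by simp
qed

lemma scaled_mu_bounds_mu:
  assumes "scaled_mu_bounds (int m) v"
  shows "(real_of_int v - 2) / 4294967296 \<le> mu (real m)" "mu (real m) \<le> (real_of_int v + 2) / 4294967296"
proof -
  define K where "K = (4294967296 :: real)"
  have b: "(v - 2) * (v - 2) \<le> int m * 182062066495444990528" "int m * 182062066495665208720 \<le> (v + 2) * (v + 2)"
    "85899345920 \<le> v"
    using assms by (auto simp: scaled_mu_bounds_def)
  have b1: "(real_of_int v - 2) ^ 2 \<le> real m * 182062066495444990528"
    using iffD2[OF of_int_le_iff[where 'a = real], OF b(1)] by (simp add: power2_eq_square)
  have b2: "real m * 182062066495665208720 \<le> (real_of_int v + 2) ^ 2"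
    using iffD2[OF of_int_le_iff[where 'a = real], OF b(2)] by (simp add: power2_eq_square)
  have "K * 3.141592653588 \<le> K * pi" "K * pi \<le> K * 3.1415926535899"
    using pi_approx by (intro mult_left_mono; simp add: K_def)+
  then have "(K * 3.141592653588) ^ 2 \<le> (K * pi) ^ 2" "(K * pi) ^ 2 \<le> (K * 3.1415926535899) ^ 2"
    by (intro power_mono; simp add: K_def)+
  then have p: "182062066495444990528 \<le> (K * pi) ^ 2" "(K * pi) ^ 2 \<le> 182062066495665208720"
    by (simp_all add: K_def power2_eq_square)
  have sq: "(K * mu (real m)) ^ 2 = real m * (K * pi) ^ 2"
    by (simp add: mu_def power_mult_distrib)
  have pos: "0 \<le> K * mu (real m)" by (simp add: K_def mu_def)
  have "(real_of_int v - 2) ^ 2 \<le> (K * mu (real m)) ^ 2"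
    unfolding sq using b1 mult_left_mono[OF p(1), of "real m"] by linarith
  then have "real_of_int v - 2 \<le> K * mu (real m)" by (rule power2_le_imp_le) (rule pos)
  then show "(real_of_int v - 2) / 4294967296 \<le> mu (real m)" by (simp add: K_def field_simps)
  have "(K * mu (real m)) ^ 2 \<le> (real_of_int v + 2) ^ 2"
    unfolding sq using b2 mult_left_mono[OF p(2), of "real m"] by linarith
  then have "K * mu (real m) \<le> real_of_int v + 2" by (rule power2_le_imp_le) (use b(3) in simp)
  then show "mu (real m) \<le> (real_of_int v + 2) / 4294967296" by (simp add: K_def field_simps)
qed

lemma int_div_bounds:
  fixes a b :: int
  shows "real_of_int (a div b) \<le> real_of_int a / real_of_int b"
    and "real_of_int a / real_of_int b < real_of_int (a div b) + 1"
  using floor_correct[of "real_of_int a / real_of_int b"] by (simp_all add: floor_divide_of_int_eq)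

text \<open>In units of \<open>1 / K\<close>, the error 2 in \<open>v\<close> costs at most 1 in the
  reciprocal because \<open>v >= 20 * K\<close>, and rounding the quotient costs another, hence the
  slack 2. Both inequalities only need \<open>c\<close> not to be too large, so computing the fifth
  power from \<open>b\<close> with 13 bits dropped is harmless.\<close>

lemma factors_of_correct:
  assumes "scaled_mu_bounds (int m) v"
  defines "x \<equiv> mu (real m)"
  shows "real_of_int (fst (factors_of v) - 2) / 4294967296 \<le> phi_plus x"
    and "phi_minus x \<le> real_of_int (snd (factors_of v) + 2) / 4294967296"
    and "fst (factors_of v) - 2 > 0" "phi_minus x > 0"
proof -
  define K where "K = (4294967296 :: real)"
  define V where "V = real_of_int v"
  define b where "b = scaled_inverse v"
  define B where "B = real_of_int b"
  define c where "c = scaled_pow5 (b div 8192)"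
  define \<beta> where "\<beta> = 1 / x"
  have K1: "K > 100" by (simp add: K_def)
  have KK: "K ^ 2 = 18446744073709551616" by (simp add: K_def power2_eq_square)
  have v: "85899345920 \<le> v" "v \<le> 18446744073709551616" using assms(1) by (auto simp: scaled_mu_bounds_def)
  have V: "20 * K \<le> V" "V \<le> K ^ 2"
    using iffD2[OF of_int_le_iff[where 'a = real], OF v(1)] iffD2[OF of_int_le_iff[where 'a = real], OF v(2)]
    unfolding KK by (simp_all add: V_def K_def)
  have B: "B \<le> K ^ 2 / V" "K ^ 2 / V < B + 1"
    unfolding KK using int_div_bounds[of 18446744073709551616 v]
    by (simp_all add: B_def b_def scaled_inverse_def V_def)
  have V0: "V > 0" "V > 2" using V K1 by linarith+
  have "K ^ 2 / V \<le> K ^ 2 / (20 * K)" using V V0 K1 by (intro divide_left_mono mult_pos_pos) auto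
  also have "\<dots> = K / 20" using K1 by (simp add: power2_eq_square)
  finally have B20: "B \<le> K / 20" using B by linarith
  have "K ^ 2 / V \<ge> 1" using V V0 by (simp add: le_divide_eq)
  then have "B > 0" using B by simp
  then have B1: "B \<ge> 1" by (simp add: B_def)
  have x: "(V - 2) / K \<le> x" "x \<le> (V + 2) / K"
    using scaled_mu_bounds_mu[OF assms(1)] by (simp_all add: x_def V_def K_def)
  have V2: "V - 2 > 0" using V0 by simp
  then have "0 < (V - 2) / K" using K1 by simp
  then have x0: "x > 0" using x(1) by linarith
  have small: "2 * K / (V * (V - 2)) \<le> 1 / K"
  proof -
    have "2 * K * K \<le> (20 * K) * (19 * K)" using K1 by simp
    also have "\<dots> \<le> V * (V - 2)" using V K1 by (intro mult_mono) auto
    finally have "2 * K * K \<le> V * (V - 2)" .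
    then show ?thesis using V0 V2 K1 by (simp add: pos_divide_le_eq pos_le_divide_eq)
  qed
  have recip: "\<beta> \<le> K / A" if "A / K \<le> x" "A > 0" for A
  proof -
    have "1 / x \<le> 1 / (A / K)" using that x0 K1 by (intro divide_left_mono mult_pos_pos) auto
    then show ?thesis by (simp add: \<beta>_def)
  qed
  have recip': "K / A \<le> \<beta>" if "x \<le> A / K" "A > 0" for A
  proof -
    have "1 / (A / K) \<le> 1 / x" using that x0 K1 by (intro divide_left_mono mult_pos_pos) auto
    then show ?thesis by (simp add: \<beta>_def)
  qed
  have KV: "K / V = (K ^ 2 / V) / K" using K1 by (simp add: power2_eq_square)
  have "\<beta> \<le> K / (V - 2)" by (rule recip[OF x(1) V2])
  also have "\<dots> = K / V + 2 * K / (V * (V - 2))"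
    using V0 V2 by (simp add: field_simps)
  also have "\<dots> \<le> (B + 1) / K + 1 / K"
  proof (rule add_mono[OF _ small])
    show "K / V \<le> (B + 1) / K" unfolding KV using B K1 by (intro divide_right_mono) auto
  qed
  finally have b_up: "\<beta> \<le> (B + 2) / K" by (simp add: add_divide_distrib)
  have b_low: "(B - 1) / K \<le> \<beta>"
  proof -
    have BV: "B / K \<le> K / V" unfolding KV using B K1 by (intro divide_right_mono) auto
    have "V \<noteq> 0" "V + 2 \<noteq> 0" using V0 by auto
    then have "K / V = K * (V + 2) / (V * (V + 2))" "K / (V + 2) = K * V / (V * (V + 2))" by simp_all
    moreover have "K * (V + 2) = K * V + 2 * K" by (simp add: algebra_simps)
    ultimately have "K / V = K / (V + 2) + 2 * K / (V * (V + 2))" by (simp only: add_divide_distrib)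
    note BV this
    moreover have "2 * K / (V * (V + 2)) \<le> 2 * K / (V * (V - 2))"
      using V0 V2 K1 by (intro divide_left_mono mult_pos_pos mult_left_mono) auto
    moreover have "K / (V + 2) \<le> \<beta>" using V0 by (intro recip' x(2)) auto
    ultimately have "B / K \<le> \<beta> + 1 / K" using small by linarith
    then show ?thesis by (simp add: diff_divide_distrib)
  qed
  define w where "w = real_of_int (b div 8192)"
  have w: "0 \<le> w" "w * 8192 \<le> B"
  proof -
    have "0 \<le> b" using B1 by (simp add: B_def)
    then show "0 \<le> w" by (simp add: w_def pos_imp_zdiv_nonneg_iff)
    show "w * 8192 \<le> B" using int_div_bounds(1)[of b 8192] by (simp add: w_def B_def)
  qed
  have c: "real_of_int c / K \<le> (B / K) ^ 5"
  proof -
    have "real_of_int c \<le> w ^ 5 / 9223372036854775808"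
      using int_div_bounds(1)[of "(b div 8192) * (b div 8192) * (b div 8192) * (b div 8192) * (b div 8192)" 9223372036854775808]
      by (simp add: c_def scaled_pow5_def w_def eval_nat_numeral mult_ac)
    also have "\<dots> = (w * 8192) ^ 5 / K ^ 4" by (simp add: K_def power_mult_distrib)
    also have "\<dots> \<le> B ^ 5 / K ^ 4" using w by (intro divide_right_mono power_mono) (auto simp: K_def)
    finally have "real_of_int c / K \<le> B ^ 5 / K ^ 4 / K" by (intro divide_right_mono) (auto simp: K_def)
    also have "\<dots> = (B / K) ^ 5" by (simp add: power_divide K_def)
    finally show ?thesis .
  qed
  have c0: "c \<ge> 0"
  proof -
    have "0 \<le> b div 8192" using w(1) by (simp add: w_def)
    then show ?thesis by (simp add: c_def scaled_pow5_def pos_imp_zdiv_nonneg_iff)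
  qed
  have f: "fst (factors_of v) = 4294967296 - b + c" "snd (factors_of v) = 4294967296 - b - c"
    by (simp_all add: factors_of_def factors_of_inverse_def factor_pair_def b_def c_def)
  have \<beta>0: "0 < \<beta>" using x0 by (simp add: \<beta>_def)
  have "(B + 2) / K \<le> (K / 20 + K / 20) / K" using B20 K1 by (intro divide_right_mono) auto
  then have half: "(B + 2) / K \<le> 1 / 10" using K1 by simp
  then have half2: "(B + 2) / K \<le> 1 / 2" by linarith
  have BK: "0 \<le> (B - 1) / K" "(B - 1) / K \<le> B / K" "B / K \<le> (B + 2) / K"
    using B1 K1 by (auto simp: divide_right_mono)
  have "real_of_int (fst (factors_of v) - 2) / K = 1 - (B + 2) / K + real_of_int c / K"
    unfolding f by (simp add: K_def B_def field_simps)
  also have "\<dots> \<le> 1 - (B + 2) / K + ((B + 2) / K) ^ 5"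
  proof -
    have "(B / K) ^ 5 \<le> ((B + 2) / K) ^ 5" using BK by (intro power_mono) linarith+
    then show ?thesis using c by linarith
  qed
  also have "\<dots> \<le> 1 - \<beta> + \<beta> ^ 5"
    using minus_pow5_mono[OF less_imp_le[OF \<beta>0] b_up half2] by linarith
  finally show "real_of_int (fst (factors_of v) - 2) / 4294967296 \<le> phi_plus x"
    by (simp add: phi_plus_def \<beta>_def K_def)
  have "phi_minus x = 1 - \<beta> - \<beta> ^ 5" by (simp add: phi_minus_def \<beta>_def)
  also have "\<dots> \<le> 1 - (B - 1) / K - ((B - 1) / K) ^ 5"
    using b_low power_mono[OF b_low BK(1), of 5] by simp
  also have "\<dots> \<le> 1 - (B - 1) / K - ((B / K) ^ 5 - 1 / K)"
  proof -
    have "B / K \<le> 1 / 2" using BK(3) half2 by linarith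
    then show ?thesis using minus_pow5_mono[OF BK(1,2)] by (simp add: diff_divide_distrib)
  qed
  also have "\<dots> \<le> 1 - (B - 1) / K - (real_of_int c / K - 1 / K)" using c by simp
  also have "\<dots> = real_of_int (snd (factors_of v) + 2) / K"
    unfolding f by (simp add: K_def B_def field_simps)
  finally show "phi_minus x \<le> real_of_int (snd (factors_of v) + 2) / 4294967296" by (simp add: K_def)
  have "real_of_int (fst (factors_of v) - 2) > 0"
    unfolding f using B20 c0 by (simp add: B_def K_def)
  then show "fst (factors_of v) - 2 > 0" by linarith
  have "\<beta> \<le> 1 / 10" using b_up half by linarith
  moreover have "\<beta> ^ 5 \<le> (1 / 10) ^ 5" using \<open>\<beta> \<le> 1 / 10\<close> \<beta>0 by (intro power_mono) auto
  moreover have "(1 / 10 :: real) ^ 5 \<le> 1 / 10" by (simp add: power_one_over)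
  ultimately have "1 - \<beta> - \<beta> ^ 5 > 0" by linarith
  then show "phi_minus x > 0" by (simp add: phi_minus_def \<beta>_def)
qed

lemma exp_nonpos_bounds:
  fixes u :: real
  assumes "u \<le> 0"
  shows "exp u \<le> 1 + u + u ^ 2 / 2" "1 + u + u ^ 2 / 2 + u ^ 3 / 6 \<le> exp u"
proof -
  obtain t where t: "exp u = (\<Sum>m<3. u ^ m / fact m) + exp t / fact 3 * u ^ 3"
    using Maclaurin_exp_le[of u 3] by blast
  have "exp t / fact 3 * u ^ 3 \<le> 0" using assms by (intro mult_nonneg_nonpos) (auto simp: power_le_zero_eq)
  then show "exp u \<le> 1 + u + u ^ 2 / 2" unfolding t by (simp add: eval_nat_numeral)
  obtain t where t: "exp u = (\<Sum>m<4. u ^ m / fact m) + exp t / fact 4 * u ^ 4"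
    using Maclaurin_exp_le[of u 4] by blast
  have "exp t / fact 4 * u ^ 4 \<ge> 0" by simp
  then show "1 + u + u ^ 2 / 2 + u ^ 3 / 6 \<le> exp u" unfolding t by (simp add: eval_nat_numeral)
qed

lemma exp_upper_correct:
  assumes "d \<le> 0"
  shows "exp (real_of_int d / 4294967296) \<le> real_of_int (exp_upper d) / 4294967296"
proof -
  define u where "u = real_of_int d / 4294967296"
  have d: "real_of_int d = 4294967296 * u" by (simp add: u_def)
  have "u \<le> 0" using assms by (simp add: u_def)
  then have "exp u \<le> 1 + u + u ^ 2 / 2" by (rule exp_nonpos_bounds)
  moreover have "real_of_int (d * d) / real_of_int 8589934592 < real_of_int (d * d div 8589934592) + 1"
    by (rule int_div_bounds)
  then have "4294967296 * (u ^ 2 / 2) < real_of_int (d * d div 8589934592) + 1"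
    by (simp add: d power2_eq_square)
  ultimately show ?thesis unfolding exp_upper_def u_def[symmetric] by (simp add: d)
qed

lemma exp_lower_correct:
  assumes "d \<le> 0"
  shows "real_of_int (exp_lower d) / 4294967296 \<le> exp (real_of_int d / 4294967296)"
proof -
  define u where "u = real_of_int d / 4294967296"
  have d: "real_of_int d = 4294967296 * u" by (simp add: u_def)
  have "u \<le> 0" using assms by (simp add: u_def)
  then have "1 + u + u ^ 2 / 2 + u ^ 3 / 6 \<le> exp u" by (rule exp_nonpos_bounds)
  moreover have "real_of_int (d * d div 8589934592) \<le> real_of_int (d * d) / real_of_int 8589934592"
    by (rule int_div_bounds)
  then have "real_of_int (d * d div 8589934592) \<le> 4294967296 * (u ^ 2 / 2)"
    by (simp add: d power2_eq_square)
  moreover have "real_of_int (d * d * d div 110680464442257309696) \<le> real_of_int (d * d * d) / real_of_int 110680464442257309696"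
    by (rule int_div_bounds)
  then have "real_of_int (d * d * d div 110680464442257309696) \<le> 4294967296 * (u ^ 3 / 6)"
    by (simp add: d power3_eq_cube)
  ultimately show ?thesis unfolding exp_lower_def u_def[symmetric] by (simp add: d)
qed

lemma ratio_test_sound:
  fixes n :: nat
  assumes n: "n \<ge> 2"
    and x: "scaled_mu_bounds (int (n - 1)) x" and y: "scaled_mu_bounds (int n) y" and z: "scaled_mu_bounds (int (n + 1)) z"
    and t: "ratio_test (x - 2 * y + z) ((int n * int n - 1) * (int (overpartition_count (n - 1)) * int (overpartition_count (n + 1))))
        (int n * int n * (int (overpartition_count n) * int (overpartition_count n)))
        (factors_of x) (factors_of y) (factors_of z)"
    and q: "overpartition_count n > 0"
  shows "f_lower n < u_seq n \<and> u_seq n < g_upper n"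
proof -
  define K where "K = (4294967296 :: real)"
  have K: "K > 0" by (simp add: K_def)
  define X where "X = mu (real n - 1)"
  define Y where "Y = mu (real n)"
  define Z where "Z = mu (real n + 1)"
  define Q where "Q = real (overpartition_count n)"
  define PR where "PR = real (overpartition_count (n - 1)) * real (overpartition_count (n + 1))"
  have X: "X = mu (real (n - 1))" and Z: "Z = mu (real (n + 1))" using n by (simp_all add: X_def Z_def of_nat_diff add.commute)
  define d where "d = x - 2 * y + z"
  define D where "D = X - 2 * Y + Z"
  have Q0: "Q > 0" using q by (simp add: Q_def)
  have n0: "real n ^ 2 - 1 > 0"
  proof -
    have "2 ^ 2 \<le> real n ^ 2" using n by (intro power_mono) auto
    then show ?thesis by simp
  qed
  note fx = factors_of_correct[OF x, folded X K_def]
  note fy = factors_of_correct[OF y, folded Y_def K_def]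
  note fz = factors_of_correct[OF z, folded Z K_def]
  have Db: "real_of_int (d - 8) / K \<le> D" "D \<le> real_of_int (d + 8) / K"
    using scaled_mu_bounds_mu[OF x, folded X K_def] scaled_mu_bounds_mu[OF y, folded Y_def K_def] scaled_mu_bounds_mu[OF z, folded Z K_def]
    by (simp_all add: D_def d_def diff_divide_distrib add_divide_distrib)
  define Mx My Mz Px Py Pz where defs: "Mx = real_of_int (snd (factors_of x) + 2)" "My = real_of_int (snd (factors_of y) + 2)"
     "Mz = real_of_int (snd (factors_of z) + 2)" "Px = real_of_int (fst (factors_of x) - 2)"
     "Py = real_of_int (fst (factors_of y) - 2)" "Pz = real_of_int (fst (factors_of z) - 2)"
  define Eu where "Eu = real_of_int (exp_upper (d + 8))"
  define El where "El = real_of_int (exp_lower (d - 8))"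
  note tt = t[folded d_def, unfolded ratio_test_def]
  note d8 = conjunct1[OF tt] and t1 = conjunct1[OF conjunct2[OF tt]] and t2 = conjunct2[OF conjunct2[OF tt]]
  have T1: "Eu * (Mx * Mz) * (real n ^ 2 * Q ^ 2) < K * (Py * Py) * ((real n ^ 2 - 1) * PR)"
    using iffD2[OF of_int_less_iff[where 'a = real], OF t1]
    by (simp only: Eu_def defs Q_def PR_def K_def power2_eq_square of_int_mult of_int_add of_int_diff of_int_of_nat_eq of_int_numeral of_int_1)
  have T2: "K * (My * My) * ((real n ^ 2 - 1) * PR) < El * (Px * Pz) * (real n ^ 2 * Q ^ 2)"
    using iffD2[OF of_int_less_iff[where 'a = real], OF t2]
    by (simp only: El_def defs Q_def PR_def K_def power2_eq_square of_int_mult of_int_add of_int_diff of_int_of_nat_eq of_int_numeral of_int_1)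
  have eu: "exp D \<le> Eu / K"
  proof -
    have "exp D \<le> exp (real_of_int (d + 8) / K)" using Db by (simp only: exp_le_cancel_iff)
    also have "\<dots> \<le> Eu / K" using exp_upper_correct[OF d8] by (simp only: Eu_def K_def)
    finally show ?thesis .
  qed
  have el: "El / K \<le> exp D"
  proof -
    have "El / K \<le> exp (real_of_int (d - 8) / K)"
      unfolding El_def K_def using d8 by (intro exp_lower_correct) simp
    also have "\<dots> \<le> exp D" using Db by (simp only: exp_le_cancel_iff)
    finally show ?thesis .
  qed
  have Ppos: "Px > 0" "Py > 0" "Pz > 0" using fx fy fz unfolding defs by (simp_all only: of_int_0_less_iff)
  have pp: "phi_plus X \<ge> Px / K" "phi_plus Y \<ge> Py / K" "phi_plus Z \<ge> Pz / K"
    using fx fy fz by (simp_all add: defs)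
  have pm: "phi_minus X \<le> Mx / K" "phi_minus Y \<le> My / K" "phi_minus Z \<le> Mz / K"
    using fx fy fz by (simp_all add: defs)
  have pm0: "phi_minus X > 0" "phi_minus Y > 0" "phi_minus Z > 0" using fx fy fz by simp_all
  have "0 < Py / K" using Ppos K by simp
  then have pp0: "phi_plus Y > 0" using pp(2) by linarith
  have u: "u_seq n = PR / Q ^ 2" by (simp add: u_seq_def PR_def Q_def)
  have PR0: "PR \<ge> 0" by (simp add: PR_def)
  have "exp D * (phi_minus X * phi_minus Z) * (real n ^ 2 * Q ^ 2) \<le> (Eu / K) * ((Mx / K) * (Mz / K)) * (real n ^ 2 * Q ^ 2)"
  proof (intro mult_right_mono mult_mono eu pm)
    show "0 \<le> Eu / K" using eu exp_ge_zero[of D] by linarith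
    show "0 \<le> Mx / K" using pm(1) pm0(1) by linarith
    show "0 \<le> phi_minus Z" "0 \<le> phi_minus X * phi_minus Z" using pm0 by simp_all
  qed simp
  also have "\<dots> = Eu * (Mx * Mz) * (real n ^ 2 * Q ^ 2) / K ^ 3" by (simp add: power3_eq_cube)
  also have "\<dots> < K * (Py * Py) * ((real n ^ 2 - 1) * PR) / K ^ 3"
    using T1 K by (intro divide_strict_right_mono) auto
  also have "\<dots> = (Py / K) ^ 2 * ((real n ^ 2 - 1) * PR)" using K by (simp add: power3_eq_cube power2_eq_square)
  also have "\<dots> \<le> phi_plus Y ^ 2 * ((real n ^ 2 - 1) * PR)"
    using pp Ppos K n0 PR0 by (intro mult_right_mono power_mono mult_nonneg_nonneg) auto
  finally have L: "exp D * (phi_minus X * phi_minus Z) * (real n ^ 2 * Q ^ 2) < phi_plus Y ^ 2 * ((real n ^ 2 - 1) * PR)" .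
  have "phi_minus Y ^ 2 * ((real n ^ 2 - 1) * PR) \<le> (My / K) ^ 2 * ((real n ^ 2 - 1) * PR)"
    using pm pm0 n0 PR0 by (intro mult_right_mono power_mono mult_nonneg_nonneg) auto
  also have "\<dots> = K * (My * My) * ((real n ^ 2 - 1) * PR) / K ^ 3" using K by (simp add: power3_eq_cube power2_eq_square)
  also have "\<dots> < El * (Px * Pz) * (real n ^ 2 * Q ^ 2) / K ^ 3"
    using T2 K by (intro divide_strict_right_mono) auto
  also have "\<dots> = (El / K) * ((Px / K) * (Pz / K)) * (real n ^ 2 * Q ^ 2)" by (simp add: power3_eq_cube)
  also have "\<dots> \<le> exp D * ((Px / K) * (Pz / K)) * (real n ^ 2 * Q ^ 2)"
    using el Ppos K by (intro mult_right_mono) auto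
  also have "\<dots> \<le> exp D * (phi_plus X * phi_plus Z) * (real n ^ 2 * Q ^ 2)"
    using pp Ppos K by (intro mult_right_mono mult_left_mono mult_mono) (auto intro: order.trans[OF _ pp(1)])
  finally have U: "phi_minus Y ^ 2 * ((real n ^ 2 - 1) * PR) < exp D * (phi_plus X * phi_plus Z) * (real n ^ 2 * Q ^ 2)" .
  have frac1: "e * (N / M) * (A / P) < R / S" if "e * A * (N * S) < P * (M * R)" "0 < M" "0 < P" "0 < S" for e N M A P R S :: real
  proof -
    have "e * (N / M) * (A / P) = e * A * (N * S) / (P * M * S)" using that by (simp add: mult_ac)
    also have "\<dots> < P * (M * R) / (P * M * S)" using that by (intro divide_strict_right_mono) auto
    also have "\<dots> = R / S" using that by simp
    finally show ?thesis .
  qed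
  have frac2: "R / S < e * (N / M) * (A / P)" if "P * (M * R) < e * A * (N * S)" "0 < M" "0 < P" "0 < S" for e N M A P R S :: real
  proof -
    have "R / S = P * (M * R) / (P * M * S)" using that by (simp add: mult_ac)
    also have "\<dots> < e * A * (N * S) / (P * M * S)" using that by (intro divide_strict_right_mono) auto
    also have "\<dots> = e * (N / M) * (A / P)" using that by (simp add: mult_ac)
    finally show ?thesis .
  qed
  show ?thesis
    unfolding u f_lower_eq[OF n, folded X_def Y_def Z_def, folded D_def]
    using L U Q0 n0 pp0 pm0 by (intro conjI frac1 frac2) simp_all
qed

text \<open>A window \<open>n - 1, n, n + 1\<close> moves upwards. \<open>x\<close> and
  \<open>y\<close> are already verified on entry, \<open>z\<close> is checked in the current round,
  and \<open>l\<close> lists the counts from \<open>n + 1\<close> down to 0.\<close>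

lemma ratio_tests_sound:
  assumes "ratio_tests k (int n) x y z w (factors_of x) (factors_of y) (factors_of z) l"
    and "n \<ge> 2" "scaled_mu_bounds (int (n - 1)) x" "scaled_mu_bounds (int n) y"
    and "length l = n + 2" "\<And>i. i < n + 2 \<Longrightarrow> l ! i = int (overpartition_count (n + 1 - i))"
    and "n \<le> j" "j < n + k"
  shows "f_lower j < u_seq j \<and> u_seq j < g_upper j"
  using assms
proof (induction k arbitrary: n x y z w l)
  case 0
  then show ?case by simp
next
  case (Suc k)
  have bz: "scaled_mu_bounds (int (n + 1)) z"
    using Suc.prems(1) by (simp add: add.commute)
  show ?case
  proof (cases "j = n")
    case True
    have l: "l ! 2 = int (overpartition_count (n - 1))" "l ! 1 = int (overpartition_count n)" "l ! 0 = int (overpartition_count (n + 1))"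
      using Suc.prems(6)[of 2] Suc.prems(6)[of 1] Suc.prems(6)[of 0] Suc.prems(2) by simp_all
    have "overpartition_count n > 0" by (rule overpartition_count_pos)
    then show ?thesis unfolding True
      using Suc.prems l by (intro ratio_test_sound[OF Suc.prems(2,3,4) bz]) simp_all
  next
    case False
    show ?thesis
    proof (rule Suc.IH)
      show "ratio_tests k (int (n + 1)) y z w (newton2 ((int n + 3) * 182062066495665208720) (2 * w - z)) (factors_of y) (factors_of z) (factors_of w) (extend_counts l)"
        using Suc.prems(1) by (simp add: add.commute)
      show "length (extend_counts l) = n + 1 + 2" using extend_counts_correct(1)[of l "n + 2"] Suc.prems(5,6) by simp
      show "extend_counts l ! i = int (overpartition_count (n + 1 + 1 - i))" if "i < n + 1 + 2" for i
        using extend_counts_correct(2)[of l "n + 2" i] Suc.prems(5,6) that by simp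
    qed (use Suc.prems False bz in auto)
  qed
qed


lemma range_55_200:
  assumes "55 \<le> n" "n < 200"
  shows "f_lower n < u_seq n \<and> u_seq n < g_upper n"
proof (rule ratio_tests_sound)
  \<comment> \<open>The four numerals approximate \<open>2 ^ 32 * mu m\<close> for
    \<open>m = 54, 55, 56, 57\<close>; the first two are verified separately below, the others
    within the run. \<open>counts 56\<close> reaches up to \<open>n + 1\<close>.\<close>
  show "ratio_tests 145 (int 55) 99153172368 100067045810 100972648394 101870200698
     (factors_of 99153172368) (factors_of 100067045810) (factors_of 100972648394) (counts 56)"
    unfolding of_nat_numeral by code_simp
  show "scaled_mu_bounds (int (55 - 1)) 99153172368" "scaled_mu_bounds (int 55) 100067045810"
    by (simp_all add: scaled_mu_bounds_def)
qed (use assms counts_correct[of 56] in auto)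

lemma range_200_301:
  assumes "200 \<le> n" "n < 301"
  shows "f_lower n < u_seq n \<and> u_seq n < g_upper n"
proof (rule ratio_tests_sound)
  show "ratio_tests 101 (int 200) 190342720461 190820369193 191296825288 191772097637
     (factors_of 190342720461) (factors_of 190820369193) (factors_of 191296825288) (counts 201)"
    unfolding of_nat_numeral by code_simp
  show "scaled_mu_bounds (int (200 - 1)) 190342720461" "scaled_mu_bounds (int 200) 190820369193"
    by (simp_all add: scaled_mu_bounds_def)
qed (use assms counts_correct[of 201] in auto)

section \<open>Conclusion\<close>

text \<open>The seventh power of \<open>y / 27 <= exp (y / 27 - 1)\<close> reduces everything to
  \<open>y = 27\<close>, where \<open>exp (1 / 2) >= 13 / 8\<close> raised to the power 54 suffices.
  The exponent 7 is the 5 of \<open>phi_plus\<close> plus 2 from \<open>m <= x ^ 2 / 9\<close>; 19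
  is just enough for \<open>8 / 9 * 2 ^ 7 <= 6 * 19\<close>.\<close>

lemma exp_dominates_power7:
  fixes y :: real
  assumes y: "y \<ge> 27"
  shows "19 * y ^ 7 < exp y"
proof -
  have "y / 27 \<le> exp (y / 27 - 1)" using exp_ge_add_one_self[of "y / 27 - 1"] by simp
  then have "(y / 27) ^ 7 \<le> exp (y / 27 - 1) ^ 7" using y by (intro power_mono) auto
  also have "\<dots> = exp (7 * (y / 27 - 1))" by (simp flip: exp_of_nat_mult)
  also have "\<dots> \<le> exp (y - 27)" using y by simp
  finally have "19 * (y / 27) ^ 7 * 27 ^ 7 \<le> 19 * exp (y - 27) * 27 ^ 7" by (intro mult_right_mono mult_left_mono) auto
  then have "19 * y ^ 7 \<le> (19 * 27 ^ 7) * exp (y - 27)" by (simp add: power_divide)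
  also have "19 * 27 ^ 7 < exp (27 :: real)"
  proof -
    have "1 + 1 / 2 + (1 / 2) ^ 2 / 2 \<le> exp (1 / 2 :: real)" by (rule exp_lower_Taylor_quadratic) simp
    then have "(13 / 8) ^ 54 \<le> exp (1 / 2 :: real) ^ 54" by (intro power_mono) (auto simp: power2_eq_square)
    also have "\<dots> = exp 27" by (simp flip: exp_of_nat_mult)
    finally have "(13 / 8 :: real) ^ 54 \<le> exp 27" .
    moreover have "19 * 27 ^ 7 < (13 / 8 :: real) ^ 54" by (simp add: power_divide)
    ultimately show ?thesis by simp
  qed
  finally show ?thesis by (simp add: exp_add[symmetric])
qed

text \<open>From \<open>m >= 300\<close> follows \<open>x >= 54\<close>, so the power estimate
  applies at \<open>x / 2 >= 27\<close> and puts the error of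
  \<open>overpartition_count_estimate\<close> below the allowance
  \<open>(1 / x) ^ 5\<close>.\<close>

lemma overpartition_count_bounds:
  assumes "m \<ge> 300"
  defines "x \<equiv> mu (real m)"
  shows "exp x / (8 * real m) * phi_minus x < real (overpartition_count m)"
    and "real (overpartition_count m) < exp x / (8 * real m) * phi_plus x"
    and "phi_minus x > 0" "phi_plus x > 0"
proof -
  define s where "s = sqrt (real m)"
  have s2: "real m = s ^ 2" by (simp add: s_def)
  have "17.3 ^ 2 \<le> real m" using assms(1) by (simp add: power2_eq_square)
  then have s: "s \<ge> 17.3" unfolding s_def by (rule real_le_rsqrt)
  have xs: "x = pi * s" by (simp add: x_def s_def mu_def)
  have "3.14 * 17.3 \<le> pi * s" using s pi_approx by (intro mult_mono) auto
  then have x: "x \<ge> 54" unfolding xs by simp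
  have "real 17 \<le> s" using s by simp
  then have est: "\<bar>real (overpartition_count m) - exp x / (8 * real m) * (1 - 1 / x)\<bar> \<le> exp (x / 2) / 6"
    using overpartition_count_estimate[of s m] s2 by (simp add: xs)
  have err: "exp (x / 2) / 6 < exp x / (8 * real m) * (1 / x) ^ 5"
  proof -
    have "9 * s ^ 2 \<le> pi ^ 2 * s ^ 2" using pi_gt3 power_mono[of 3 pi 2] by (intro mult_right_mono) auto
    then have "9 * real m \<le> x ^ 2" by (simp add: s2 xs power_mult_distrib)
    then have "8 * real m * x ^ 5 \<le> 8 * (x ^ 2 / 9) * x ^ 5" using x by (intro mult_right_mono) auto
    also have "\<dots> = 8 / 9 * 2 ^ 7 * (x / 2) ^ 7" by (simp add: power_divide flip: power_add)
    also have "\<dots> \<le> 6 * (19 * (x / 2) ^ 7)" using x by simp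
    also have "\<dots> < 6 * exp (x / 2)" using exp_dominates_power7[of "x / 2"] x by simp
    finally have "8 * real m * x ^ 5 * exp (x / 2) < 6 * exp (x / 2) * exp (x / 2)" by simp
    also have "6 * exp (x / 2) * exp (x / 2) = 6 * exp x" by (simp add: exp_add[symmetric])
    finally show ?thesis using x assms(1) by (simp add: field_simps power_one_over)
  qed
  show "exp x / (8 * real m) * phi_minus x < real (overpartition_count m)"
    "real (overpartition_count m) < exp x / (8 * real m) * phi_plus x"
    using est err unfolding phi_minus_def phi_plus_def right_diff_distrib distrib_left abs_le_iff by linarith+
  have "1 / x \<le> 1 / 54" using x by simp
  moreover have "(1 / x) ^ 5 \<le> (1 / 54) ^ 5" using x by (intro power_mono) (auto intro: divide_left_mono)
  moreover have "(1 / 54 :: real) ^ 5 \<le> 1 / 54" by (simp add: power_one_over)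
  moreover have "(1 / x) ^ 5 \<ge> 0" using x by simp
  ultimately show "phi_minus x > 0" "phi_plus x > 0" unfolding phi_minus_def phi_plus_def by linarith+
qed

text \<open>The prefactors \<open>exp x / (8 * m)\<close> at the three arguments combine exactly to
  the exponential and rational part of \<open>f_lower\<close> and \<open>g_upper\<close>, so the two
  functions are quotients of the individual bounds. The start 301 makes \<open>n - 1\<close> at
  least 300.\<close>

lemma large_range:
  assumes "n \<ge> 301"
  shows "f_lower n < u_seq n \<and> u_seq n < g_upper n"
proof -
  define x where "x = mu (real n - 1)"
  define y where "y = mu (real n)"
  define z where "z = mu (real n + 1)"
  have xm: "x = mu (real (n - 1))" and zm: "z = mu (real (n + 1))"
    using assms by (simp_all add: x_def z_def of_nat_diff add.commute)
  define a where "a = exp x / (8 * real (n - 1))"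
  define b where "b = exp y / (8 * real n)"
  define c where "c = exp z / (8 * real (n + 1))"
  have pos: "a > 0" "b > 0" "c > 0" using assms by (auto simp: a_def b_def c_def)
  define p where "p = real (overpartition_count (n - 1))"
  define q where "q = real (overpartition_count n)"
  define r where "r = real (overpartition_count (n + 1))"
  have "n - 1 \<ge> 300" "n \<ge> 300" "n + 1 \<ge> 300" using assms by auto
  note bx = overpartition_count_bounds[OF this(1), folded xm, folded a_def p_def]
    and bY = overpartition_count_bounds[OF this(2), folded y_def, folded b_def q_def]
    and bz = overpartition_count_bounds[OF this(3), folded zm, folded c_def r_def]
  have ee: "exp (x - 2 * y + z) = exp x * exp z / exp y ^ 2"
    by (simp add: exp_diff exp_add exp_double power2_eq_square)
  have nn: "real n ^ 2 / (real n ^ 2 - 1) = real n ^ 2 / (real (n - 1) * real (n + 1))"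
    using assms by (simp add: of_nat_diff power2_eq_square algebra_simps)
  have abc: "exp (x - 2 * y + z) * (real n ^ 2 / (real n ^ 2 - 1)) = a * c / b ^ 2"
  proof -
    have frac: "(X * Z / Y ^ 2) * (N ^ 2 / (M * L)) = (X / (8 * M)) * (Z / (8 * L)) / (Y / (8 * N)) ^ 2"
      if "N \<noteq> 0" for X Y Z N M L :: real
      using that by (simp add: power_divide power_mult_distrib mult_ac)
    show ?thesis unfolding a_def b_def c_def ee nn by (rule frac) (use assms in simp)
  qed
  have n2: "n \<ge> 2" using assms by simp
  have f: "f_lower n = (a * phi_minus x) * (c * phi_minus z) / (b * phi_plus y) ^ 2"
    and g: "g_upper n = (a * phi_plus x) * (c * phi_plus z) / (b * phi_minus y) ^ 2"
    unfolding f_lower_eq[OF n2, folded x_def y_def z_def] abc by (simp_all add: power_mult_distrib)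
  have u: "u_seq n = p * r / q ^ 2" by (simp add: u_seq_def p_def q_def r_def)
  have pm: "0 < a * phi_minus x" "0 < b * phi_minus y" "0 < c * phi_minus z" "0 < b * phi_plus y"
    using pos bx bY bz by simp_all
  have "(a * phi_minus x) * (c * phi_minus z) < p * r"
    using bx bz pm by (intro mult_strict_mono) auto
  moreover have "q ^ 2 \<le> (b * phi_plus y) ^ 2" using bY by (intro power_mono) (auto simp: q_def)
  moreover have "0 < q" using bY pm by linarith
  ultimately have l: "f_lower n < u_seq n"
    unfolding f u using pm by (intro frac_less) auto
  have "p * r < (a * phi_plus x) * (c * phi_plus z)"
    using bx bz pm pos by (intro mult_strict_mono) (auto simp: p_def r_def)
  moreover have "(b * phi_minus y) ^ 2 \<le> q ^ 2" using bY pm by (intro power_mono) auto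
  ultimately have "u_seq n < g_upper n"
    unfolding g u using pm by (intro frac_less) (auto simp: p_def r_def)
  with l show ?thesis by simp
qed

theorem theorem3p1:
  fixes n :: nat
  assumes "n \<ge> 55"
  shows "f_lower n < u_seq n \<and> u_seq n < g_upper n"
  using assms range_55_200[of n] range_200_301[of n] large_range[of n]
  by (cases "n < 200"; cases "n < 301") auto

end
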